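(* Consider the Čech or the Vietoris-Rips filtration and the Poisson or the binomial sampling scheme. Let $\kappa$ be a bounded probability density on $[0,1]^d$ and let $(\hat\kappa_n:n\in\mathbb{N})$ be a sequence of density estimators of $\kappa$ with $\lim_{n\to\infty}\|\kappa-\hat\kappa_n\|_\infty=0$ almost surely (respectively, in probability). Additionally, let $(J_n:n\in\mathbb{N})$ be a sequence of positive integers diverging to infinity such that, as $n\to\infty$, $$J_n\|\hat\kappa_n-\kappa\|_\infty\to0\quad\text{and}\quad\sqrt{\frac{n}{J_n}}\;\|\hat\kappa_n-\kappa\|_\infty\to0\quad\text{almost surely (respectively, in probability).}$$ Set $b_n=J_n^{1/2}\|\hat\kappa_n-\kappa\|_\infty^{1/2}+\sqrt{nJ_n^{-1}}\,\|\hat\kappa_n-\kappa\|_\infty$. Then $$b_n^{-1}\cdot d_W^{\mathfrak{D}}\big((\overline{\chi}^*_n(t))_{t\in[0,T]},(\overline{\chi}_n(t))_{t\in[0,T]}\big)=O(1)\quad\text{almost surely (respectively, in probability).}$$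
   Context: For a finite set $P\subset\mathbb{R}^d$ and $t\ge 0$, the Čech complex is $\mathcal{C}_t(P)=\{\emptyset\ne\sigma\subseteq P:\bigcap_{x\in\sigma}B(x,t)\ne\emptyset\}$, where $B(x,t)$ is the closed Euclidean ball, and the Vietoris-Rips complex is $\mathcal{R}_t(P)=\{\emptyset\ne\sigma\subseteq P:\operatorname{diam}(\sigma)\le t\}$. $\mathcal{K}_t$ denotes either one of these (the choice being fixed). A simplex $\sigma$ has dimension $\#\sigma-1$. The Euler characteristic of a finite simplicial complex $\mathcal{K}$ is $\chi(\mathcal{K})=\sum_{k\ge0}(-1)^k\#\{\sigma\in\mathcal{K}:\dim\sigma=k\}$. Fix $T\in(0,\infty)$. For $n\in\mathbb{N}$, let $\mathcal{P}_n$ be a Poisson process with intensity function $n\kappa$, and $\mathbb{X}_n=\{X_1,\dots,X_n\}$ with $X_i$ i.i.d. with density $\kappa$ (binomial process). Put $\mathcal{K}_{t,n}=\mathcal{K}_t(n^{1/d}\mathcal{P}_n)$ in the Poisson sampling scheme and $\mathcal{K}_{t,n}=\mathcal{K}_t(n^{1/d}\mathbb{X}_n)$ in the binomial sampling scheme, and $\overline{\chi}_n(t)=n^{-1/2}(\chi(\mathcal{K}_{t,n})-\mathbb{E}[\chi(\mathcal{K}_{t,n})])$, $t\in[0,T]$. Bootstrap: $\hat\kappa_n$ is a (random) probability density on $[0,1]^d$ computed from the sample $\mathcal{P}_n$, resp. $\mathbb{X}_n$. Conditionally on the sample (and $\hat\kappa_n$), one draws a Poisson process $\mathcal{P}^*_n=\{X_1^*,\dots,X^*_{N_n^*}\}$,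 resp. a binomial process $\mathbb{X}^*_n=\{X^*_1,\dots,X^*_n\}$, where the $X_i^*$ are i.i.d. with density $\hat\kappa_n$ and $N_n^*$ is Poisson distributed with mean $n$ and independent of all other random variables. Put $\mathcal{K}^*_t=\mathcal{K}_t(n^{1/d}\mathcal{P}^*_n)$, resp. $\mathcal{K}_t(n^{1/d}\mathbb{X}^*_n)$, and $\overline{\chi}^*_n(t)=n^{-1/2}(\chi(\mathcal{K}^*_t)-\mathbb{E}^*[\chi(\mathcal{K}^*_t)])$, where $\mathbb{E}^*$ is the expectation conditional on the sample. $\mathfrak{D}=D([0,T])$ is the space of càdlàg functions on $[0,T]$ with the sup-norm, and $d_W^{\mathfrak{D}}(\mu_1,\mu_2)=\sup\{|\int f\,d\mu_1-\int f\,d\mu_2|: f:\mathfrak{D}\to\mathbb{R}\text{ Lipschitz w.r.t. }\|\cdot\|_\infty\text{ with constant}\le1\}$ is the Kantorovich-Wasserstein distance on it. In $d_W^{\mathfrak{D}}$ above, $(\overline{\chi}^*_n(t))_t$ stands for its conditional law given the sample and $(\overline{\chi}_n(t))_t$ for its (unconditional) law. "$O(1)$ in probability" means bounded in probability (tight). *)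

theory Defs
  imports "HOL-Probability.Probability"
begin

section \<open>Filtrations and their Euler characteristic\<close>

datatype filtration = Cech | Rips

fun filtration_complex :: "filtration \<Rightarrow> real \<Rightarrow> 'a::euclidean_space set \<Rightarrow> 'a set set" where
  "filtration_complex Cech t P = {\<sigma>. \<sigma> \<noteq> {} \<and> \<sigma> \<subseteq> P \<and> (\<Inter>x\<in>\<sigma>. cball x t) \<noteq> {}}"
| "filtration_complex Rips t P = {\<sigma>. \<sigma> \<noteq> {} \<and> \<sigma> \<subseteq> P \<and> diameter \<sigma> \<le> t}"

text \<open>A simplex with \<open>k + 1\<close> vertices has dimension \<open>k\<close>. For a finite complex only finitely many
  terms of the series are nonzero.\<close>

definition euler_char :: "'a set set \<Rightarrow> real" where
  "euler_char K = (\<Sum>k. (-1) ^ k * real (card {\<sigma> \<in> K. card \<sigma> = k + 1}))"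

text \<open>\<open>\<chi>(\<K>\<^sub>t(n\<^sup>1\<^sup>/\<^sup>d P))\<close> for a configuration \<open>P\<close> in \<open>\<real>\<^sup>d\<close>, \<open>d = CARD('d)\<close>.\<close>

definition scaled_euler_char :: "filtration \<Rightarrow> nat \<Rightarrow> real \<Rightarrow> (real ^ 'd) set \<Rightarrow> real" where
  "scaled_euler_char F n t P =
     euler_char (filtration_complex F t ((\<lambda>x. root CARD('d) (real n) *\<^sub>R x) ` P))"

section \<open>Cadlag functions and the Wasserstein distance\<close>

text \<open>The laws of the Euler characteristic processes do not live on the Borel sets of the
  (non-separable) sup-norm topology, since the jump times are continuously distributed. The path
  space therefore carries the \<sigma>-algebra generated by the coordinate projections, i.e. the trace of
  the product \<sigma>-algebra. Elements are functions that are \<open>undefined\<close> outside \<open>{0..T}\<close>.\<close>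

definition cadlag_functions :: "real \<Rightarrow> (real \<Rightarrow> real) set" where
  "cadlag_functions T = {x \<in> extensional {0..T}.
     (\<forall>t\<in>{0..<T}. (x \<longlongrightarrow> x t) (at_right t)) \<and>
     (\<forall>t\<in>{0<..T}. \<exists>l. (x \<longlongrightarrow> l) (at_left t))}"

definition cadlag_space :: "real \<Rightarrow> (real \<Rightarrow> real) measure" where
  "cadlag_space T = restrict_space (\<Pi>\<^sub>M t\<in>{0..T}. borel) (cadlag_functions T)"

definition sup_dist :: "real \<Rightarrow> (real \<Rightarrow> real) \<Rightarrow> (real \<Rightarrow> real) \<Rightarrow> real" where
  "sup_dist T x y = (SUP t\<in>{0..T}. \<bar>x t - y t\<bar>)"

text \<open>Measurability of the Lipschitz test functions is what makes the integrals meaningful;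
  on a non-measurable function the Bochner integral would silently be \<open>0\<close>.\<close>

definition wasserstein_dist ::
  "real \<Rightarrow> (real \<Rightarrow> real) measure \<Rightarrow> (real \<Rightarrow> real) measure \<Rightarrow> ennreal" where
  "wasserstein_dist T \<mu> \<nu> =
     (SUP f\<in>{f \<in> borel_measurable (cadlag_space T).
         \<forall>x\<in>cadlag_functions T. \<forall>y\<in>cadlag_functions T. \<bar>f x - f y\<bar> \<le> sup_dist T x y}.
       ennreal \<bar>(\<integral>x. f x \<partial>\<mu>) - (\<integral>x. f x \<partial>\<nu>)\<bar>)"

section \<open>The centred and normalised Euler characteristic process\<close>

text \<open>\<open>S\<close> is a random finite point configuration on the probability space \<open>M\<close>.\<close>

definition chi_bar ::
  "filtration \<Rightarrow> real \<Rightarrow> nat \<Rightarrow> 'w measure \<Rightarrow> ('w \<Rightarrow> (real ^ 'd) set) \<Rightarrow> 'w \<Rightarrow> real \<Rightarrow> real" where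
  "chi_bar F T n M S \<omega> = (\<lambda>t\<in>{0..T}. real n powr (-1/2) *
     (scaled_euler_char F n t (S \<omega>) - (\<integral>\<omega>'. scaled_euler_char F n t (S \<omega>') \<partial>M)))"

definition chi_bar_law ::
  "filtration \<Rightarrow> real \<Rightarrow> nat \<Rightarrow> 'w measure \<Rightarrow> ('w \<Rightarrow> (real ^ 'd) set) \<Rightarrow> (real \<Rightarrow> real) measure" where
  "chi_bar_law F T n M S = distr M (cadlag_space T) (chi_bar F T n M S)"

section \<open>Densities, point processes and sampling schemes\<close>

text \<open>Densities on \<open>[0,1]\<^sup>d\<close> are extended by \<open>0\<close> to \<open>\<real>\<^sup>d\<close>.\<close>

definition unit_cube_density :: "(real ^ 'd \<Rightarrow> real) \<Rightarrow> bool" where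
  "unit_cube_density f \<longleftrightarrow> f \<in> borel_measurable borel \<and> (\<forall>x. 0 \<le> f x) \<and>
     (\<forall>x. x \<notin> cbox 0 1 \<longrightarrow> f x = 0) \<and> (\<integral>\<^sup>+x. ennreal (f x) \<partial>lborel) = 1"

text \<open>The \<open>L\<^sup>\<infinity>\<close>-norm with respect to Lebesgue measure. The value is in \<open>ennreal\<close> because an
  estimator need not be bounded.\<close>

definition Linf_norm :: "(real ^ 'd \<Rightarrow> real) \<Rightarrow> ennreal" where
  "Linf_norm f = esssup lborel (\<lambda>x. ennreal \<bar>f x\<bar>)"

text \<open>The space of finite configurations, with the \<sigma>-algebra generated by the counting maps.\<close>

definition config_space :: "'a::topological_space set measure" where
  "config_space = sigma {c. finite c}
     {{c. finite c \<and> card (c \<inter> B) = k} | B k. B \<in> sets borel}"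

text \<open>A Poisson process with integrable intensity function \<open>f\<close>, as a random finite set. The Poisson
  weights are written out because \<^const>\<open>poisson_pmf\<close> is unspecified at mean \<open>0\<close>.\<close>

definition poisson_process ::
  "'w measure \<Rightarrow> (real ^ 'd \<Rightarrow> real) \<Rightarrow> ('w \<Rightarrow> (real ^ 'd) set) \<Rightarrow> bool" where
  "poisson_process M f P \<longleftrightarrow>
     P \<in> M \<rightarrow>\<^sub>M config_space \<and>
     (\<forall>B\<in>sets borel. \<forall>k. measure M {\<omega> \<in> space M. card (P \<omega> \<inter> B) = k} =
        (let r = measure (density lborel (\<lambda>x. ennreal (f x))) B in r ^ k / fact k * exp (- r))) \<and>
     (\<forall>(m::nat) B. (\<forall>i<m. B i \<in> sets borel) \<and> disjoint_family_on B {..<m} \<longrightarrow>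
        prob_space.indep_vars M (\<lambda>_. count_space UNIV) (\<lambda>i \<omega>. card (P \<omega> \<inter> B i)) {..<m})"

datatype scheme = Poisson | Binomial

text \<open>\<open>S n\<close> is the sample at stage \<open>n\<close>. In the binomial scheme it consists of the first \<open>n\<close> members
  of one i.i.d. sequence; in the Poisson scheme nothing is prescribed about the joint law of
  different stages.\<close>

fun sampling :: "scheme \<Rightarrow> 'w measure \<Rightarrow> (real ^ 'd \<Rightarrow> real) \<Rightarrow> (nat \<Rightarrow> 'w \<Rightarrow> (real ^ 'd) set) \<Rightarrow> bool"
where
  "sampling Poisson M \<kappa> S \<longleftrightarrow> (\<forall>n\<ge>1. poisson_process M (\<lambda>x. real n * \<kappa> x) (S n))"
| "sampling Binomial M \<kappa> S \<longleftrightarrow> (\<exists>X :: nat \<Rightarrow> 'w \<Rightarrow> real ^ 'd.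
     prob_space.indep_vars M (\<lambda>_. borel) X {1..} \<and>
     (\<forall>i\<ge>1. distributed M lborel (X i) (\<lambda>x. ennreal (\<kappa> x))) \<and>
     (\<forall>n\<ge>1. \<forall>\<omega>\<in>space M. S n \<omega> = (\<lambda>i. X i \<omega>) ` {1..n}))"

section \<open>The bootstrap\<close>

text \<open>Given that the estimated density is \<open>k\<close>, the bootstrap sample is \<open>{X\<^sub>1, \<dots>, X\<^sub>N}\<close> with
  \<open>X\<^sub>i\<close> i.i.d. with density \<open>k\<close> and an independent sample size \<open>N\<close>. The conditional law of the
  bootstrap data given the original sample is thus the kernel \<open>\<omega> \<mapsto> boot_space s n (k \<omega>)\<close>.\<close>

fun sample_size_pmf :: "scheme \<Rightarrow> nat \<Rightarrow> nat pmf" where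
  "sample_size_pmf Poisson n = poisson_pmf (real n)"
| "sample_size_pmf Binomial n = return_pmf n"

definition boot_space ::
  "scheme \<Rightarrow> nat \<Rightarrow> (real ^ 'd \<Rightarrow> real) \<Rightarrow> (nat \<times> (nat \<Rightarrow> real ^ 'd)) measure" where
  "boot_space s n k = measure_pmf (sample_size_pmf s n) \<Otimes>\<^sub>M
     (\<Pi>\<^sub>M i\<in>UNIV. density lborel (\<lambda>x. ennreal (k x)))"

definition boot_sample :: "nat \<times> (nat \<Rightarrow> 'a) \<Rightarrow> 'a set" where
  "boot_sample = (\<lambda>(N, X). X ` {1..N})"

definition boot_law ::
  "filtration \<Rightarrow> scheme \<Rightarrow> real \<Rightarrow> nat \<Rightarrow> (real ^ 'd \<Rightarrow> real) \<Rightarrow> (real \<Rightarrow> real) measure" where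
  "boot_law F s T n k = chi_bar_law F T n (boot_space s n k) boot_sample"

section \<open>Modes of convergence\<close>

text \<open>Outer probabilities are used because the Wasserstein distance, a supremum over an uncountable
  family, need not be a measurable function of the sample.\<close>

datatype convergence_mode = Almost_surely | In_probability

fun tendsto_zero :: "convergence_mode \<Rightarrow> 'w measure \<Rightarrow> (nat \<Rightarrow> 'w \<Rightarrow> ennreal) \<Rightarrow> bool" where
  "tendsto_zero Almost_surely M Z \<longleftrightarrow> (AE \<omega> in M. (\<lambda>n. Z n \<omega>) \<longlonglongrightarrow> 0)"
| "tendsto_zero In_probability M Z \<longleftrightarrow>
     (\<forall>\<epsilon>>0. (\<lambda>n. outer_measure_of M {\<omega> \<in> space M. ennreal \<epsilon> < Z n \<omega>}) \<longlonglongrightarrow> 0)"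

fun stochastically_bounded :: "convergence_mode \<Rightarrow> 'w measure \<Rightarrow> (nat \<Rightarrow> 'w \<Rightarrow> ennreal) \<Rightarrow> bool" where
  "stochastically_bounded Almost_surely M Z \<longleftrightarrow>
     (AE \<omega> in M. \<exists>C::real. \<forall>n\<ge>1. Z n \<omega> \<le> ennreal C)"
| "stochastically_bounded In_probability M Z \<longleftrightarrow>
     (\<forall>\<epsilon>>0. \<exists>C::real. \<forall>n\<ge>1.
        outer_measure_of M {\<omega> \<in> space M. ennreal C < Z n \<omega>} \<le> ennreal \<epsilon>)"

section \<open>The rate\<close>

definition ennreal_sqrt :: "ennreal \<Rightarrow> ennreal" where
  "ennreal_sqrt x = (if x = \<infinity> then \<infinity> else ennreal (sqrt (enn2real x)))"

definition boot_rate :: "nat \<Rightarrow> nat \<Rightarrow> ennreal \<Rightarrow> ennreal" where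
  "boot_rate n J \<delta> = ennreal (sqrt (real J)) * ennreal_sqrt \<delta> + ennreal (sqrt (real n / real J)) * \<delta>"


end

theory Submission
  imports Defs
begin

text \<open>The estimate is not asymptotic: it compares the laws of the Euler characteristic process for two
densities \<open>\<kappa>\<close>, \<open>\<kappa>'\<close> on the unit cube that are bounded by \<open>K\<close> and differ by at most \<open>\<delta>\<close> almost everywhere.
For all \<open>n, J \<ge> 1\<close> the Wasserstein distance is at most
\<open>C \<sqdot> (\<surd>J \<surd>\<delta> + \<surd>(n/J) \<delta>)\<close> with a constant \<open>C\<close> that depends only on \<open>K\<close>, \<open>T\<close> and the dimension
(\<open>boot_wasserstein_le\<close>). Four ideas carry it.

\<^item> \<^emph>\<open>Coupling.\<close> There are i.i.d. pairs of points with marginal densities \<open>\<kappa>\<close> and \<open>\<kappa>'\<close> whose two members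
  differ with probability at most \<open>\<delta>\<close> (\<open>density_coupling\<close>). Take the same number of pairs on both sides. In the
  difference of the two Euler characteristics every simplex with all its vertices common to both samples
  cancels. What is left is a signed sum of four counts: for either sample and either parity of the number of
  vertices, the number \<open>A t\<close> of simplices born by time \<open>t\<close> that have at least one vertex where the pair
  disagrees (\<open>chi_difference\<close>).

\<^item> \<^emph>\<open>Moments.\<close> Mean and variance of \<open>A t\<close> are at most \<open>B = O(n \<delta>)\<close> (\<open>evcount_variance_le\<close>). Its square
  counts pairs of simplices. Disjoint pairs contribute at most the square of the mean, because the points are
  independent and the sample size is deterministic or Poisson (\<open>sample_size_disjoint_pairs\<close>). Both members of an
  intersecting pair lie near one of the points where the samples disagree. There are at most \<open>n \<delta>\<close> such points in
  the mean, and the number of pairs of subsets of the neighbourhood of a point is \<open>4\<close> to the power of its size, whose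
  mean stays bounded because the neighbourhood has volume of order \<open>1/n\<close> (\<open>nn_integral_hub\<close>).

\<^item> \<^emph>\<open>Monotonicity.\<close> \<open>A\<close> is nondecreasing in \<open>t\<close>. Cut the range of its mean into \<open>J\<close> slabs of height \<open>B/J\<close>.
  The deviation from the mean at a time in a slab is at most the deviation at the first or last time of
  the slab plus \<open>B/J\<close>, so the mean of the supremum is at most \<open>2 \<surd>(J B) + B/J\<close>
  (\<open>finite_sup_deviation_le\<close>). The slabs are intervals of the mean, not of time. Multiplication by \<open>n\<^sup>-\<^sup>1\<^sup>/\<^sup>2\<close> gives the two terms of the rate.

\<^item> \<^emph>\<open>Identification of laws.\<close> The law of a random finite set is determined by the probabilities that it
  avoids a given Borel set (\<open>config_law_eq_if_void_probabilities_eq\<close>). These are easily computed in both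
  sampling schemes, so the original sample is distributed as a bootstrap sample drawn from \<open>\<kappa>\<close>
  (\<open>chi_bar_law_sampling\<close>), and each half of the coupled sample has the law that it should have.

The theorem is then read off for \<open>\<kappa>' = kh n \<omega>\<close> and \<open>\<delta> = err n \<omega>\<close>. The quotient of the distance and the rate is
at most an increasing function of the error (and it is \<open>0\<close> where the error is infinite). An error that
tends to \<open>0\<close> almost surely, or in probability, is bounded in the corresponding sense as far as it is finite, and
hence so is the quotient.\<close>

section \<open>Finite configurations\<close>

lemma space_config_space: "space config_space = {c. finite c}"
  unfolding config_space_def by (rule space_measure_of) auto

text \<open>Avoiding \<open>A\<close> and avoiding \<open>B\<close> is the same as avoiding \<open>A \<union> B\<close>. So the void events, unlike the
counting events, are closed under intersection.\<close>

definition void_space :: "'a::topological_space set measure" where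
  "void_space = sigma {c. finite c} {{c. finite c \<and> c \<inter> B = {}} | B. B \<in> sets borel}"

lemma space_void_space: "space void_space = {c. finite c}"
  unfolding void_space_def by (rule space_measure_of) auto

lemma void_event_sets:
  "B \<in> sets borel \<Longrightarrow> {c. finite c \<and> c \<inter> B = {}} \<in> sets void_space"
  unfolding void_space_def by (subst sets_measure_of) auto

lemma eventually_inj_on_of_tendsto:
  fixes f :: "nat \<Rightarrow> 'a \<Rightarrow> 'a::t2_space"
  assumes "finite c" and lim: "\<And>x. x \<in> c \<Longrightarrow> (\<lambda>j. f j x) \<longlonglongrightarrow> x"
  shows "\<forall>\<^sub>F j in sequentially. inj_on (f j) c"
proof -
  have "\<forall>\<^sub>F j in sequentially. f j x \<noteq> f j y" if xy: "x \<in> c" "y \<in> c" "x \<noteq> y" for x y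
  proof -
    obtain U V where "open U" "open V" "x \<in> U" "y \<in> V" "U \<inter> V = {}"
      using hausdorff[OF xy(3)] by blast
    then have "\<forall>\<^sub>F j in sequentially. f j x \<in> U" "\<forall>\<^sub>F j in sequentially. f j y \<in> V"
      using lim xy topological_tendstoD by blast+
    then show ?thesis
      by eventually_elim (use \<open>U \<inter> V = {}\<close> in auto)
  qed
  then have "\<forall>\<^sub>F j in sequentially. x \<noteq> y \<longrightarrow> f j x \<noteq> f j y" if "x \<in> c" "y \<in> c" for x y
    using that by (cases "x = y") (auto elim: eventually_mono)
  then have "\<forall>\<^sub>F j in sequentially. \<forall>x\<in>c. \<forall>y\<in>c. x \<noteq> y \<longrightarrow> f j x \<noteq> f j y"
    using \<open>finite c\<close> by (intro eventually_ball_finite ballI) auto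
  then show ?thesis
    by eventually_elim (auto simp: inj_on_def)
qed

text \<open>The image of a configuration under a function with finitely many values takes only finitely many values, and
each of them is specified by which cells of the function are void.\<close>

lemma simple_function_image_measurable_void:
  fixes f :: "'a::topological_space \<Rightarrow> 'a"
  assumes f: "simple_function borel f" and B: "B \<in> sets borel"
  shows "(\<lambda>c. g (f ` (c \<inter> B)) :: real) \<in> borel_measurable void_space"
proof -
  have fin: "finite (range f)"
    using simple_functionD(1)[OF f] by simp
  have cell: "f -` {y} \<inter> B \<in> sets borel" for y
    using simple_functionD(2)[OF f, of "{y}"] B by simp
  have "(\<lambda>c. f ` (c \<inter> B)) \<in> void_space \<rightarrow>\<^sub>M count_space (Pow (range f))"
  proof (subst measurable_count_space_eq2, use fin in simp, intro conjI ballI)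
    show "(\<lambda>c. f ` (c \<inter> B)) \<in> space void_space \<rightarrow> Pow (range f)" by auto
    fix D assume "D \<in> Pow (range f)"
    then have sub: "D \<subseteq> range f" by simp
    have hit: "c \<inter> (f -` {y} \<inter> B) \<noteq> {} \<longleftrightarrow> y \<in> f ` (c \<inter> B)" for c y by auto
    have "f ` (c \<inter> B) = D \<longleftrightarrow> (\<forall>y\<in>range f. (y \<in> D) = (c \<inter> (f -` {y} \<inter> B) \<noteq> {}))" for c
      unfolding hit using sub image_mono[of "c \<inter> B" UNIV f] by (smt (verit) subset_antisym subset_iff subset_UNIV)
    then have D: "(\<lambda>c. f ` (c \<inter> B)) -` {D} \<inter> space void_space =
        {c\<in>space void_space. \<forall>y\<in>range f. (y \<in> D) = (c \<inter> (f -` {y} \<inter> B) \<noteq> {})}"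
      by (simp add: vimage_def Collect_conj_eq Int_commute)
    have void: "{c \<in> space void_space. c \<inter> (f -` {y} \<inter> B) = {}} \<in> sets void_space" for y
      using void_event_sets[OF cell[of y]] by (simp add: space_void_space)
    show "(\<lambda>c. f ` (c \<inter> B)) -` {D} \<inter> space void_space \<in> sets void_space"
      unfolding D by (intro sets.sets_Collect_finite_All fin) 
         (use void in \<open>auto intro!: sets.sets_Collect_neg simp: eq_commute[of "_ \<in> D"]\<close>)
  qed
  then show ?thesis by (rule measurable_compose) simp
qed

text \<open>The identity is a pointwise limit of simple functions. Configurations are finite, therefore pointwise
convergence on the points is all that continuity of \<open>\<psi>\<close> has to take care of.\<close>

lemma borel_measurable_void_if_continuous:
  fixes \<psi> :: "'a::{metric_space, second_countable_topology} set \<Rightarrow> real"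
  assumes cont: "\<And>c f. finite c \<Longrightarrow> (\<And>x. x \<in> c \<Longrightarrow> (\<lambda>j::nat. f j x) \<longlonglongrightarrow> x) \<Longrightarrow>
      (\<lambda>j. \<psi> (f j ` c)) \<longlonglongrightarrow> \<psi> c"
    and B: "B \<in> sets borel"
  shows "(\<lambda>c. \<psi> (c \<inter> B)) \<in> borel_measurable void_space"
proof -
  obtain f :: "nat \<Rightarrow> 'a \<Rightarrow> 'a" where f: "\<And>j. simple_function borel (f j)"
    "\<And>x. (\<lambda>j. f j x) \<longlonglongrightarrow> x"
    using borel_measurable_implies_sequence_metric[of "\<lambda>x::'a. x" borel undefined] by auto
  show ?thesis
  proof (rule borel_measurable_LIMSEQ_real)
    show "(\<lambda>j. \<psi> (f j ` (c \<inter> B))) \<longlonglongrightarrow> \<psi> (c \<inter> B)" if "c \<in> space void_space" for c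
      using that f(2) by (intro cont) (auto simp: space_void_space)
    show "(\<lambda>c. \<psi> (f j ` (c \<inter> B))) \<in> borel_measurable void_space" for j
      by (rule simple_function_image_measurable_void[OF f(1) B])
  qed
qed

text \<open>The number of points in a set is continuous in the above sense, since a discretisation that is fine enough keeps
the finitely many points apart.\<close>

lemma sets_config_space_eq_void:
  "sets (config_space :: 'a::{metric_space, second_countable_topology} set measure) = sets void_space"
proof
  have "(\<lambda>c. real (card (c \<inter> B))) \<in> borel_measurable void_space" if B: "B \<in> sets borel"
    for B :: "'a set"
  proof (rule borel_measurable_void_if_continuous[OF _ B])
    fix c :: "'a set" and f :: "nat \<Rightarrow> 'a \<Rightarrow> 'a"
    assume "finite c" "\<And>x. x \<in> c \<Longrightarrow> (\<lambda>j. f j x) \<longlonglongrightarrow> x"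
    then have "\<forall>\<^sub>F j in sequentially. real (card (f j ` c)) = real (card c)"
      using eventually_inj_on_of_tendsto[of c f]
      by (auto elim!: eventually_mono simp: card_image)
    then show "(\<lambda>j. real (card (f j ` c))) \<longlonglongrightarrow> real (card c)"
      by (rule tendsto_eventually)
  qed
  then have "{c \<in> space void_space. real (card (c \<inter> B)) = real k} \<in> sets void_space"
    if "B \<in> sets borel" for B :: "'a set" and k
    using that by (intro borel_measurable_eq) auto
  then have "{{c. finite c \<and> card (c \<inter> B) = k} | B k. B \<in> sets borel}
      \<subseteq> sets (void_space :: 'a set measure)"
    by (auto simp: space_void_space)
  from sets.sigma_sets_subset[OF this]
  show "sets (config_space :: 'a set measure) \<subseteq> sets void_space"
    unfolding config_space_def by (subst sets_measure_of) (auto simp: space_void_space)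
  have "{c. finite c \<and> c \<inter> B = {}} = {c. finite c \<and> card (c \<inter> B) = 0}" for B :: "'a set"
    by auto
  then have "{c. finite c \<and> c \<inter> B = {}} \<in> sets config_space" if "B \<in> sets borel" for B :: "'a set"
    using that unfolding config_space_def by (subst sets_measure_of) auto
  then have "{{c. finite c \<and> c \<inter> B = {}} | B. B \<in> sets borel} \<subseteq> sets (config_space :: 'a set measure)"
    by auto
  from sets.sigma_sets_subset[OF this]
  show "sets void_space \<subseteq> sets (config_space :: 'a set measure)"
    unfolding void_space_def by (subst sets_measure_of) (auto simp: space_config_space)
qed

lemma borel_measurable_config_if_continuous:
  fixes \<psi> :: "'a::{metric_space, second_countable_topology} set \<Rightarrow> real"
  assumes "\<And>c f. finite c \<Longrightarrow> (\<And>x. x \<in> c \<Longrightarrow> (\<lambda>j::nat. f j x) \<longlonglongrightarrow> x) \<Longrightarrow>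
      (\<lambda>j. \<psi> (f j ` c)) \<longlonglongrightarrow> \<psi> c"
  shows "\<psi> \<in> borel_measurable config_space"
  using borel_measurable_void_if_continuous[OF assms, of UNIV]
  by (simp add: measurable_cong_sets[OF sets_config_space_eq_void refl])

lemma measurable_config_spaceI:
  fixes S :: "'w \<Rightarrow> 'a::{metric_space, second_countable_topology} set"
  assumes "\<And>\<omega>. \<omega> \<in> space M \<Longrightarrow> finite (S \<omega>)"
    and "\<And>B. B \<in> sets borel \<Longrightarrow> {\<omega>\<in>space M. S \<omega> \<inter> B = {}} \<in> sets M"
  shows "S \<in> M \<rightarrow>\<^sub>M config_space"
proof -
  have "S \<in> M \<rightarrow>\<^sub>M void_space"
    unfolding void_space_def
  proof (rule measurable_measure_of)
    fix Y assume "Y \<in> {{c. finite c \<and> c \<inter> B = {}} | B. B \<in> sets (borel :: 'a measure)}"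
    then obtain B where B: "B \<in> sets borel" "Y = {c. finite c \<and> c \<inter> B = {}}" by auto
    have "S -` Y \<inter> space M = {\<omega>\<in>space M. S \<omega> \<inter> B = {}}"
      unfolding B using assms(1) by auto
    then show "S -` Y \<inter> space M \<in> sets M" using assms(2)[OF B(1)] by simp
  qed (use assms(1) in auto)
  then show ?thesis
    by (simp add: measurable_cong_sets[OF refl sets_config_space_eq_void])
qed

lemma void_event_measurable:
  fixes S :: "'w \<Rightarrow> 'a::{metric_space, second_countable_topology} set"
  assumes "S \<in> M \<rightarrow>\<^sub>M config_space" "B \<in> sets borel"
  shows "{\<omega>\<in>space M. S \<omega> \<inter> B = {}} \<in> sets M"
proof -
  have "{c. finite c \<and> c \<inter> B = {}} \<in> sets config_space"
    using void_event_sets[OF assms(2)] by (simp add: sets_config_space_eq_void)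
  from measurable_sets[OF assms(1) this]
  have "S -` {c. finite c \<and> c \<inter> B = {}} \<inter> space M \<in> sets M" .
  also have "S -` {c. finite c \<and> c \<inter> B = {}} \<inter> space M = {\<omega>\<in>space M. S \<omega> \<inter> B = {}}"
    using measurable_space[OF assms(1)] by (auto simp: space_config_space)
  finally show ?thesis .
qed

text \<open>Renyi's theorem for finite random sets: the void events are closed under intersection and generate.\<close>

theorem config_law_eq_if_void_probabilities_eq:
  fixes S :: "'w \<Rightarrow> 'a::{metric_space, second_countable_topology} set" and S' :: "'v \<Rightarrow> 'a set"
  assumes "prob_space M" "prob_space M'"
    and S: "S \<in> M \<rightarrow>\<^sub>M config_space" and S': "S' \<in> M' \<rightarrow>\<^sub>M config_space"
    and eq: "\<And>B. B \<in> sets borel \<Longrightarrow>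
      measure M {\<omega>\<in>space M. S \<omega> \<inter> B = {}} = measure M' {\<omega>\<in>space M'. S' \<omega> \<inter> B = {}}"
  shows "distr M config_space S = distr M' config_space S'"
proof -
  interpret M: prob_space M by fact
  interpret M': prob_space M' by fact
  define E where "E = {{c :: 'a set. finite c \<and> c \<inter> B = {}} | B. B \<in> sets borel}"
  have gen: "sets config_space = sigma_sets {c. finite c} E"
    unfolding sets_config_space_eq_void void_space_def E_def by (rule sets_measure_of) auto
  have pre: "S -` {c. finite c \<and> c \<inter> B = {}} \<inter> space M = {\<omega>\<in>space M. S \<omega> \<inter> B = {}}"
    "S' -` {c. finite c \<and> c \<inter> B = {}} \<inter> space M' = {\<omega>\<in>space M'. S' \<omega> \<inter> B = {}}" for B
    using measurable_space[OF S] measurable_space[OF S'] by (auto simp: space_config_space)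
  show ?thesis
  proof (rule measure_eqI_generator_eq[where E=E and \<Omega>="{c. finite c}" and A="\<lambda>_. {c. finite c}"])
    show "Int_stable E"
    proof (rule Int_stableI)
      fix a b assume "a \<in> E" "b \<in> E"
      then obtain A B where AB: "a = {c. finite c \<and> c \<inter> A = {}}" "b = {c. finite c \<and> c \<inter> B = {}}"
        and [measurable]: "A \<in> sets borel" "B \<in> sets borel"
        unfolding E_def by auto
      have "a \<inter> b = {c. finite c \<and> c \<inter> (A \<union> B) = {}}" "A \<union> B \<in> sets borel"
        unfolding AB by auto
      then show "a \<inter> b \<in> E" unfolding E_def by blast
    qed
    show "range (\<lambda>_. {c. finite c}) \<subseteq> E"
      unfolding E_def by (auto intro!: exI[of _ "{}"])
    fix Y assume "Y \<in> E"
    then obtain B where B: "B \<in> sets borel" "Y = {c. finite c \<and> c \<inter> B = {}}"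
      unfolding E_def by auto
    have Y: "Y \<in> sets config_space" using \<open>Y \<in> E\<close> gen by auto
    show "emeasure (distr M config_space S) Y = emeasure (distr M' config_space S') Y"
      using eq[OF B(1)] S S' Y
      by (simp add: emeasure_distr) (simp only: B(2) pre M.emeasure_eq_measure M'.emeasure_eq_measure)
  next
    fix i :: nat
    show "emeasure (distr M config_space S) {c. finite c} \<noteq> \<infinity>"
      using finite_measure.emeasure_finite[OF prob_space.finite_measure[OF M.prob_space_distr[OF S]]]
      by simp
  qed (use gen in \<open>auto simp: E_def\<close>)
qed

section \<open>Birth times and the Euler characteristic\<close>

text \<open>The condition for a finite nonempty set to be a simplex at scale \<open>t\<close>, freed from the ambient configuration.\<close>

fun within_scale :: "filtration \<Rightarrow> real \<Rightarrow> 'a::euclidean_space set \<Rightarrow> bool" where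
  "within_scale Cech t c \<longleftrightarrow> (\<exists>y. \<forall>x\<in>c. dist x y \<le> t)"
| "within_scale Rips t c \<longleftrightarrow> (\<forall>x\<in>c. \<forall>y\<in>c. dist x y \<le> t)"

lemma mem_filtration_complex_iff:
  assumes "finite \<sigma>" "\<sigma> \<noteq> {}"
  shows "\<sigma> \<in> filtration_complex F t P \<longleftrightarrow> \<sigma> \<subseteq> P \<and> within_scale F t \<sigma>"
proof (cases F)
  case Cech
  then show ?thesis using assms by (simp add: ex_in_conv[symmetric] conj_commute)
next
  case Rips
  have "diameter \<sigma> \<le> t \<longleftrightarrow> (\<forall>x\<in>\<sigma>. \<forall>y\<in>\<sigma>. dist x y \<le> t)"
  proof
    assume "diameter \<sigma> \<le> t"
    then show "\<forall>x\<in>\<sigma>. \<forall>y\<in>\<sigma>. dist x y \<le> t"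
      using diameter_bounded_bound[OF finite_imp_bounded[OF assms(1)]] by (meson order_trans)
  next
    assume *: "\<forall>x\<in>\<sigma>. \<forall>y\<in>\<sigma>. dist x y \<le> t"
    then show "diameter \<sigma> \<le> t"
      by (intro diameter_le) (use assms in \<open>auto simp: dist_norm\<close>)
  qed
  then show ?thesis using assms Rips by auto
qed

definition birth :: "filtration \<Rightarrow> 'a::euclidean_space set \<Rightarrow> real" where
  "birth F c = Inf {t. within_scale F t c}"

lemma within_scale_mono: "within_scale F s c \<Longrightarrow> s \<le> t \<Longrightarrow> within_scale F t c"
  by (cases F) (simp, meson order_trans, simp, meson order_trans)

lemma within_scale_dist:
  assumes "within_scale F t c" "x \<in> c" "y \<in> c"
  shows "dist x y \<le> 2 * t"
proof (cases F)
  case Cech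
  then obtain z where "dist x z \<le> t" "dist y z \<le> t" using assms by auto
  then show ?thesis using dist_triangle2[of x y z] by linarith
next
  case Rips
  then have "dist x y \<le> t" using assms by auto
  then show ?thesis using zero_le_dist[of x y] by linarith
qed

lemma within_scale_nonneg: "within_scale F t c \<Longrightarrow> c \<noteq> {} \<Longrightarrow> 0 \<le> t"
  using within_scale_dist[of F t c] by fastforce

text \<open>For the Cech complex the sets of admissible centres at scales decreasing to \<open>t\<close> are nested nonempty compact
sets.\<close>

lemma within_scale_right_closed:
  fixes c :: "'a::euclidean_space set"
  assumes "finite c" "c \<noteq> {}" and *: "\<And>s. t < s \<Longrightarrow> within_scale F s c"
  shows "within_scale F t c"
proof (cases F)
  case Cech
  define K where "K n = (\<Inter>x\<in>c. cball x (t + 1 / real (Suc n)))" for n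
  have "\<Inter>(range K) \<noteq> {}"
  proof (rule compact_nest)
    fix n
    have "within_scale Cech (t + 1 / real (Suc n)) c" using * Cech by simp
    then obtain y where "\<forall>x\<in>c. dist x y \<le> t + 1 / real (Suc n)" by auto
    then have "y \<in> K n" unfolding K_def by auto
    then show "K n \<noteq> {}" by blast
    show "compact (K n)"
      using assms(2) unfolding K_def by (blast intro!: compact_Inter compact_cball)
  next
    fix m n :: nat assume "m \<le> n"
    then have "1 / real (Suc n) \<le> 1 / real (Suc m)" by (simp add: field_simps)
    then show "K n \<subseteq> K m" unfolding K_def by fastforce
  qed
  then obtain y where y: "\<And>n. y \<in> K n" by auto
  have "dist x y \<le> t" if "x \<in> c" for x
  proof (rule field_le_epsilon)
    fix e :: real assume "0 < e"
    then obtain n where "1 / real (Suc n) < e" using nat_approx_posE by blast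
    then show "dist x y \<le> t + e" using y[of n] that unfolding K_def by fastforce
  qed
  then show ?thesis using Cech by auto
next
  case Rips
  have "dist x y \<le> t" if "x \<in> c" "y \<in> c" for x y
  proof (rule dense_ge)
    fix s assume "t < s"
    then have "within_scale Rips s c" using * Rips by simp
    then show "dist x y \<le> s" using that by simp
  qed
  then show ?thesis using Rips by auto
qed

lemma ex_within_scale:
  assumes "finite c" shows "\<exists>t. within_scale F t c"
proof -
  obtain e y where e: "\<forall>x\<in>c. dist y x \<le> e"
    using finite_imp_bounded[OF assms] unfolding bounded_def by auto
  have "within_scale F (2 * e) c"
  proof (cases F)
    case Cech
    have "dist x y \<le> 2 * e" if "x \<in> c" for x
    proof -
      have "dist x y \<le> e" using e that by (simp add: dist_commute)
      then show ?thesis using zero_le_dist[of x y] by linarith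
    qed
    then show ?thesis using Cech by auto
  next
    case Rips
    have "dist x z \<le> 2 * e" if "x \<in> c" "z \<in> c" for x z
    proof -
      have "dist y x \<le> e" "dist y z \<le> e" using e that by auto
      then show ?thesis using dist_triangle3[of x z y] by linarith
    qed
    then show ?thesis using Rips by auto
  qed
  then show ?thesis by blast
qed

text \<open>The infimum in the definition of the birth time is attained. Hence the whole filtration is encoded in one
number for each simplex, and the complex is right-continuous in the scale.\<close>

lemma within_scale_iff_birth_le:
  assumes "finite c" "c \<noteq> {}"
  shows "within_scale F t c \<longleftrightarrow> birth F c \<le> t"
proof
  have bdd: "bdd_below {t. within_scale F t c}"
    using within_scale_nonneg[OF _ assms(2)] by (intro bdd_belowI[of _ 0]) auto
  show "within_scale F t c \<Longrightarrow> birth F c \<le> t"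
    unfolding birth_def by (rule cInf_lower[OF _ bdd]) simp
  assume le: "birth F c \<le> t"
  show "within_scale F t c"
  proof (rule within_scale_right_closed[OF assms])
    fix s assume "t < s"
    then have "Inf {t. within_scale F t c} < s" using le unfolding birth_def by simp
    then obtain u where "within_scale F u c" "u < s"
      using cInf_lessD ex_within_scale[OF assms(1)] by (metis (no_types, lifting) empty_iff mem_Collect_eq)
    then show "within_scale F s c" by (auto intro: within_scale_mono)
  qed
qed

text \<open>Birth times are Lipschitz in the positions of the points, which makes them measurable functions of the
configuration.\<close>

lemma within_scale_perturb:
  assumes "within_scale F t (f ` c)" and e: "\<And>x. x \<in> c \<Longrightarrow> dist (f x) (g x) \<le> e" and "0 \<le> e"
  shows "within_scale F (t + 2 * e) (g ` c)"
proof (cases F)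
  case Cech
  then obtain y where y: "\<And>x. x \<in> c \<Longrightarrow> dist (f x) y \<le> t" using assms(1) by auto
  have "dist (g x) y \<le> t + 2 * e" if "x \<in> c" for x
    using dist_triangle3[of "g x" y "f x"] e[OF that] y[OF that] \<open>0 \<le> e\<close> by linarith
  then show ?thesis using Cech by auto
next
  case Rips
  have "dist (g x) (g y) \<le> t + 2 * e" if "x \<in> c" "y \<in> c" for x y
  proof -
    have "dist (f x) (f y) \<le> t" using assms(1) Rips that by auto
    then show ?thesis
      using dist_triangle3[of "g x" "g y" "f x"] dist_triangle[of "f x" "g y" "f y"]
        e[OF that(1)] e[OF that(2)] by linarith
  qed
  then show ?thesis using Rips by auto
qed

lemma birth_perturb:
  assumes "finite c" "c \<noteq> {}" and "\<And>x. x \<in> c \<Longrightarrow> dist (f x) (g x) \<le> e" "0 \<le> e"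
  shows "birth F (g ` c) \<le> birth F (f ` c) + 2 * e"
  using within_scale_perturb[of F "birth F (f ` c)" f c g e] assms
  by (simp add: within_scale_iff_birth_le)

lemma tendsto_birth:
  fixes f :: "nat \<Rightarrow> 'b \<Rightarrow> 'a::euclidean_space"
  assumes c: "finite c" "c \<noteq> {}" and lim: "\<And>x. x \<in> c \<Longrightarrow> (\<lambda>j. f j x) \<longlonglongrightarrow> g x"
  shows "(\<lambda>j. birth F (f j ` c)) \<longlonglongrightarrow> birth F (g ` c)"
proof (rule tendstoI)
  fix e :: real assume "0 < e"
  then have "\<forall>\<^sub>F j in sequentially. dist (f j x) (g x) < e / 3" if "x \<in> c" for x
    using tendstoD[OF lim[OF that], of "e / 3"] \<open>0 < e\<close> by simp
  then have "\<forall>\<^sub>F j in sequentially. \<forall>x\<in>c. dist (f j x) (g x) < e / 3"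
    using c by (intro eventually_ball_finite) auto
  then show "\<forall>\<^sub>F j in sequentially. dist (birth F (f j ` c)) (birth F (g ` c)) < e"
  proof eventually_elim
    case (elim j)
    have "birth F (g ` c) \<le> birth F (f j ` c) + 2 * (e / 3)"
      using elim \<open>0 < e\<close> by (intro birth_perturb c) (auto simp: less_imp_le)
    moreover have "birth F (f j ` c) \<le> birth F (g ` c) + 2 * (e / 3)"
      using elim \<open>0 < e\<close> by (intro birth_perturb c) (auto simp: less_imp_le dist_commute)
    ultimately show ?case using \<open>0 < e\<close> by (simp add: dist_real_def abs_le_iff)
  qed
qed

lemma borel_measurable_birth:
  "birth F \<in> borel_measurable (config_space :: 'a::euclidean_space set measure)"
proof (rule borel_measurable_config_if_continuous)
  fix c :: "'a set" and f :: "nat \<Rightarrow> 'a \<Rightarrow> 'a"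
  assume "finite c" "\<And>x. x \<in> c \<Longrightarrow> (\<lambda>j. f j x) \<longlonglongrightarrow> x"
  then show "(\<lambda>j. birth F (f j ` c)) \<longlonglongrightarrow> birth F c"
    using tendsto_birth[of c f "\<lambda>x. x" F] by (cases "c = {}") auto
qed

lemma euler_char_finite:
  assumes "finite K" "\<And>\<sigma>. \<sigma> \<in> K \<Longrightarrow> finite \<sigma> \<and> \<sigma> \<noteq> {}"
  shows "euler_char K = (\<Sum>\<sigma>\<in>K. (-1) ^ (card \<sigma> + 1))"
proof -
  define m where "m = Max (insert 0 (card ` K))"
  have le: "card \<sigma> \<le> m" if "\<sigma> \<in> K" for \<sigma>
    unfolding m_def using that assms(1) by (intro Max_ge) auto
  have pos: "0 < card \<sigma>" if "\<sigma> \<in> K" for \<sigma>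
    using assms(2)[OF that] by (simp add: card_gt_0_iff)
  have "euler_char K = (\<Sum>k<m. (-1) ^ k * real (card {\<sigma>\<in>K. card \<sigma> = k + 1}))"
    unfolding euler_char_def
  proof (rule suminf_finite)
    fix k assume "k \<notin> {..<m}"
    then have "{\<sigma>\<in>K. card \<sigma> = k + 1} = {}" using le by force
    then show "(-1) ^ k * real (card {\<sigma>\<in>K. card \<sigma> = k + 1}) = 0"
      by (simp only: card.empty of_nat_0 mult_zero_right)
  qed simp
  also have "\<dots> = (\<Sum>k<m. \<Sum>\<sigma>\<in>{\<sigma>\<in>K. card \<sigma> - 1 = k}. (-1) ^ (card \<sigma> + 1))"
  proof (rule sum.cong[OF refl])
    fix k
    have eq: "{\<sigma>\<in>K. card \<sigma> = k + 1} = {\<sigma>\<in>K. card \<sigma> - 1 = k}" using pos by force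
    have "(\<Sum>\<sigma>\<in>{\<sigma>\<in>K. card \<sigma> - 1 = k}. (-1) ^ (card \<sigma> + 1)) =
        (\<Sum>\<sigma>\<in>{\<sigma>\<in>K. card \<sigma> = k + 1}. (-1) ^ k :: real)"
      unfolding eq[symmetric] by (intro sum.cong) auto
    then show "(-1) ^ k * real (card {\<sigma>\<in>K. card \<sigma> = k + 1}) =
        (\<Sum>\<sigma>\<in>{\<sigma>\<in>K. card \<sigma> - 1 = k}. (-1) ^ (card \<sigma> + 1))" by simp
  qed
  also have "\<dots> = (\<Sum>\<sigma>\<in>K. (-1) ^ (card \<sigma> + 1))"
  proof (rule sum.group[OF assms(1)])
    show "(\<lambda>\<sigma>. card \<sigma> - 1) ` K \<subseteq> {..<m}" using le pos by fastforce
  qed simp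
  finally show ?thesis .
qed

definition nonempty_subsets :: "'a set \<Rightarrow> 'a set set" where
  "nonempty_subsets c = Pow c - {{}}"

lemma finite_nonempty_subsets [simp]: "finite c \<Longrightarrow> finite (nonempty_subsets c)"
  by (simp add: nonempty_subsets_def)

text \<open>The Euler characteristic at scale \<open>t\<close> of the configuration \<open>c\<close> dilated by \<open>r\<close>, written as a sum over
the simplices of \<open>c\<close> itself.\<close>

definition chi :: "filtration \<Rightarrow> real \<Rightarrow> real \<Rightarrow> 'a::euclidean_space set \<Rightarrow> real" where
  "chi F r t c = (\<Sum>\<sigma>\<in>nonempty_subsets c. (-1) ^ (card \<sigma> + 1) * of_bool (birth F ((*\<^sub>R) r ` \<sigma>) \<le> t))"

lemma sum_nonempty_subsets_image:
  assumes "inj_on f c"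
  shows "(\<Sum>\<sigma>\<in>nonempty_subsets (f ` c). h \<sigma>) = (\<Sum>\<sigma>\<in>nonempty_subsets c. h (f ` \<sigma>))"
proof -
  have eq: "nonempty_subsets (f ` c) = (`) f ` nonempty_subsets c"
    unfolding nonempty_subsets_def by (auto simp: image_Pow_surj[OF refl, symmetric])
  have inj: "inj_on ((`) f) (nonempty_subsets c)"
    by (rule inj_on_subset[OF inj_on_image_Pow[OF assms]]) (auto simp: nonempty_subsets_def)
  show ?thesis unfolding eq by (simp add: sum.reindex[OF inj])
qed

lemma chi_image:
  assumes "inj_on f I"
  shows "chi F r t (f ` I) = (\<Sum>\<sigma>\<in>nonempty_subsets I.
    (-1) ^ (card \<sigma> + 1) * of_bool (birth F ((\<lambda>i. r *\<^sub>R f i) ` \<sigma>) \<le> t))"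
  unfolding chi_def sum_nonempty_subsets_image[OF assms]
proof (intro sum.cong refl)
  fix \<sigma> assume "\<sigma> \<in> nonempty_subsets I"
  then have "inj_on f \<sigma>" using assms by (auto simp: nonempty_subsets_def intro: inj_on_subset)
  then show "(- 1) ^ (card (f ` \<sigma>) + 1) * of_bool (birth F ((*\<^sub>R) r ` f ` \<sigma>) \<le> t) =
    (- 1) ^ (card \<sigma> + 1) * (of_bool (birth F ((\<lambda>i. r *\<^sub>R f i) ` \<sigma>) \<le> t) :: real)"
    by (simp add: card_image image_image)
qed

lemma scaled_euler_char_eq_chi:
  fixes P :: "(real ^ 'd) set"
  assumes P: "finite P" and "1 \<le> n"
  shows "scaled_euler_char F n t P = chi F (root CARD('d) (real n)) t P"
proof -
  let ?r = "root CARD('d) (real n)" let ?g = "(*\<^sub>R) ?r :: real ^ 'd \<Rightarrow> _"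
  have "0 < ?r" using \<open>1 \<le> n\<close> by simp
  then have inj: "inj_on ?g c" for c by (auto simp: inj_on_def)
  let ?K = "filtration_complex F t (?g ` P)"
  have sub: "?K \<subseteq> nonempty_subsets (?g ` P)" by (cases F) (auto simp: nonempty_subsets_def)
  have fin: "finite (nonempty_subsets (?g ` P))" using P by simp
  have "scaled_euler_char F n t P = (\<Sum>\<sigma>\<in>?K. (-1) ^ (card \<sigma> + 1))"
    unfolding scaled_euler_char_def
  proof (rule euler_char_finite)
    show "finite ?K" using finite_subset[OF sub fin] .
    show "finite \<sigma> \<and> \<sigma> \<noteq> {}" if "\<sigma> \<in> ?K" for \<sigma>
      using subsetD[OF sub that] P by (auto simp: nonempty_subsets_def dest: finite_subset)
  qed
  also have "\<dots> = (\<Sum>\<sigma>\<in>nonempty_subsets (?g ` P). (-1) ^ (card \<sigma> + 1) * of_bool (birth F \<sigma> \<le> t))"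
  proof (rule sum.mono_neutral_cong_left[OF fin sub], goal_cases)
    case 1
    then show ?case
    proof
      fix \<sigma> assume \<sigma>: "\<sigma> \<in> nonempty_subsets (?g ` P) - ?K"
      then have "finite \<sigma>" "\<sigma> \<noteq> {}" "\<sigma> \<subseteq> ?g ` P"
        using P by (auto simp: nonempty_subsets_def dest: finite_subset)
      with \<sigma> show "(-1) ^ (card \<sigma> + 1) * of_bool (birth F \<sigma> \<le> t) = (0::real)"
        by (auto simp: mem_filtration_complex_iff within_scale_iff_birth_le)
    qed
  next
    case (2 \<sigma>)
    then have "finite \<sigma>" "\<sigma> \<noteq> {}"
      using P subsetD[OF sub 2] by (auto simp: nonempty_subsets_def dest: finite_subset)
    with 2 show ?case by (auto simp: mem_filtration_complex_iff within_scale_iff_birth_le)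
  qed
  also have "\<dots> = chi F ?r t P"
    unfolding chi_def sum_nonempty_subsets_image[OF inj] by (simp add: card_image[OF inj])
  finally show ?thesis .
qed

lemma abs_chi_le:
  assumes "finite c" shows "\<bar>chi F r t c\<bar> \<le> 2 ^ card c"
proof -
  have "\<bar>chi F r t c\<bar> \<le> (\<Sum>\<sigma>\<in>nonempty_subsets c. 1)"
    unfolding chi_def by (rule order_trans[OF sum_abs sum_mono]) (auto simp: abs_mult power_abs)
  also have "\<dots> \<le> (\<Sum>\<sigma>\<in>Pow c. 1)"
    using assms by (intro sum_mono2) (auto simp: nonempty_subsets_def)
  finally show ?thesis using assms by (simp add: card_Pow)
qed

text \<open>The indicator of \<open>birth \<le> t\<close> jumps when the points move. It is the limit of continuous cutoffs \<open>\<phi> m\<close>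
that equal \<open>1\<close> up to \<open>t\<close> and vanish from \<open>t + 1/m\<close> on.\<close>

lemma borel_measurable_chi:
  "chi F r t \<in> borel_measurable (config_space :: 'a::euclidean_space set measure)"
proof -
  define \<phi> :: "nat \<Rightarrow> real \<Rightarrow> real" where "\<phi> m u = max 0 (1 - real m * max 0 (u - t))" for m u
  define \<psi> :: "nat \<Rightarrow> 'a set \<Rightarrow> real" where
    "\<psi> m c = (\<Sum>\<sigma>\<in>nonempty_subsets c. (-1) ^ (card \<sigma> + 1) * \<phi> m (birth F ((*\<^sub>R) r ` \<sigma>)))" for m c
  have "\<psi> m \<in> borel_measurable config_space" for m
  proof (rule borel_measurable_config_if_continuous)
    fix c :: "'a set" and f :: "nat \<Rightarrow> 'a \<Rightarrow> 'a"
    assume c: "finite c" and lim: "\<And>x. x \<in> c \<Longrightarrow> (\<lambda>j. f j x) \<longlonglongrightarrow> x"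
    have "(\<lambda>j. \<Sum>\<sigma>\<in>nonempty_subsets c. (-1) ^ (card \<sigma> + 1) *
        \<phi> m (birth F ((\<lambda>x. r *\<^sub>R f j x) ` \<sigma>))) \<longlonglongrightarrow> \<psi> m c"
      unfolding \<psi>_def \<phi>_def
    proof (intro tendsto_intros tendsto_birth)
      fix \<sigma> x assume "\<sigma> \<in> nonempty_subsets c"
      then show "finite \<sigma>" "\<sigma> \<noteq> {}" using c by (auto simp: nonempty_subsets_def dest: finite_subset)
      assume "x \<in> \<sigma>"
      then show "(\<lambda>j. f j x) \<longlonglongrightarrow> x"
        using lim \<open>\<sigma> \<in> nonempty_subsets c\<close> by (auto simp: nonempty_subsets_def)
    qed
    moreover have "\<forall>\<^sub>F j in sequentially. (\<Sum>\<sigma>\<in>nonempty_subsets c. (-1) ^ (card \<sigma> + 1) *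
        \<phi> m (birth F ((\<lambda>x. r *\<^sub>R f j x) ` \<sigma>))) = \<psi> m (f j ` c)"
    proof -
      have "\<forall>\<^sub>F j in sequentially. inj_on (f j) c"
        using c lim by (rule eventually_inj_on_of_tendsto)
      then show ?thesis
      proof eventually_elim
        case (elim j)
        then have "card (f j ` \<sigma>) = card \<sigma>" if "\<sigma> \<in> nonempty_subsets c" for \<sigma>
          using that by (intro card_image) (auto simp: nonempty_subsets_def intro: inj_on_subset)
        then show ?case
          unfolding \<psi>_def sum_nonempty_subsets_image[OF elim]
          by (intro sum.cong) (auto simp: image_image)
      qed
    qed
    ultimately show "(\<lambda>j. \<psi> m (f j ` c)) \<longlonglongrightarrow> \<psi> m c"
      by (rule Lim_transform_eventually)
  qed
  then show ?thesis
  proof (rule borel_measurable_LIMSEQ_real[rotated])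
    fix c :: "'a set"
    have "(\<lambda>m. \<phi> m u) \<longlonglongrightarrow> of_bool (u \<le> t)" for u
    proof (cases "u \<le> t")
      case False
      then have "\<forall>\<^sub>F m in sequentially. 1 / (u - t) \<le> real m"
        by (intro eventually_mono[OF eventually_ge_at_top[of "nat \<lceil>1 / (u - t)\<rceil>"]]) linarith
      then have "\<forall>\<^sub>F m in sequentially. \<phi> m u = 0"
        by eventually_elim (use False in \<open>auto simp: \<phi>_def field_simps\<close>)
      then show ?thesis using False by (simp add: tendsto_eventually)
    qed (simp add: \<phi>_def)
    then show "(\<lambda>m. \<psi> m c) \<longlonglongrightarrow> chi F r t c"
      unfolding \<psi>_def chi_def by (intro tendsto_intros)
  qed
qed

lemma tendsto_of_bool_at_right:
  "((\<lambda>s. of_bool (b \<le> s)) \<longlongrightarrow> (of_bool (b \<le> t) :: real)) (at_right (t::real))"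
proof (rule tendsto_eventually, cases "b \<le> t")
  case True
  then show "\<forall>\<^sub>F s in at_right t. of_bool (b \<le> s) = (of_bool (b \<le> t) :: real)"
    using eventually_at_right_less[of t] by (auto elim!: eventually_mono)
next
  case False
  then have "\<forall>\<^sub>F s in at_right t. s < b"    by (auto simp: eventually_at_right_field intro!: exI[of _ b])
  then show "\<forall>\<^sub>F s in at_right t. of_bool (b \<le> s) = (of_bool (b \<le> t) :: real)"
    by eventually_elim (use False in auto)
qed

lemma tendsto_of_bool_at_left:
  "((\<lambda>s. of_bool (b \<le> s)) \<longlongrightarrow> (of_bool (b < t) :: real)) (at_left (t::real))"
proof (rule tendsto_eventually, cases "b < t")
  case True
  then have "\<forall>\<^sub>F s in at_left t. b < s"    by (auto simp: eventually_at_left_field intro!: exI[of _ b])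
  then show "\<forall>\<^sub>F s in at_left t. of_bool (b \<le> s) = (of_bool (b < t) :: real)"
    by eventually_elim (use True in auto)
next
  case False
  have "\<forall>\<^sub>F s in at_left t. s < t" by (simp add: eventually_at_filter)
  then show "\<forall>\<^sub>F s in at_left t. of_bool (b \<le> s) = (of_bool (b < t) :: real)"
    by eventually_elim (use False in auto)
qed

text \<open>Each simplex contributes a step function that jumps at its birth time, where it takes the new value.\<close>

lemma chi_at_right: "((\<lambda>s. chi F r s c) \<longlongrightarrow> chi F r t c) (at_right t)"
  unfolding chi_def by (intro tendsto_intros tendsto_of_bool_at_right)

lemma chi_at_left: "((\<lambda>s. chi F r s c) \<longlongrightarrow>
    (\<Sum>\<sigma>\<in>nonempty_subsets c. (-1) ^ (card \<sigma> + 1) * of_bool (birth F ((*\<^sub>R) r ` \<sigma>) < t))) (at_left t)"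
  unfolding chi_def by (intro tendsto_intros tendsto_of_bool_at_left)

lemma tendsto_integral_dominated:
  fixes f :: "real \<Rightarrow> 'w \<Rightarrow> real"
  assumes meas: "\<And>s. f s \<in> borel_measurable M" "l \<in> borel_measurable M" and w: "integrable M w"
    and bound: "\<And>s \<omega>. \<omega> \<in> space M \<Longrightarrow> \<bar>f s \<omega>\<bar> \<le> w \<omega>"
    and lim: "\<And>\<omega>. \<omega> \<in> space M \<Longrightarrow> ((\<lambda>s. f s \<omega>) \<longlongrightarrow> l \<omega>) (at t within A)"
  shows "((\<lambda>s. \<integral>\<omega>. f s \<omega> \<partial>M) \<longlongrightarrow> (\<integral>\<omega>. l \<omega> \<partial>M)) (at t within A)"
  unfolding tendsto_at_iff_sequentially comp_def
proof (intro allI impI)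
  fix X :: "nat \<Rightarrow> real" assume X: "\<forall>i. X i \<in> A - {t}" "X \<longlonglongrightarrow> t"
  show "(\<lambda>i. \<integral>\<omega>. f (X i) \<omega> \<partial>M) \<longlonglongrightarrow> (\<integral>\<omega>. l \<omega> \<partial>M)"
  proof (rule integral_dominated_convergence[OF meas(2) meas(1) w])
    show "AE \<omega> in M. (\<lambda>i. f (X i) \<omega>) \<longlonglongrightarrow> l \<omega>"
      using lim X unfolding tendsto_at_iff_sequentially comp_def by (auto intro!: AE_I2)
  qed (use bound in \<open>auto intro!: AE_I2\<close>)
qed

section \<open>The path space\<close>

lemma borel_measurable_card_config:
  "(\<lambda>c. real (card c)) \<in> borel_measurable
     (config_space :: 'a::{metric_space, second_countable_topology} set measure)"
proof (rule borel_measurable_config_if_continuous)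
  fix c :: "'a set" and f :: "nat \<Rightarrow> 'a \<Rightarrow> 'a"
  assume "finite c" "\<And>x. x \<in> c \<Longrightarrow> (\<lambda>j. f j x) \<longlonglongrightarrow> x"
  then have "\<forall>\<^sub>F j in sequentially. inj_on (f j) c" by (rule eventually_inj_on_of_tendsto)
  then show "(\<lambda>j. real (card (f j ` c))) \<longlonglongrightarrow> real (card c)"
    by (intro tendsto_eventually) (auto elim!: eventually_mono simp: card_image)
qed

lemma borel_measurable_scaled_euler_char:
  assumes "1 \<le> n"
  shows "scaled_euler_char F n t \<in> borel_measurable (config_space :: (real ^ 'd) set measure)"
proof (subst measurable_cong)
  fix c :: "(real ^ 'd) set" assume "c \<in> space config_space"
  then show "scaled_euler_char F n t c = chi F (root CARD('d) (real n)) t c"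
    using assms by (simp add: space_config_space scaled_euler_char_eq_chi)
qed (rule borel_measurable_chi)

context
  fixes F :: filtration and T :: real and n :: nat and M :: "'w measure"
    and S :: "'w \<Rightarrow> (real ^ 'd) set"
  assumes prob: "prob_space M" and n: "1 \<le> n" and S: "S \<in> M \<rightarrow>\<^sub>M config_space"
    and int: "integrable M (\<lambda>\<omega>. 2 ^ card (S \<omega>) :: real)"
begin

lemma finite_config: "\<omega> \<in> space M \<Longrightarrow> finite (S \<omega>)"
  using measurable_space[OF S] by (auto simp: space_config_space)

lemma borel_measurable_scaled_euler_char_config [measurable]:
  "(\<lambda>\<omega>. scaled_euler_char F n t (S \<omega>)) \<in> borel_measurable M"
  using measurable_compose[OF S borel_measurable_scaled_euler_char[OF n]] .

lemma abs_scaled_euler_char_config_le: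
  "\<omega> \<in> space M \<Longrightarrow> \<bar>scaled_euler_char F n t (S \<omega>)\<bar> \<le> 2 ^ card (S \<omega>)"
  using abs_chi_le[OF finite_config] by (simp add: scaled_euler_char_eq_chi[OF finite_config n])

lemma integrable_scaled_euler_char:
  "integrable M (\<lambda>\<omega>. scaled_euler_char F n t (S \<omega>))"
  by (rule Bochner_Integration.integrable_bound[OF int])
     (auto intro!: AE_I2 abs_scaled_euler_char_config_le[THEN order_trans])

text \<open>The path itself is a finite sum of steps. The centring function inherits its one-sided limits by dominated
convergence; this is what the exponential moment of the number of points is for, as a configuration of \<open>m\<close>
points has fewer than \<open>2\<^sup>m\<close> simplices.\<close>

lemma chi_bar_cadlag:
  assumes \<omega>: "\<omega> \<in> space M"
  shows "chi_bar F T n M S \<omega> \<in> cadlag_functions T"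
proof -
  let ?r = "root CARD('d) (real n)"
  let ?f = "\<lambda>t. real n powr (-1/2) *
    (scaled_euler_char F n t (S \<omega>) - (\<integral>\<omega>'. scaled_euler_char F n t (S \<omega>') \<partial>M))"
  define left where "left t c = (\<Sum>\<sigma>\<in>nonempty_subsets c. (-1) ^ (card \<sigma> + 1) *
      of_bool (birth F ((*\<^sub>R) ?r ` \<sigma>) < t) :: real)" for t and c :: "(real ^ 'd) set"
  have right: "((\<lambda>s. scaled_euler_char F n s (S \<omega>)) \<longlongrightarrow> scaled_euler_char F n t (S \<omega>)) (at_right t)"
    if "\<omega> \<in> space M" for \<omega> t
    using chi_at_right[of F ?r "S \<omega>" t]
    by (simp add: scaled_euler_char_eq_chi[OF finite_config[OF that] n])
  have lft: "((\<lambda>s. scaled_euler_char F n s (S \<omega>)) \<longlongrightarrow> left t (S \<omega>)) (at_left t)"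
    if "\<omega> \<in> space M" for \<omega> t
    using chi_at_left[of F ?r "S \<omega>" t] unfolding left_def
    by (simp add: scaled_euler_char_eq_chi[OF finite_config[OF that] n])
  have [measurable]: "(\<lambda>\<omega>. left t (S \<omega>)) \<in> borel_measurable M" for t
  proof (rule borel_measurable_LIMSEQ_real)
    fix \<omega> assume "\<omega> \<in> space M"
    have "filterlim (\<lambda>i. t - 1 / real (Suc i)) (at_left t) sequentially"
      unfolding filterlim_at
      using tendsto_diff[OF tendsto_const LIMSEQ_Suc[OF lim_const_over_n[of 1]], of t] by simp
    from filterlim_compose[OF lft[OF \<open>\<omega> \<in> space M\<close>] this]
    show "(\<lambda>i. scaled_euler_char F n (t - 1 / real (Suc i)) (S \<omega>)) \<longlonglongrightarrow> left t (S \<omega>)" .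
  qed simp
  have "((\<lambda>t. \<integral>\<omega>'. scaled_euler_char F n t (S \<omega>') \<partial>M) \<longlongrightarrow>
      (\<integral>\<omega>'. scaled_euler_char F n t (S \<omega>') \<partial>M)) (at_right t)" for t
    by (rule tendsto_integral_dominated[OF _ _ int])
      (simp_all add: right abs_scaled_euler_char_config_le)
  then have R: "(?f \<longlongrightarrow> ?f t) (at_right t)" for t
    by (intro tendsto_intros right \<omega>)
  have "((\<lambda>t. \<integral>\<omega>'. scaled_euler_char F n t (S \<omega>') \<partial>M) \<longlongrightarrow>
      (\<integral>\<omega>'. left t (S \<omega>') \<partial>M)) (at_left t)" for t
    by (rule tendsto_integral_dominated[OF _ _ int])
      (simp_all add: lft abs_scaled_euler_char_config_le)
  then have L: "(?f \<longlongrightarrow> real n powr (-1/2) * (left t (S \<omega>) - (\<integral>\<omega>'. left t (S \<omega>') \<partial>M))) (at_left t)" for t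
    by (intro tendsto_intros lft \<omega>)
  show ?thesis
    unfolding cadlag_functions_def
  proof (intro CollectI conjI ballI)
    show "chi_bar F T n M S \<omega> \<in> extensional {0..T}" by (simp add: chi_bar_def)
    fix t assume t: "t \<in> {0..<T}"
    then have "\<forall>\<^sub>F s in at_right t. s \<in> {0..T}"
      by (auto simp: eventually_at_right_field intro!: exI[of _ T])
    then have "\<forall>\<^sub>F s in at_right t. ?f s = chi_bar F T n M S \<omega> s"
      by eventually_elim (simp add: chi_bar_def)
    then have "(chi_bar F T n M S \<omega> \<longlongrightarrow> ?f t) (at_right t)"
      by (rule Lim_transform_eventually[OF R])
    then show "(chi_bar F T n M S \<omega> \<longlongrightarrow> chi_bar F T n M S \<omega> t) (at_right t)"
      using t by (simp add: chi_bar_def)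
  next
    fix t assume t: "t \<in> {0<..T}"
    then have "\<forall>\<^sub>F s in at_left t. s \<in> {0..T}"
      by (auto simp: eventually_at_left_field intro!: exI[of _ 0])
    then have "\<forall>\<^sub>F s in at_left t. ?f s = chi_bar F T n M S \<omega> s"
      by eventually_elim (simp add: chi_bar_def)
    then show "\<exists>l. (chi_bar F T n M S \<omega> \<longlongrightarrow> l) (at_left t)"
      using Lim_transform_eventually[OF L] by blast
  qed
qed

lemma measurable_chi_bar: "chi_bar F T n M S \<in> M \<rightarrow>\<^sub>M cadlag_space T"
  unfolding cadlag_space_def
proof (rule measurable_restrict_space2)
  show "chi_bar F T n M S \<in> space M \<rightarrow> cadlag_functions T" using chi_bar_cadlag by blast
  show "chi_bar F T n M S \<in> M \<rightarrow>\<^sub>M (\<Pi>\<^sub>M t\<in>{0..T}. borel)"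
    unfolding chi_bar_def by (intro measurable_restrict) measurable
qed

end

lemma borel_measurable_pow_card_config:
  "(\<lambda>c. 2 ^ card c :: real) \<in> borel_measurable
     (config_space :: 'a::{metric_space, second_countable_topology} set measure)"
proof -
  have "(\<lambda>c. 2 powr real (card c)) \<in> borel_measurable (config_space :: 'a set measure)"
    using borel_measurable_card_config by measurable
  then show ?thesis by (simp add: powr_realpow)
qed

lemma chi_bar_law_config:
  fixes S :: "'w \<Rightarrow> (real ^ 'd) set"
  assumes M: "prob_space M" and n: "1 \<le> n" and S: "S \<in> M \<rightarrow>\<^sub>M config_space"
    and int: "integrable M (\<lambda>\<omega>. 2 ^ card (S \<omega>) :: real)"
  shows "chi_bar_law F T n M S = chi_bar_law F T n (distr M config_space S) (\<lambda>c. c)"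
proof -
  \<comment> \<open>Both the law and the centring are functions of the law \<open>P\<close> of the configuration.\<close>
  define P where "P = distr M config_space S"
  note meas = borel_measurable_pow_card_config[where 'a="real ^ 'd"]
  have P: "prob_space P" unfolding P_def by (rule prob_space.prob_space_distr[OF M S])
  have id: "(\<lambda>c. c) \<in> P \<rightarrow>\<^sub>M config_space" unfolding P_def by simp
  have intP: "integrable P (\<lambda>c. 2 ^ card c :: real)"
    unfolding P_def using int by (subst integrable_distr_eq[OF S meas])
  have "chi_bar F T n M S \<omega> = chi_bar F T n P (\<lambda>c. c) (S \<omega>)" for \<omega>
    unfolding chi_bar_def P_def
    by (simp add: integral_distr[OF S borel_measurable_scaled_euler_char[OF n]])
  then have "chi_bar F T n M S = chi_bar F T n P (\<lambda>c. c) \<circ> S" by (simp add: fun_eq_iff)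
  then show ?thesis
    unfolding chi_bar_law_def
    using distr_distr[OF measurable_chi_bar[OF P n id intP, of F T, unfolded P_def, simplified] S] 
    by (simp add: P_def)
qed

text \<open>The law of the process, centring included, depends on the random set only through the law of the latter.\<close>

lemma chi_bar_law_cong:
  fixes S :: "'w \<Rightarrow> (real ^ 'd) set" and S' :: "'v \<Rightarrow> (real ^ 'd) set"
  assumes M: "prob_space M" "prob_space M'" and n: "1 \<le> n"
    and S: "S \<in> M \<rightarrow>\<^sub>M config_space" "S' \<in> M' \<rightarrow>\<^sub>M config_space"
    and eq: "distr M config_space S = distr M' config_space S'"
    and int: "integrable M (\<lambda>\<omega>. 2 ^ card (S \<omega>) :: real)"
  shows "chi_bar_law F T n M S = chi_bar_law F T n M' S'"
proof -
  note meas = borel_measurable_pow_card_config[where 'a="real ^ 'd"]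
  have "integrable M' (\<lambda>\<omega>. 2 ^ card (S' \<omega>) :: real)"
    using int by (simp add: integrable_distr_eq[OF S(1) meas, symmetric] eq
        integrable_distr_eq[OF S(2) meas])
  then show ?thesis
    using chi_bar_law_config[OF M(1) n S(1) int] chi_bar_law_config[OF M(2) n S(2)] eq by metis
qed

section \<open>Samples of random size\<close>

text \<open>The bootstrap space with an arbitrary mark space in place of \<open>\<real>\<^sup>d\<close>, so that it can also carry coupled
pairs of points.\<close>

definition sampling_space :: "scheme \<Rightarrow> nat \<Rightarrow> 'e measure \<Rightarrow> (nat \<times> (nat \<Rightarrow> 'e)) measure" where
  "sampling_space s n Q = measure_pmf (sample_size_pmf s n) \<Otimes>\<^sub>M (\<Pi>\<^sub>M i\<in>UNIV. Q)"

definition sample :: "('e \<Rightarrow> 'a) \<Rightarrow> nat \<times> (nat \<Rightarrow> 'e) \<Rightarrow> 'a set" where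
  "sample \<xi> = (\<lambda>(N, Z). (\<lambda>i. \<xi> (Z i)) ` {1..N})"

lemma boot_space_eq: "boot_space s n k = sampling_space s n (density lborel (\<lambda>x. ennreal (k x)))"
  by (simp add: boot_space_def sampling_space_def)

lemma boot_sample_eq: "boot_sample = sample (\<lambda>x. x)"
  by (simp add: boot_sample_def sample_def)

lemma space_sampling_space: "space (sampling_space s n Q) = UNIV \<times> (UNIV \<rightarrow>\<^sub>E space Q)"
  by (simp add: sampling_space_def space_pair_measure space_PiM)

lemma prob_space_sampling_space: "prob_space Q \<Longrightarrow> prob_space (sampling_space s n Q)"
  unfolding sampling_space_def
  by (intro prob_space_pair prob_space_PiM measure_pmf.prob_space_axioms)

lemma measurable_sampling_space:
  assumes "\<And>N. (\<lambda>Z. f (N, Z)) \<in> (\<Pi>\<^sub>M i\<in>UNIV. Q) \<rightarrow>\<^sub>M K"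
  shows "f \<in> sampling_space s n Q \<rightarrow>\<^sub>M K"
proof -
  have "f \<in> count_space UNIV \<Otimes>\<^sub>M (\<Pi>\<^sub>M i\<in>UNIV. Q) \<rightarrow>\<^sub>M K"
    using assms by (intro measurable_pair_measure_countable1) auto
  also have "count_space UNIV \<Otimes>\<^sub>M (\<Pi>\<^sub>M i\<in>UNIV. Q) \<rightarrow>\<^sub>M K = sampling_space s n Q \<rightarrow>\<^sub>M K"
    unfolding sampling_space_def by (intro measurable_cong_sets sets_pair_measure_cong) auto
  finally show ?thesis .
qed

lemma nn_integral_sampling_space:
  assumes "prob_space Q" and f: "f \<in> borel_measurable (sampling_space s n Q)"
  shows "(\<integral>\<^sup>+\<omega>. f \<omega> \<partial>sampling_space s n Q) =
    (\<integral>\<^sup>+N. \<integral>\<^sup>+Z. f (N, Z) \<partial>(\<Pi>\<^sub>M i\<in>UNIV. Q) \<partial>measure_pmf (sample_size_pmf s n))"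
proof -
  interpret prob_space "\<Pi>\<^sub>M i\<in>(UNIV :: nat set). Q" by (intro prob_space_PiM assms)
  show ?thesis using nn_integral_fst[of f] f unfolding sampling_space_def by simp
qed

lemma measurable_sample:
  fixes \<xi> :: "'e \<Rightarrow> 'a::{metric_space, second_countable_topology}"
  assumes [measurable]: "\<xi> \<in> borel_measurable Q"
  shows "sample \<xi> \<in> sampling_space s n Q \<rightarrow>\<^sub>M config_space"
proof (rule measurable_sampling_space)
  fix N
  show "(\<lambda>Z. sample \<xi> (N, Z)) \<in> (\<Pi>\<^sub>M i\<in>UNIV. Q) \<rightarrow>\<^sub>M config_space"
  proof (rule measurable_config_spaceI)
    fix B :: "'a set" assume [measurable]: "B \<in> sets borel"
    have "{Z \<in> space (\<Pi>\<^sub>M i\<in>UNIV. Q). sample \<xi> (N, Z) \<inter> B = {}} =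
      {Z \<in> space (\<Pi>\<^sub>M i\<in>UNIV. Q). \<forall>i\<in>{1..N}. \<xi> (Z i) \<notin> B}"
      unfolding sample_def by auto
    also have "\<dots> \<in> sets (\<Pi>\<^sub>M i\<in>UNIV. Q)" by measurable
    finally show "{Z \<in> space (\<Pi>\<^sub>M i\<in>UNIV. Q). sample \<xi> (N, Z) \<inter> B = {}} \<in> sets (\<Pi>\<^sub>M i\<in>UNIV. Q)" .
  qed (simp add: sample_def)
qed

text \<open>The probability generating function of the sample size.\<close>

definition sample_size_pgf :: "scheme \<Rightarrow> nat \<Rightarrow> real \<Rightarrow> real" where
  "sample_size_pgf s n x = (case s of Poisson \<Rightarrow> exp (real n * (x - 1)) | Binomial \<Rightarrow> x ^ n)"

lemma nn_integral_poisson: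
  assumes "1 \<le> n"
  shows "(\<integral>\<^sup>+N. f N \<partial>measure_pmf (poisson_pmf (real n))) =
    (\<Sum>N. ennreal (real n ^ N / fact N * exp (- real n)) * f N)"
  using assms by (subst nn_integral_measure_pmf) (simp add: nn_integral_count_space_nat)

lemma nn_integral_sample_size_power:
  assumes n: "1 \<le> n" and x: "0 \<le> x"
  shows "(\<integral>\<^sup>+N. ennreal x ^ N \<partial>measure_pmf (sample_size_pmf s n)) = ennreal (sample_size_pgf s n x)"
proof (cases s)
  case Poisson
  have "(\<lambda>N. (real n * x) ^ N /\<^sub>R fact N * exp (- real n)) sums (exp (real n * x) * exp (- real n))"
    by (intro sums_mult2 exp_converges)
  then have "(\<Sum>N. ennreal ((real n * x) ^ N /\<^sub>R fact N * exp (- real n))) =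
      ennreal (exp (real n * x) * exp (- real n))"
    using x by (intro suminf_ennreal_eq) auto
  moreover have "ennreal (real n ^ N / fact N * exp (- real n)) * ennreal x ^ N =
      ennreal ((real n * x) ^ N /\<^sub>R fact N * exp (- real n))" for N
    using x by (simp add: ennreal_power ennreal_mult[symmetric] power_mult_distrib divide_inverse mult_ac)
  ultimately show ?thesis
    using Poisson by (simp add: nn_integral_poisson[OF n] sample_size_pgf_def exp_add[symmetric] algebra_simps)
next
  case Binomial
  then show ?thesis using x by (simp add: sample_size_pgf_def ennreal_power)
qed

lemma nn_integral_sample_size_times_power:
  assumes n: "1 \<le> n" and x: "1 \<le> x"
  shows "(\<integral>\<^sup>+N. ennreal (real N * x ^ (N - 1)) \<partial>measure_pmf (sample_size_pmf s n)) \<le>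
    ennreal (real n * exp (real n * (x - 1)))"
proof (cases s)
  case Poisson
  let ?h = "\<lambda>N. real n ^ N / fact N * exp (- real n) * (real N * x ^ (N - 1))"
  have "(\<lambda>N. (real n * x) ^ N /\<^sub>R fact N * (real n * exp (- real n))) sums
      (exp (real n * x) * (real n * exp (- real n)))"
    by (intro sums_mult2 exp_converges)
  moreover have "(real n * x) ^ N /\<^sub>R fact N * (real n * exp (- real n)) = ?h (Suc N)" for N
  proof -
    have "real n ^ Suc N / fact (Suc N) * real (Suc N) = real n * (real n ^ N / fact N)"
      by (simp add: fact_Suc del: of_nat_Suc)
    then have "?h (Suc N) = real n * (real n ^ N / fact N) * exp (- real n) * x ^ N"
    proof -
      have "?h (Suc N) = (real n ^ Suc N / fact (Suc N) * real (Suc N)) * exp (- real n) * x ^ N"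
        by (simp only: diff_Suc_1 mult_ac)
      then show ?thesis by (simp only: \<open>real n ^ Suc N / fact (Suc N) * real (Suc N) = _\<close>)
    qed
    then show ?thesis by (simp add: power_mult_distrib divide_inverse mult_ac)
  qed
  ultimately have "(\<lambda>N. ?h (Suc N)) sums (exp (real n * x) * (real n * exp (- real n)))"
    by simp
  from sums_Suc[OF this] have "?h sums (exp (real n * x) * (real n * exp (- real n)))" by simp
  then have "(\<Sum>N. ennreal (?h N)) = ennreal (exp (real n * x) * (real n * exp (- real n)))"
    using x by (intro suminf_ennreal_eq) auto
  moreover have "ennreal (real n ^ N / fact N * exp (- real n)) * ennreal (real N * x ^ (N - 1)) =
      ennreal (?h N)" for N
    using x by (simp add: ennreal_mult[symmetric])
  ultimately show ?thesis
    using Poisson by (simp add: nn_integral_poisson[OF n] algebra_simps exp_diff exp_minus divide_inverse)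
next
  case Binomial
  have "x ^ (n - 1) \<le> exp (x - 1) ^ (n - 1)"
    using x exp_ge_add_one_self[of "x - 1"] by (intro power_mono) auto
  also have "\<dots> = exp (real (n - 1) * (x - 1))" by (simp add: exp_of_nat_mult)
  also have "\<dots> \<le> exp (real n * (x - 1))" using x by (simp add: mult_right_mono)
  finally have "real n * x ^ (n - 1) \<le> real n * exp (real n * (x - 1))"
    by (intro mult_left_mono) auto
  then show ?thesis using Binomial by (simp add: ennreal_leI)
qed

text \<open>A Mecke identity: removing \<open>a\<close> chosen points from a Poisson number of points leaves a Poisson number of points.
In terms of the weights, \<open>n\<^sup>N/N! \<sqdot> (N choose a) = n\<^sup>a/a! \<sqdot> n\<^sup>N\<^sup>-\<^sup>a/(N - a)!\<close>.\<close>

lemma poisson_factorial_shift: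
  fixes g f :: "nat \<Rightarrow> ennreal"
  assumes n: "1 \<le> n"
  shows "(\<integral>\<^sup>+N. (\<Sum>a\<le>N. of_nat (N choose a) * g a * f (N - a)) \<partial>measure_pmf (poisson_pmf (real n))) =
    (\<Sum>a. ennreal (real n ^ a / fact a) * g a) * (\<integral>\<^sup>+N. f N \<partial>measure_pmf (poisson_pmf (real n)))"
proof -
  define w where "w N = real n ^ N / fact N * exp (- real n)" for N
  define k where "k N a = (if a \<le> N then ennreal (w N) * (of_nat (N choose a) * g a * f (N - a)) else 0)"
    for N a
  have w0: "0 \<le> w N" for N by (simp add: w_def)
  have row: "ennreal (w N) * (\<Sum>a\<le>N. of_nat (N choose a) * g a * f (N - a)) = (\<Sum>a. k N a)" for N
  proof -
    have "(\<Sum>a. k N a) = (\<Sum>a\<le>N. k N a)" by (rule suminf_finite) (auto simp: k_def)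
    then show ?thesis by (simp add: k_def sum_distrib_left)
  qed
  \<comment> \<open>This is the identity between the weights.\<close>
  have wshift: "ennreal (w (M + a)) * of_nat ((M + a) choose a) = ennreal (real n ^ a / fact a) * ennreal (w M)"
    for M a
  proof -
    have "w (M + a) * real ((M + a) choose a) = real n ^ a / fact a * w M"
      unfolding w_def by (simp add: binomial_fact power_add)
    then show ?thesis
      using w0 by (simp add: ennreal_of_nat_eq_real_of_nat ennreal_mult[symmetric])
  qed
  have col: "(\<Sum>N. k N a) = ennreal (real n ^ a / fact a) * g a * (\<Sum>M. ennreal (w M) * f M)" for a
  proof -
    have shift: "k (M + a) a = ennreal (real n ^ a / fact a) * g a * (ennreal (w M) * f M)" for M
    proof -
      have "k (M + a) a = ennreal (w (M + a)) * of_nat ((M + a) choose a) * g a * f M"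
        by (simp add: k_def mult_ac)
      then show ?thesis unfolding wshift by (simp add: mult_ac)
    qed
    have "(\<Sum>N. k N a) = (\<Sum>M. k (M + a) a) + (\<Sum>N<a. k N a)" by (intro suminf_offset) simp
    also have "(\<Sum>N<a. k N a) = 0" by (simp add: k_def)
    finally show ?thesis unfolding shift by simp
  qed
  have "(\<integral>\<^sup>+N. (\<Sum>a\<le>N. of_nat (N choose a) * g a * f (N - a)) \<partial>measure_pmf (poisson_pmf (real n))) =
      (\<Sum>N. \<Sum>a. k N a)"
    unfolding nn_integral_poisson[OF n] w_def[symmetric] row ..
  also have "\<dots> = (\<Sum>a. \<Sum>N. k N a)"
    using nn_integral_suminf[of "\<lambda>a N. k N a" "count_space UNIV"]
    by (simp add: nn_integral_count_space_nat)
  also have "\<dots> = (\<Sum>a. ennreal (real n ^ a / fact a) * g a) * (\<Sum>M. ennreal (w M) * f M)"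
    unfolding col by simp
  finally show ?thesis unfolding nn_integral_poisson[OF n] w_def .
qed

text \<open>If \<open>g a\<close> is the probability that \<open>a\<close> given points form a simplex of some kind, then \<open>\<phi> N\<close> is the mean number
of such simplices among \<open>N\<close> points and the integrand on the left is the mean number of ordered disjoint
pairs of them. In the Poisson case removal of the points of the first simplex does not change the law of the rest,
and there is equality; in the binomial case it can only lower the number of simplices.\<close>

lemma sample_size_disjoint_pairs:
  fixes g :: "nat \<Rightarrow> ennreal"
  defines "\<phi> \<equiv> \<lambda>N. \<Sum>a\<le>N. of_nat (N choose a) * g a"
  assumes n: "1 \<le> n"
  shows "(\<integral>\<^sup>+N. (\<Sum>a\<le>N. of_nat (N choose a) * g a * \<phi> (N - a)) \<partial>measure_pmf (sample_size_pmf s n)) \<le>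
    (\<integral>\<^sup>+N. \<phi> N \<partial>measure_pmf (sample_size_pmf s n))\<^sup>2"
proof (cases s)
  case Poisson
  have "(\<integral>\<^sup>+N. \<phi> N \<partial>measure_pmf (poisson_pmf (real n))) = (\<Sum>a. ennreal (real n ^ a / fact a) * g a)"
    using poisson_factorial_shift[OF n, of g "\<lambda>_. 1"] measure_pmf.emeasure_space_1[of "poisson_pmf (real n)"]
    by (simp add: \<phi>_def)
  then show ?thesis
    using Poisson poisson_factorial_shift[OF n, of g \<phi>] by (simp add: power2_eq_square)
next
  case Binomial
  have "\<phi> (n - a) \<le> \<phi> n" for a
  proof -
    have "\<phi> (n - a) \<le> (\<Sum>b\<le>n - a. of_nat (n choose b) * g b)"
      unfolding \<phi>_def by (intro sum_mono mult_right_mono) (auto intro!: binomial_right_mono of_nat_mono)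
    also have "\<dots> \<le> \<phi> n" unfolding \<phi>_def by (intro sum_mono2) auto
    finally show ?thesis .
  qed
  then have "(\<Sum>a\<le>n. of_nat (n choose a) * g a * \<phi> (n - a)) \<le> (\<Sum>a\<le>n. of_nat (n choose a) * g a * \<phi> n)"
    by (intro sum_mono mult_left_mono) auto
  also have "\<dots> = (\<phi> n)\<^sup>2" by (simp add: \<phi>_def power2_eq_square sum_distrib_right)
  finally show ?thesis using Binomial by simp
qed

text \<open>Given the size \<open>N\<close>, the sample avoids \<open>B\<close> with probability \<open>p\<^sup>N\<close>, where \<open>p\<close> is the probability that one point
avoids it.\<close>

lemma void_probability_sample:
  fixes \<xi> :: "'e \<Rightarrow> 'a::{metric_space, second_countable_topology}"
  assumes Q: "prob_space Q" and \<xi>: "\<xi> \<in> borel_measurable Q" and n: "1 \<le> n" and B: "B \<in> sets borel"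
  shows "measure (sampling_space s n Q) {\<omega> \<in> space (sampling_space s n Q). sample \<xi> \<omega> \<inter> B = {}} =
    sample_size_pgf s n (measure (distr Q borel \<xi>) (- B))"
proof -
  interpret Q: prob_space Q by fact
  interpret product_prob_space "\<lambda>_::nat. Q" UNIV by standard
  note [measurable] = \<xi> B
  let ?E = "{\<omega> \<in> space (sampling_space s n Q). sample \<xi> \<omega> \<inter> B = {}}"
  let ?x = "measure (distr Q borel \<xi>) (- B)"
  have x: "?x = measure Q {z \<in> space Q. \<xi> z \<notin> B}"
    by (subst measure_distr) (auto intro!: arg_cong[where f="measure Q"])
  have E [measurable]: "?E \<in> sets (sampling_space s n Q)"
    by (rule void_event_measurable[OF measurable_sample[OF \<xi>] B])
  have "(\<integral>\<^sup>+Z. indicator ?E (N, Z) \<partial>(\<Pi>\<^sub>M i\<in>UNIV. Q)) = ennreal ?x ^ N" for N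
  proof -
    have "(\<integral>\<^sup>+Z. indicator ?E (N, Z) \<partial>(\<Pi>\<^sub>M i\<in>UNIV. Q)) =
      (\<integral>\<^sup>+Z. indicator {Z \<in> space (\<Pi>\<^sub>M i\<in>UNIV. Q). \<forall>i\<in>{1..N}. Z i \<in> {z \<in> space Q. \<xi> z \<notin> B}} Z
        \<partial>(\<Pi>\<^sub>M i\<in>UNIV. Q))"
      by (intro nn_integral_cong)
        (auto simp: indicator_def space_sampling_space sample_def space_PiM Pi_iff)
    also have "\<dots> = emeasure (\<Pi>\<^sub>M i\<in>UNIV. Q)
        {Z \<in> space (\<Pi>\<^sub>M i\<in>UNIV. Q). \<forall>i\<in>{1..N}. Z i \<in> {z \<in> space Q. \<xi> z \<notin> B}}"
      by (rule nn_integral_indicator) measurable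
    also have "\<dots> = (\<Prod>i\<in>{1..N}. emeasure Q {z \<in> space Q. \<xi> z \<notin> B})"
      by (rule emeasure_PiM_Collect) auto
    finally show ?thesis by (simp add: x Q.emeasure_eq_measure)
  qed
  then have "emeasure (sampling_space s n Q) ?E = ennreal (sample_size_pgf s n ?x)"
    using nn_integral_sampling_space[OF Q, of "indicator ?E" s n]
    by (simp add: nn_integral_sample_size_power[OF n] measure_nonneg)
  moreover have "0 \<le> sample_size_pgf s n ?x"
    by (cases s) (auto simp: sample_size_pgf_def measure_nonneg)
  ultimately show ?thesis by (simp add: measure_def)
qed

lemma sample_law_cong:
  fixes \<xi> :: "'e \<Rightarrow> 'a::{metric_space, second_countable_topology}" and \<xi>' :: "'f \<Rightarrow> 'a"
  assumes "prob_space Q" "prob_space Q'" "\<xi> \<in> borel_measurable Q" "\<xi>' \<in> borel_measurable Q'" "1 \<le> n"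
    and "distr Q borel \<xi> = distr Q' borel \<xi>'"
  shows "distr (sampling_space s n Q) config_space (sample \<xi>) =
    distr (sampling_space s n Q') config_space (sample \<xi>')"
  using assms
  by (intro config_law_eq_if_void_probabilities_eq prob_space_sampling_space measurable_sample)
    (simp_all add: void_probability_sample)

lemma integrable_pow_card_sample:
  fixes \<xi> :: "'e \<Rightarrow> 'a::{metric_space, second_countable_topology}"
  assumes Q: "prob_space Q" and \<xi>: "\<xi> \<in> borel_measurable Q" and n: "1 \<le> n"
  shows "integrable (sampling_space s n Q) (\<lambda>\<omega>. 2 ^ card (sample \<xi> \<omega>) :: real)"
proof (rule integrableI_bounded)
  show "(\<lambda>\<omega>. 2 ^ card (sample \<xi> \<omega>) :: real) \<in> borel_measurable (sampling_space s n Q)"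
    by (rule measurable_compose[OF measurable_sample[OF \<xi>] borel_measurable_pow_card_config])
  have fst [measurable]: "(\<lambda>\<omega>. ennreal 2 ^ fst \<omega>) \<in> borel_measurable (sampling_space s n Q)"
    by (rule measurable_sampling_space) simp
  have PiM1: "emeasure (\<Pi>\<^sub>M i\<in>(UNIV::nat set). Q) (space (\<Pi>\<^sub>M i\<in>UNIV. Q)) = 1"
    by (intro prob_space.emeasure_space_1 prob_space_PiM Q)
  have "(\<integral>\<^sup>+\<omega>. ennreal (norm (2 ^ card (sample \<xi> \<omega>) :: real)) \<partial>sampling_space s n Q) \<le>
      (\<integral>\<^sup>+\<omega>. ennreal 2 ^ fst \<omega> \<partial>sampling_space s n Q)"
  proof (intro nn_integral_mono)
    fix \<omega> :: "nat \<times> (nat \<Rightarrow> 'e)"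
    have "card (sample \<xi> \<omega>) \<le> fst \<omega>"
      unfolding sample_def by (auto split: prod.split intro!: order_trans[OF card_image_le])
    then have "(2::real) ^ card (sample \<xi> \<omega>) \<le> 2 ^ fst \<omega>" by (rule power_increasing) simp
    then show "ennreal (norm (2 ^ card (sample \<xi> \<omega>) :: real)) \<le> ennreal 2 ^ fst \<omega>"
      by (simp add: ennreal_power ennreal_leI del: ennreal_numeral)
  qed
  also have "\<dots> = ennreal (sample_size_pgf s n 2)"
    by (subst nn_integral_sampling_space[OF Q fst])
      (simp add: nn_integral_sample_size_power[OF n, symmetric] PiM1 del: ennreal_numeral)
  finally show "(\<integral>\<^sup>+\<omega>. ennreal (norm (2 ^ card (sample \<xi> \<omega>) :: real)) \<partial>sampling_space s n Q) < \<infinity>"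
    using le_less_trans ennreal_less_top by (auto simp: less_top[symmetric] top_unique)
qed

section \<open>Second moments of simplex counts\<close>

text \<open>Here \<open>ev I Z\<close> says that the points of the sample \<open>Z\<close> with indices in \<open>I\<close> form a simplex that is to be counted.
The crucial assumption is \<open>ev_near\<close>: two counted simplices with a common vertex lie together in
the neighbourhood of a bad vertex of the first one. Bad points are rare (\<open>\<delta>\<close>) and neighbourhoods are
small (\<open>q\<close>).\<close>

locale simplex_events =
  fixes Q :: "'e measure" and ev :: "nat set \<Rightarrow> (nat \<Rightarrow> 'e) \<Rightarrow> bool"
    and bad :: "'e \<Rightarrow> bool" and near :: "'e \<Rightarrow> 'e \<Rightarrow> bool" and \<delta> q :: real
  assumes prob_Q: "prob_space Q" and nonneg: "0 \<le> \<delta>" "0 \<le> q"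
    and ev_measurable: "\<And>I. finite I \<Longrightarrow> Measurable.pred (\<Pi>\<^sub>M i\<in>UNIV. Q) (ev I)"
    and ev_local: "\<And>I Z Z'. (\<And>i. i \<in> I \<Longrightarrow> Z i = Z' i) \<Longrightarrow> ev I Z = ev I Z'"
    and ev_reindex: "\<And>\<pi> I Z. inj_on \<pi> I \<Longrightarrow> ev (\<pi> ` I) Z = ev I (\<lambda>i. Z (\<pi> i))"
    and ev_empty: "\<And>Z. \<not> ev {} Z"
    and ev_near: "\<And>I J Z. ev I Z \<Longrightarrow> ev J Z \<Longrightarrow> I \<inter> J \<noteq> {} \<Longrightarrow>
      \<exists>i\<in>I. bad (Z i) \<and> (\<forall>j\<in>I \<union> J. near (Z i) (Z j))"
    and bad_measurable: "Measurable.pred Q bad"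
    and near_measurable: "Measurable.pred (Q \<Otimes>\<^sub>M Q) (\<lambda>p. near (fst p) (snd p))"
    and bad_prob: "emeasure Q {z \<in> space Q. bad z} \<le> ennreal \<delta>"
    and near_prob: "\<And>x. x \<in> space Q \<Longrightarrow> emeasure Q {y \<in> space Q. near x y} \<le> ennreal q"
begin

abbreviation "QQ \<equiv> \<Pi>\<^sub>M i\<in>(UNIV :: nat set). Q"

interpretation Q: prob_space Q by (rule prob_Q)
interpretation QQ: prob_space QQ by (intro prob_space_PiM prob_Q)
interpretation PQ: product_prob_space "\<lambda>_::nat. Q" I for I by standard

lemmas [measurable] = bad_measurable near_measurable

lemma ev_measurable_coordinates:
  assumes "finite I"
  shows "Measurable.pred (\<Pi>\<^sub>M i\<in>I. Q) (ev I)"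
proof -
  obtain z where z: "z \<in> space Q" using Q.not_empty by auto
  have "(\<lambda>Y. if i \<in> I then Y i else z) \<in> (\<Pi>\<^sub>M i\<in>I. Q) \<rightarrow>\<^sub>M Q" for i
    using z by (cases "i \<in> I") simp_all
  then have "(\<lambda>Y i. if i \<in> I then Y i else z) \<in> (\<Pi>\<^sub>M i\<in>I. Q) \<rightarrow>\<^sub>M QQ"
    using z by (intro measurable_PiM_single') (auto simp: space_PiM)
  from measurable_compose[OF this ev_measurable[OF assms]]
  have "Measurable.pred (\<Pi>\<^sub>M i\<in>I. Q) (\<lambda>Y. ev I (\<lambda>i. if i \<in> I then Y i else z))" .
  also have "(\<lambda>Y. ev I (\<lambda>i. if i \<in> I then Y i else z)) = ev I"
    by (intro ext ev_local) simp
  finally show ?thesis .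
qed

text \<open>The probability that \<open>a\<close> given points form a counted simplex. As the points are exchangeable, it does not
matter which ones (\<open>prob_ev\<close>).\<close>

definition g :: "nat \<Rightarrow> real" where
  "g a = measure (\<Pi>\<^sub>M i\<in>{1..a}. Q) {Y \<in> space (\<Pi>\<^sub>M i\<in>{1..a}. Q). ev {1..a} Y}"

lemma prob_ev:
  assumes "finite I"
  shows "measure QQ {Z \<in> space QQ. ev I Z} = g (card I)"
proof -
  obtain \<pi> where \<pi>: "bij_betw \<pi> {1..card I} I"
    using ex_bij_betw_nat_finite_1[OF assms] by auto
  let ?R = "\<lambda>Z. \<lambda>n\<in>{1..card I}. Z (\<pi> n)"
  have R: "?R \<in> QQ \<rightarrow>\<^sub>M (\<Pi>\<^sub>M i\<in>{1..card I}. Q)" by measurable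
  have law: "distr QQ (\<Pi>\<^sub>M i\<in>{1..card I}. Q) ?R = (\<Pi>\<^sub>M i\<in>{1..card I}. Q)"
    using \<pi> by (intro distr_PiM_reindex[of UNIV "\<lambda>_. Q"]) (auto simp: bij_betw_def prob_Q)
  have "ev I Z = ev {1..card I} (?R Z)" for Z
  proof -
    have "ev I Z = ev {1..card I} (\<lambda>i. Z (\<pi> i))"
      using ev_reindex[of \<pi> "{1..card I}" Z] \<pi> by (simp add: bij_betw_def)
    also have "\<dots> = ev {1..card I} (?R Z)" by (rule ev_local) simp
    finally show ?thesis .
  qed
  then have "measure QQ {Z \<in> space QQ. ev I Z} = measure QQ (?R -` {Y \<in> space (\<Pi>\<^sub>M i\<in>{1..card I}. Q). ev {1..card I} Y} \<inter> space QQ)"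
    using measurable_space[OF R] by (intro arg_cong[where f="measure QQ"]) auto
  also have "\<dots> = measure (distr QQ (\<Pi>\<^sub>M i\<in>{1..card I}. Q) ?R) {Y \<in> space (\<Pi>\<^sub>M i\<in>{1..card I}. Q). ev {1..card I} Y}"
    using ev_measurable_coordinates[of "{1..card I}"] by (intro measure_distr[symmetric] R) auto
  finally show ?thesis unfolding law g_def .
qed

lemma coordinates_indep: "QQ.indep_vars (\<lambda>_. Q) (\<lambda>i Z. Z i) UNIV"
proof (subst QQ.indep_vars_iff_distr_eq_PiM')
  have "distr QQ QQ (\<lambda>Z. \<lambda>i\<in>UNIV. Z i) = QQ" by (simp add: restrict_def distr_id2)
  moreover have "distr QQ Q (\<lambda>Z. Z i) = Q" for i by (rule PQ.PiM_component) simp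
  ultimately show "distr QQ QQ (\<lambda>Z. \<lambda>i\<in>UNIV. Z i) = (\<Pi>\<^sub>M i\<in>UNIV. distr QQ Q (\<lambda>Z. Z i))" by simp
qed simp_all

lemma prob_ev_disjoint:
  assumes fin: "finite I" "finite J" and disj: "I \<inter> J = {}"
  shows "measure QQ {Z \<in> space QQ. ev I Z \<and> ev J Z} = g (card I) * g (card J)"
proof -
  let ?X = "\<lambda>I. {Y \<in> space (\<Pi>\<^sub>M i\<in>I. Q). ev I Y}"
  have X: "?X I \<in> sets (\<Pi>\<^sub>M i\<in>I. Q)" if "finite I" for I
    using ev_measurable_coordinates[OF that] by simp
  have pre: "(\<lambda>Z. restrict Z I) -` ?X I \<inter> space QQ = {Z \<in> space QQ. ev I Z}" for I
  proof -
    have "ev I (restrict Z I) = ev I Z" for Z by (rule ev_local) simp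
    then show ?thesis by (auto simp: space_PiM)
  qed
  have "QQ.indep_var (\<Pi>\<^sub>M i\<in>I. Q) (\<lambda>Z. restrict Z I) (\<Pi>\<^sub>M i\<in>J. Q) (\<lambda>Z. restrict Z J)"
    using QQ.indep_var_restrict[OF coordinates_indep disj] by simp
  from QQ.indep_varD[OF this X[OF fin(1)] X[OF fin(2)]]
  have "measure QQ ((\<lambda>Z. (restrict Z I, restrict Z J)) -` (?X I \<times> ?X J) \<inter> space QQ) =
      g (card I) * g (card J)"
    unfolding pre by (simp add: prob_ev fin)
  also have "(\<lambda>Z. (restrict Z I, restrict Z J)) -` (?X I \<times> ?X J) \<inter> space QQ =
      ((\<lambda>Z. restrict Z I) -` ?X I \<inter> space QQ) \<inter> ((\<lambda>Z. restrict Z J) -` ?X J \<inter> space QQ)"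
    by auto
  finally show ?thesis unfolding pre by (simp add: Int_def conj_ac)
qed

definition evcount :: "nat \<times> (nat \<Rightarrow> 'e) \<Rightarrow> real" where
  "evcount = (\<lambda>(N, Z). real (card {I \<in> Pow {1..N}. ev I Z}))"

lemma evcount_eq: "evcount (N, Z) = (\<Sum>I\<in>Pow {1..N}. of_bool (ev I Z))"
  by (simp add: evcount_def sum_of_bool_eq Int_def conj_commute)

lemma ev_count_measurable [measurable]: "evcount \<in> borel_measurable (sampling_space s n Q)"
proof (rule measurable_sampling_space)
  fix N
  have [measurable]: "Measurable.pred QQ (ev I)" if "I \<in> Pow {1..N}" for I
    using that by (intro ev_measurable) (auto dest: finite_subset)
  show "(\<lambda>Z. evcount (N, Z)) \<in> borel_measurable QQ"
    unfolding evcount_eq by measurable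
qed

lemma choose_sum: "(\<Sum>I\<in>Pow A. h (card I)) = (\<Sum>a\<le>card A. of_nat (card A choose a) * h a :: 'z::comm_semiring_1)"
  if "finite A" for A :: "nat set"
proof -
  have "(\<Sum>a\<le>card A. \<Sum>I\<in>{I \<in> Pow A. card I = a}. h (card I)) = (\<Sum>I\<in>Pow A. h (card I))"
    using that by (intro sum.group) (auto intro: card_mono)
  moreover have "(\<Sum>I\<in>{I \<in> Pow A. card I = a}. h (card I)) = of_nat (card A choose a) * h a" for a
    using n_subsets[OF that, of a] by (simp add: Pow_def)
  ultimately show ?thesis by simp
qed

definition \<phi> :: "nat \<Rightarrow> ennreal" where
  "\<phi> N = (\<Sum>a\<le>N. of_nat (N choose a) * ennreal (g a))"

lemma nn_integral_ev:
  assumes "finite I"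
  shows "(\<integral>\<^sup>+Z. ennreal (of_bool (ev I Z)) \<partial>QQ) = ennreal (g (card I))"
proof -
  have "(\<integral>\<^sup>+Z. ennreal (of_bool (ev I Z)) \<partial>QQ) = (\<integral>\<^sup>+Z. indicator {Z \<in> space QQ. ev I Z} Z \<partial>QQ)"
    by (intro nn_integral_cong) (auto simp: indicator_def)
  also have "\<dots> = emeasure QQ {Z \<in> space QQ. ev I Z}"
    using ev_measurable[OF assms] by (intro nn_integral_indicator) simp
  finally show ?thesis using prob_ev[OF assms] by (simp add: QQ.emeasure_eq_measure)
qed

lemma nn_integral_evcount: "(\<integral>\<^sup>+Z. ennreal (evcount (N, Z)) \<partial>QQ) = \<phi> N"
proof -
  have meas: "(\<lambda>Z. ennreal (of_bool (ev I Z))) \<in> borel_measurable QQ" if "I \<in> Pow {1..N}" for I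
  proof -
    have [measurable]: "Measurable.pred QQ (ev I)"
      using that by (intro ev_measurable) (auto dest: finite_subset)
    show ?thesis by measurable
  qed
  have "(\<integral>\<^sup>+Z. ennreal (evcount (N, Z)) \<partial>QQ) = (\<integral>\<^sup>+Z. (\<Sum>I\<in>Pow {1..N}. ennreal (of_bool (ev I Z))) \<partial>QQ)"
    unfolding evcount_eq by (simp add: sum_ennreal)
  also have "\<dots> = (\<Sum>I\<in>Pow {1..N}. \<integral>\<^sup>+Z. ennreal (of_bool (ev I Z)) \<partial>QQ)"
    by (rule nn_integral_sum[OF meas])
  also have "\<dots> = (\<Sum>I\<in>Pow {1..N}. ennreal (g (card I)))"
    by (intro sum.cong refl nn_integral_ev) (auto dest: finite_subset)
  also have "\<dots> = \<phi> N" unfolding \<phi>_def by (subst choose_sum) auto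
  finally show ?thesis .
qed

text \<open>If point \<open>i\<close> is bad, this is \<open>4\<close> to the number of points in its neighbourhood, \<open>i\<close> included; otherwise it is
\<open>0\<close>. The product form allows the other points to be integrated out one by one.\<close>

definition hub :: "nat \<Rightarrow> nat \<Rightarrow> (nat \<Rightarrow> 'e) \<Rightarrow> ennreal" where
  "hub N i Z = (\<Prod>j\<in>{1..N} - {i}. if near (Z i) (Z j) then 4 else 1) * (if bad (Z i) then 4 else 0)"

text \<open>Both simplices are subsets of the neighbourhood \<open>U\<close> of a bad point, and \<open>U\<close> has \<open>2\<^bsup>|U|\<^esup> \<sqdot> 2\<^bsup>|U|\<^esup>\<close>
pairs of subsets.\<close>

lemma intersecting_pairs_le:
  "of_nat (card {(I, J). I \<subseteq> {1..N} \<and> J \<subseteq> {1..N} \<and> I \<inter> J \<noteq> {} \<and> ev I Z \<and> ev J Z}) \<le> (\<Sum>i\<in>{1..N}. hub N i Z)"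
proof -
  let ?U = "\<lambda>i. insert i {j \<in> {1..N}. near (Z i) (Z j)}"
  let ?B = "{i \<in> {1..N}. bad (Z i)}"
  let ?P = "{(I, J). I \<subseteq> {1..N} \<and> J \<subseteq> {1..N} \<and> I \<inter> J \<noteq> {} \<and> ev I Z \<and> ev J Z}"
  have "?P \<subseteq> (\<Union>i\<in>?B. Pow (?U i) \<times> Pow (?U i))"
  proof
    fix p assume "p \<in> ?P"
    then obtain I J where p: "p = (I, J)" and IJ: "I \<subseteq> {1..N}" "J \<subseteq> {1..N}" "ev I Z" "ev J Z"
      and ne: "I \<inter> J \<noteq> {}" by auto
    obtain i where "i \<in> I" "bad (Z i)" "\<forall>j\<in>I \<union> J. near (Z i) (Z j)"
      using ev_near[OF IJ(3,4) ne] by auto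
    with IJ show "p \<in> (\<Union>i\<in>?B. Pow (?U i) \<times> Pow (?U i))"
      unfolding p by (intro UN_I[of i]) auto
  qed
  then have "card ?P \<le> card (\<Union>i\<in>?B. Pow (?U i) \<times> Pow (?U i))"
    by (intro card_mono) auto
  also have "\<dots> \<le> (\<Sum>i\<in>?B. card (Pow (?U i) \<times> Pow (?U i)))" by (intro card_UN_le) simp
  also have "\<dots> = (\<Sum>i\<in>?B. 4 ^ card (?U i))"
    by (simp add: card_cartesian_product card_Pow power_mult_distrib[symmetric])
  finally have "card ?P \<le> (\<Sum>i\<in>?B. 4 ^ card (?U i))" .
  then have "of_nat (card ?P) \<le> (of_nat (\<Sum>i\<in>?B. 4 ^ card (?U i)) :: ennreal)"
    by (rule of_nat_mono)
  also have "\<dots> = (\<Sum>i\<in>?B. 4 ^ card (?U i))"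
    unfolding of_nat_sum of_nat_power of_nat_numeral ..
  also have "\<dots> = (\<Sum>i\<in>?B. hub N i Z)"
  proof (intro sum.cong refl)
    fix i assume i: "i \<in> ?B"
    let ?V = "{j \<in> {1..N} - {i}. near (Z i) (Z j)}"
    have "?U i = insert i ?V" using i by auto
    then have "(4::ennreal) ^ card (?U i) = 4 * 4 ^ card ?V" by simp
    also have "(4::ennreal) ^ card ?V = (\<Prod>j\<in>{1..N} - {i}. if near (Z i) (Z j) then 4 else 1)"
      by (simp add: prod.If_cases Int_def)
    finally show "(4::ennreal) ^ card (?U i) = hub N i Z" using i by (simp add: hub_def mult.commute)
  qed
  also have "\<dots> \<le> (\<Sum>i\<in>{1..N}. hub N i Z)" by (intro sum_mono2) auto
  finally show ?thesis .
qed

lemma hub_measurable [measurable]: "i \<in> K \<Longrightarrow> {1..N} \<subseteq> K \<Longrightarrow> hub N i \<in> borel_measurable (\<Pi>\<^sub>M i\<in>K. Q)"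
proof -
  assume i: "i \<in> K" and K: "{1..N} \<subseteq> K"
  have [measurable]: "Measurable.pred (\<Pi>\<^sub>M i\<in>K. Q) (\<lambda>Z. near (Z i) (Z j))" if "j \<in> {1..N} - {i}" for j
  proof -
    have "(\<lambda>Z. (Z i, Z j)) \<in> (\<Pi>\<^sub>M i\<in>K. Q) \<rightarrow>\<^sub>M Q \<Otimes>\<^sub>M Q"
      using i K that by (intro measurable_Pair measurable_component_singleton) auto
    from measurable_compose[OF this near_measurable] show ?thesis by simp
  qed
  have [measurable]: "(\<lambda>Z. Z i) \<in> (\<Pi>\<^sub>M i\<in>K. Q) \<rightarrow>\<^sub>M Q" using i by measurable
  show "hub N i \<in> borel_measurable (\<Pi>\<^sub>M i\<in>K. Q)"
    unfolding hub_def by measurable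
qed

text \<open>Given point \<open>i\<close>, each other point contributes an independent factor, which is \<open>4\<close> with probability at most \<open>q\<close>
and \<open>1\<close> otherwise. So its mean is at most \<open>1 + 3 q\<close>.\<close>

lemma nn_integral_hub:
  assumes i: "i \<in> {1..N}"
  shows "(\<integral>\<^sup>+Z. hub N i Z \<partial>QQ) \<le> ennreal (4 * \<delta> * (1 + 3 * q) ^ (N - 1))"
proof -
  let ?I = "{1..N} - {i}"
  have ins: "insert i ?I = {1..N}" using i by auto
  have "(\<integral>\<^sup>+Z. hub N i Z \<partial>QQ) = (\<integral>\<^sup>+Z. hub N i (restrict Z {1..N}) \<partial>QQ)"
    using i by (intro nn_integral_cong) (auto simp: hub_def intro!: prod.cong)
  also have "\<dots> = (\<integral>\<^sup>+Y. hub N i Y \<partial>distr QQ (\<Pi>\<^sub>M i\<in>{1..N}. Q) (\<lambda>Z. restrict Z {1..N}))"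
    using i by (intro nn_integral_distr[symmetric] hub_measurable measurable_restrict_subset) auto
  also have "distr QQ (\<Pi>\<^sub>M i\<in>{1..N}. Q) (\<lambda>Z. restrict Z {1..N}) = (\<Pi>\<^sub>M i\<in>insert i ?I. Q)"
    unfolding ins by (rule PQ.distr_PiM_restrict_finite) auto
  also have "(\<integral>\<^sup>+Y. hub N i Y \<partial>(\<Pi>\<^sub>M i\<in>insert i ?I. Q)) =
      (\<integral>\<^sup>+x. \<integral>\<^sup>+Y. hub N i (Y(i := x)) \<partial>(\<Pi>\<^sub>M i\<in>?I. Q) \<partial>Q)"
    using ins i by (intro PQ.product_nn_integral_insert_rev hub_measurable) auto
  also have "\<dots> \<le> (\<integral>\<^sup>+x. ennreal ((1 + 3 * q) ^ (N - 1) * 4) * indicator {z \<in> space Q. bad z} x \<partial>Q)"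
  proof (intro nn_integral_mono)
    fix x assume x: "x \<in> space Q"
    have nm [measurable]: "Measurable.pred Q (near x)"
    proof -
      have "(\<lambda>y. (x, y)) \<in> Q \<rightarrow>\<^sub>M Q \<Otimes>\<^sub>M Q" using x by measurable
      from measurable_compose[OF this near_measurable] show ?thesis by simp
    qed
    have one: "(\<integral>\<^sup>+y. (if near x y then 4 else 1) \<partial>Q) \<le> ennreal (1 + 3 * q)"
    proof -
      have "(\<integral>\<^sup>+y. (if near x y then 4 else 1) \<partial>Q) = (\<integral>\<^sup>+y. 1 + 3 * indicator {y \<in> space Q. near x y} y \<partial>Q)"
        by (intro nn_integral_cong) (auto simp: indicator_def)
      also have "\<dots> = 1 + 3 * emeasure Q {y \<in> space Q. near x y}"
        by (subst nn_integral_add) (auto simp: nn_integral_cmult Q.emeasure_space_1)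
      also have "\<dots> \<le> 1 + 3 * ennreal q" by (intro add_left_mono mult_left_mono near_prob x) simp
      also have "\<dots> = ennreal (1 + 3 * q)"
        using nonneg by (simp add: ennreal_mult ennreal_plus)
      finally show ?thesis .
    qed
    have "(\<integral>\<^sup>+Y. hub N i (Y(i := x)) \<partial>(\<Pi>\<^sub>M i\<in>?I. Q)) =
        (\<integral>\<^sup>+Y. (\<Prod>j\<in>?I. if near x (Y j) then 4 else 1) * (if bad x then 4 else 0) \<partial>(\<Pi>\<^sub>M i\<in>?I. Q))"
      by (intro nn_integral_cong) (auto simp: hub_def intro!: prod.cong)
    also have "\<dots> = (\<integral>\<^sup>+Y. (\<Prod>j\<in>?I. if near x (Y j) then 4 else 1) \<partial>(\<Pi>\<^sub>M i\<in>?I. Q)) * (if bad x then 4 else 0)"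
      by (intro nn_integral_multc) measurable
    also have "(\<integral>\<^sup>+Y. (\<Prod>j\<in>?I. if near x (Y j) then 4 else 1) \<partial>(\<Pi>\<^sub>M i\<in>?I. Q)) =
        (\<Prod>j\<in>?I. \<integral>\<^sup>+y. (if near x y then 4 else 1) \<partial>Q)"
      by (rule PQ.product_nn_integral_prod[of ?I "\<lambda>_ y. if near x y then 4 else 1"]) auto
    also have "(\<Prod>j\<in>?I. \<integral>\<^sup>+y. (if near x y then 4 else 1) \<partial>Q) * (if bad x then 4 else 0) \<le>
        (\<Prod>j\<in>?I. ennreal (1 + 3 * q)) * (if bad x then 4 else 0)"
      by (intro mult_right_mono prod_mono_ennreal one) simp
    also have "(\<Prod>j\<in>?I. ennreal (1 + 3 * q)) = ennreal ((1 + 3 * q) ^ (N - 1))"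
      using i nonneg by (simp add: ennreal_power del: ennreal_plus)
    also have "ennreal ((1 + 3 * q) ^ (N - 1)) * (if bad x then 4 else 0) =
        ennreal ((1 + 3 * q) ^ (N - 1) * 4) * indicator {z \<in> space Q. bad z} x"
      using x nonneg by (auto simp: ennreal_mult'')
    finally show "(\<integral>\<^sup>+Y. hub N i (Y(i := x)) \<partial>(\<Pi>\<^sub>M i\<in>?I. Q)) \<le>
        ennreal ((1 + 3 * q) ^ (N - 1) * 4) * indicator {z \<in> space Q. bad z} x" .
  qed
  also have "\<dots> = ennreal ((1 + 3 * q) ^ (N - 1) * 4) * emeasure Q {z \<in> space Q. bad z}"
    by (rule nn_integral_cmult_indicator) measurable
  also have "\<dots> \<le> ennreal ((1 + 3 * q) ^ (N - 1) * 4) * ennreal \<delta>"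
    by (intro mult_left_mono bad_prob) simp
  finally show ?thesis using nonneg by (simp add: ennreal_mult[symmetric] mult_ac)
qed

lemma nn_integral_hubs:
  "(\<integral>\<^sup>+Z. (\<Sum>i\<in>{1..N}. hub N i Z) \<partial>QQ) \<le> ennreal (4 * \<delta>) * ennreal (real N * (1 + 3 * q) ^ (N - 1))"
proof -
  have "(\<integral>\<^sup>+Z. (\<Sum>i\<in>{1..N}. hub N i Z) \<partial>QQ) = (\<Sum>i\<in>{1..N}. \<integral>\<^sup>+Z. hub N i Z \<partial>QQ)"
    by (intro nn_integral_sum hub_measurable) auto
  also have "\<dots> \<le> (\<Sum>i\<in>{1..N}. ennreal (4 * \<delta> * (1 + 3 * q) ^ (N - 1)))"
    by (intro sum_mono nn_integral_hub)
  finally show ?thesis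
    using nonneg by (simp add: ennreal_of_nat_eq_real_of_nat ennreal_mult[symmetric] mult_ac)
qed

text \<open>The square counts ordered pairs of simplices, sorted into disjoint and intersecting ones.\<close>

lemma evcount_sq_le:
  "ennreal ((evcount (N, Z))\<^sup>2) \<le>
    (\<Sum>I\<in>Pow {1..N}. \<Sum>J\<in>Pow ({1..N} - I). ennreal (of_bool (ev I Z \<and> ev J Z))) + (\<Sum>i\<in>{1..N}. hub N i Z)"
proof -
  let ?A = "Pow {1..N}"
  let ?P = "{(I, J). I \<subseteq> {1..N} \<and> J \<subseteq> {1..N} \<and> I \<inter> J \<noteq> {} \<and> ev I Z \<and> ev J Z}"
  have finP: "finite ?P" by (rule finite_subset[of _ "?A \<times> ?A"]) auto
  have "(evcount (N, Z))\<^sup>2 = (\<Sum>I\<in>?A. \<Sum>J\<in>?A. of_bool (ev I Z \<and> ev J Z))"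
    unfolding evcount_eq power2_eq_square sum_product by (simp add: of_bool_conj)
  also have "\<dots> = (\<Sum>I\<in>?A. (\<Sum>J\<in>Pow ({1..N} - I). of_bool (ev I Z \<and> ev J Z)) +
      (\<Sum>J\<in>{J \<in> ?A. I \<inter> J \<noteq> {}}. of_bool (ev I Z \<and> ev J Z)))"
  proof (intro sum.cong refl)
    fix I assume "I \<in> ?A"
    have "Pow ({1..N} - I) \<union> {J \<in> ?A. I \<inter> J \<noteq> {}} = ?A" by auto
    moreover have "Pow ({1..N} - I) \<inter> {J \<in> ?A. I \<inter> J \<noteq> {}} = {}" by auto
    moreover have "finite (Pow ({1..N} - I))" "finite {J \<in> ?A. I \<inter> J \<noteq> {}}" by auto
    ultimately show "(\<Sum>J\<in>?A. of_bool (ev I Z \<and> ev J Z)) =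
      (\<Sum>J\<in>Pow ({1..N} - I). of_bool (ev I Z \<and> ev J Z)) +
      (\<Sum>J\<in>{J \<in> ?A. I \<inter> J \<noteq> {}}. of_bool (ev I Z \<and> ev J Z) :: real)"
      using sum.union_disjoint[of "Pow ({1..N} - I)" "{J \<in> ?A. I \<inter> J \<noteq> {}}"
        "\<lambda>J. of_bool (ev I Z \<and> ev J Z) :: real"] by (simp only:)
  qed
  also have "\<dots> = (\<Sum>I\<in>?A. \<Sum>J\<in>Pow ({1..N} - I). of_bool (ev I Z \<and> ev J Z)) +
      (\<Sum>p\<in>?A \<times> ?A. of_bool (p \<in> ?P))"
  proof -
    have "(\<Sum>J\<in>{J \<in> ?A. I \<inter> J \<noteq> {}}. of_bool (ev I Z \<and> ev J Z)) = (\<Sum>J\<in>?A. of_bool ((I, J) \<in> ?P) :: real)"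
      if "I \<in> ?A" for I
      using that by (intro sum.mono_neutral_cong_left) auto
    then show ?thesis by (simp add: sum.distrib sum.cartesian_product')
  qed
  also have "(\<Sum>p\<in>?A \<times> ?A. of_bool (p \<in> ?P)) = real (card ?P)"
    by (subst sum_of_bool_eq) (auto intro!: arg_cong[where f=card])
  finally have "ennreal ((evcount (N, Z))\<^sup>2) =
      (\<Sum>I\<in>?A. \<Sum>J\<in>Pow ({1..N} - I). ennreal (of_bool (ev I Z \<and> ev J Z))) + of_nat (card ?P)"
    by (simp add: sum_nonneg sum_ennreal ennreal_of_nat_eq_real_of_nat flip: ennreal_plus)
  then show ?thesis using intersecting_pairs_le[of N Z] by (simp add: add_left_mono)
qed

lemma nn_integral_evcount_sq:
  "(\<integral>\<^sup>+Z. ennreal ((evcount (N, Z))\<^sup>2) \<partial>QQ) \<le>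
    (\<Sum>a\<le>N. of_nat (N choose a) * ennreal (g a) * \<phi> (N - a)) +
    ennreal (4 * \<delta>) * ennreal (real N * (1 + 3 * q) ^ (N - 1))"
proof -
  let ?D = "\<lambda>Z. \<Sum>I\<in>Pow {1..N}. \<Sum>J\<in>Pow ({1..N} - I). ennreal (of_bool (ev I Z \<and> ev J Z))"
  have meas: "(\<lambda>Z. ennreal (of_bool (ev I Z \<and> ev J Z))) \<in> borel_measurable QQ"
    if "finite I" "finite J" for I J
    using ev_measurable[OF that(1)] ev_measurable[OF that(2)] by measurable
  have fin: "finite I" if "I \<in> Pow {1..N}" for I using that by (auto dest: finite_subset)
  have finD: "finite J" if "J \<in> Pow ({1..N} - I)" for I J using that by (auto dest: finite_subset)
  have pair: "(\<integral>\<^sup>+Z. ennreal (of_bool (ev I Z \<and> ev J Z)) \<partial>QQ) = ennreal (g (card I)) * ennreal (g (card J))"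
    if "I \<in> Pow {1..N}" "J \<in> Pow ({1..N} - I)" for I J
  proof -
    note IJ = fin[OF that(1)] finD[OF that(2)]
    have "(\<integral>\<^sup>+Z. ennreal (of_bool (ev I Z \<and> ev J Z)) \<partial>QQ) =
        (\<integral>\<^sup>+Z. indicator {Z \<in> space QQ. ev I Z \<and> ev J Z} Z \<partial>QQ)"
      by (intro nn_integral_cong) (auto simp: indicator_def)
    also have "\<dots> = emeasure QQ {Z \<in> space QQ. ev I Z \<and> ev J Z}"
      using ev_measurable[OF IJ(1)] ev_measurable[OF IJ(2)] by (intro nn_integral_indicator) measurable
    also have "\<dots> = ennreal (g (card I) * g (card J))"
      using that by (subst QQ.emeasure_eq_measure, subst prob_ev_disjoint[OF IJ]) auto
    finally show ?thesis by (simp add: ennreal_mult g_def)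
  qed
  have "(\<integral>\<^sup>+Z. ?D Z \<partial>QQ) = (\<Sum>I\<in>Pow {1..N}. \<integral>\<^sup>+Z. (\<Sum>J\<in>Pow ({1..N} - I). ennreal (of_bool (ev I Z \<and> ev J Z))) \<partial>QQ)"
    by (intro nn_integral_sum borel_measurable_sum meas fin finD)
  also have "\<dots> = (\<Sum>I\<in>Pow {1..N}. \<Sum>J\<in>Pow ({1..N} - I). \<integral>\<^sup>+Z. ennreal (of_bool (ev I Z \<and> ev J Z)) \<partial>QQ)"
    by (intro sum.cong refl nn_integral_sum meas fin finD)
  also have "\<dots> = (\<Sum>I\<in>Pow {1..N}. \<Sum>J\<in>Pow ({1..N} - I). ennreal (g (card I)) * ennreal (g (card J)))"
    by (intro sum.cong refl pair)
  also have "\<dots> = (\<Sum>I\<in>Pow {1..N}. ennreal (g (card I)) * \<phi> (N - card I))"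
  proof (intro sum.cong refl)
    fix I assume I: "I \<in> Pow {1..N}"
    have "card ({1..N} - I) = N - card I" using I fin[OF I] by (simp add: card_Diff_subset)
    then have "(\<Sum>J\<in>Pow ({1..N} - I). ennreal (g (card J))) = \<phi> (N - card I)"
      unfolding \<phi>_def by (subst choose_sum) auto
    then show "(\<Sum>J\<in>Pow ({1..N} - I). ennreal (g (card I)) * ennreal (g (card J))) =
        ennreal (g (card I)) * \<phi> (N - card I)"
      by (simp add: sum_distrib_left[symmetric])
  qed
  also have "\<dots> = (\<Sum>a\<le>N. of_nat (N choose a) * ennreal (g a) * \<phi> (N - a))"
    by (subst choose_sum[of "{1..N}" "\<lambda>a. ennreal (g a) * \<phi> (N - a)"]) (auto simp: mult_ac)
  finally have D: "(\<integral>\<^sup>+Z. ?D Z \<partial>QQ) = (\<Sum>a\<le>N. of_nat (N choose a) * ennreal (g a) * \<phi> (N - a))" .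
  have "(\<integral>\<^sup>+Z. ennreal ((evcount (N, Z))\<^sup>2) \<partial>QQ) \<le> (\<integral>\<^sup>+Z. ?D Z + (\<Sum>i\<in>{1..N}. hub N i Z) \<partial>QQ)"
    by (intro nn_integral_mono evcount_sq_le)
  also have "\<dots> = (\<integral>\<^sup>+Z. ?D Z \<partial>QQ) + (\<integral>\<^sup>+Z. (\<Sum>i\<in>{1..N}. hub N i Z) \<partial>QQ)"
    by (intro nn_integral_add borel_measurable_sum meas fin finD hub_measurable) auto
  finally show ?thesis
    using nn_integral_hubs[of N] unfolding D by (meson add_left_mono order_trans)
qed

definition bound :: "nat \<Rightarrow> real" where
  "bound n = 4 * \<delta> * (real n * exp (real n * (3 * q)))"

lemma bound_nonneg: "0 \<le> bound n"
  using nonneg by (simp add: bound_def)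

lemma sample_size_hub_bound:
  assumes "1 \<le> n"
  shows "(\<integral>\<^sup>+N. ennreal (4 * \<delta>) * ennreal (real N * (1 + 3 * q) ^ (N - 1)) \<partial>measure_pmf (sample_size_pmf s n))
    \<le> ennreal (bound n)"
proof -
  have "(\<integral>\<^sup>+N. ennreal (4 * \<delta>) * ennreal (real N * (1 + 3 * q) ^ (N - 1)) \<partial>measure_pmf (sample_size_pmf s n))
      = ennreal (4 * \<delta>) * (\<integral>\<^sup>+N. ennreal (real N * (1 + 3 * q) ^ (N - 1)) \<partial>measure_pmf (sample_size_pmf s n))"
    by (rule nn_integral_cmult) simp
  also have "\<dots> \<le> ennreal (4 * \<delta>) * ennreal (real n * exp (real n * (1 + 3 * q - 1)))"
    using nonneg by (intro mult_left_mono nn_integral_sample_size_times_power assms) auto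
  finally show ?thesis using nonneg by (simp add: bound_def ennreal_mult[symmetric])
qed

text \<open>A counted simplex paired with itself is an intersecting pair.\<close>

lemma evcount_le_hubs: "ennreal (evcount (N, Z)) \<le> (\<Sum>i\<in>{1..N}. hub N i Z)"
proof -
  let ?P = "{(I, J). I \<subseteq> {1..N} \<and> J \<subseteq> {1..N} \<and> I \<inter> J \<noteq> {} \<and> ev I Z \<and> ev J Z}"
  have "card {I \<in> Pow {1..N}. ev I Z} \<le> card ?P"
  proof (rule card_inj_on_le[where f="\<lambda>I. (I, I)"])
    show "(\<lambda>I. (I, I)) ` {I \<in> Pow {1..N}. ev I Z} \<subseteq> ?P" using ev_empty by auto
    show "finite ?P" by (rule finite_subset[of _ "Pow {1..N} \<times> Pow {1..N}"]) auto
  qed (auto simp: inj_on_def)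
  then have "ennreal (evcount (N, Z)) \<le> of_nat (card ?P)"
    by (simp add: evcount_def ennreal_of_nat_eq_real_of_nat)
  then show ?thesis using intersecting_pairs_le order_trans by blast
qed

lemma evcount_nonneg: "0 \<le> evcount \<omega>"
  by (simp add: evcount_def split: prod.split)

theorem evcount_mean_le:
  assumes n: "1 \<le> n"
  shows "(\<integral>\<^sup>+\<omega>. ennreal (evcount \<omega>) \<partial>sampling_space s n Q) \<le> ennreal (bound n)"
proof -
  have "(\<integral>\<^sup>+\<omega>. ennreal (evcount \<omega>) \<partial>sampling_space s n Q) =
      (\<integral>\<^sup>+N. \<integral>\<^sup>+Z. ennreal (evcount (N, Z)) \<partial>QQ \<partial>measure_pmf (sample_size_pmf s n))"
    by (intro nn_integral_sampling_space prob_Q) measurable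
  also have "\<dots> \<le> (\<integral>\<^sup>+N. ennreal (4 * \<delta>) * ennreal (real N * (1 + 3 * q) ^ (N - 1)) \<partial>measure_pmf (sample_size_pmf s n))"
    by (intro nn_integral_mono order_trans[OF nn_integral_mono[OF evcount_le_hubs] nn_integral_hubs])
  finally show ?thesis using sample_size_hub_bound[OF n] order_trans by blast
qed

theorem evcount_second_moment_le:
  assumes n: "1 \<le> n"
  shows "(\<integral>\<^sup>+\<omega>. ennreal ((evcount \<omega>)\<^sup>2) \<partial>sampling_space s n Q) \<le>
    (\<integral>\<^sup>+\<omega>. ennreal (evcount \<omega>) \<partial>sampling_space s n Q)\<^sup>2 + ennreal (bound n)"
proof -
  let ?p = "measure_pmf (sample_size_pmf s n)"
  have mean: "(\<integral>\<^sup>+\<omega>. ennreal (evcount \<omega>) \<partial>sampling_space s n Q) = (\<integral>\<^sup>+N. \<phi> N \<partial>?p)"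
    by (subst nn_integral_sampling_space[OF prob_Q]) (measurable, simp add: nn_integral_evcount)
  have "(\<integral>\<^sup>+\<omega>. ennreal ((evcount \<omega>)\<^sup>2) \<partial>sampling_space s n Q) =
      (\<integral>\<^sup>+N. \<integral>\<^sup>+Z. ennreal ((evcount (N, Z))\<^sup>2) \<partial>QQ \<partial>?p)"
    by (intro nn_integral_sampling_space prob_Q) measurable
  also have "\<dots> \<le> (\<integral>\<^sup>+N. (\<Sum>a\<le>N. of_nat (N choose a) * ennreal (g a) * \<phi> (N - a)) +
      ennreal (4 * \<delta>) * ennreal (real N * (1 + 3 * q) ^ (N - 1)) \<partial>?p)"
    by (intro nn_integral_mono nn_integral_evcount_sq)
  also have "\<dots> = (\<integral>\<^sup>+N. (\<Sum>a\<le>N. of_nat (N choose a) * ennreal (g a) * \<phi> (N - a)) \<partial>?p) +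
      (\<integral>\<^sup>+N. ennreal (4 * \<delta>) * ennreal (real N * (1 + 3 * q) ^ (N - 1)) \<partial>?p)"
    by (intro nn_integral_add) auto
  also have "\<dots> \<le> (\<integral>\<^sup>+N. \<phi> N \<partial>?p)\<^sup>2 + ennreal (bound n)"
    using sample_size_disjoint_pairs[OF n, where g="\<lambda>a. ennreal (g a)" and s=s]
      sample_size_hub_bound[OF n, of s]
    unfolding \<phi>_def by (intro add_mono)
  finally show ?thesis unfolding mean .
qed

text \<open>The same bound holds for the mean and for the variance: the bound on intersecting pairs controls the former,
and the disjoint pairs are cancelled by the square of the mean in the latter.\<close>

theorem evcount_variance_le:
  fixes s :: scheme
  assumes n: "1 \<le> n"
  defines "\<Omega> \<equiv> sampling_space s n Q"
  shows "integrable \<Omega> evcount" "(\<integral>\<omega>. evcount \<omega> \<partial>\<Omega>) \<le> bound n"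
    "(\<integral>\<^sup>+\<omega>. ennreal ((evcount \<omega> - (\<integral>\<omega>. evcount \<omega> \<partial>\<Omega>))\<^sup>2) \<partial>\<Omega>) \<le> ennreal (bound n)"
proof -
  interpret \<Omega>: prob_space \<Omega> unfolding \<Omega>_def by (rule prob_space_sampling_space[OF prob_Q])
  have [measurable]: "evcount \<in> borel_measurable \<Omega>" unfolding \<Omega>_def by measurable
  have le: "(\<integral>\<^sup>+\<omega>. ennreal (evcount \<omega>) \<partial>\<Omega>) \<le> ennreal (bound n)"
    unfolding \<Omega>_def by (rule evcount_mean_le[OF n])
  show int: "integrable \<Omega> evcount"
    using le by (intro integrableI_nonneg) (auto simp: evcount_nonneg intro: le_less_trans)
  have mean: "(\<integral>\<^sup>+\<omega>. ennreal (evcount \<omega>) \<partial>\<Omega>) = ennreal (\<integral>\<omega>. evcount \<omega> \<partial>\<Omega>)"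
    by (intro nn_integral_eq_integral int) (simp add: evcount_nonneg)
  have mean0: "0 \<le> (\<integral>\<omega>. evcount \<omega> \<partial>\<Omega>)" by (simp add: evcount_nonneg)
  show "(\<integral>\<omega>. evcount \<omega> \<partial>\<Omega>) \<le> bound n"
    using le unfolding mean by (simp add: bound_nonneg)
  have sq: "(\<integral>\<^sup>+\<omega>. ennreal ((evcount \<omega>)\<^sup>2) \<partial>\<Omega>) \<le> ennreal ((\<integral>\<omega>. evcount \<omega> \<partial>\<Omega>)\<^sup>2 + bound n)"
    using evcount_second_moment_le[OF n, of s] mean mean0 bound_nonneg[of n] unfolding \<Omega>_def[symmetric]
    by (simp add: ennreal_power)
  have int2: "integrable \<Omega> (\<lambda>\<omega>. (evcount \<omega>)\<^sup>2)"
    using sq by (intro integrableI_nonneg) (auto intro: le_less_trans)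
  have "(\<integral>\<omega>. (evcount \<omega>)\<^sup>2 \<partial>\<Omega>) \<le> (\<integral>\<omega>. evcount \<omega> \<partial>\<Omega>)\<^sup>2 + bound n"
    using sq bound_nonneg[of n] by (simp add: nn_integral_eq_integral[OF int2] del: ennreal_plus)
  then have "(\<integral>\<omega>. (evcount \<omega> - (\<integral>\<omega>. evcount \<omega> \<partial>\<Omega>))\<^sup>2 \<partial>\<Omega>) \<le> bound n"
    using \<Omega>.variance_eq[OF int int2] by simp
  moreover have "integrable \<Omega> (\<lambda>\<omega>. (evcount \<omega> - (\<integral>\<omega>. evcount \<omega> \<partial>\<Omega>))\<^sup>2)"
    using int int2 by (simp add: power2_diff)
  ultimately show "(\<integral>\<^sup>+\<omega>. ennreal ((evcount \<omega> - (\<integral>\<omega>. evcount \<omega> \<partial>\<Omega>))\<^sup>2) \<partial>\<Omega>) \<le> ennreal (bound n)"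
    by (simp add: nn_integral_eq_integral ennreal_leI)
qed

end

section \<open>Uniform control of monotone processes\<close>

lemma ennreal_le_sqrt_if_square_le:
  assumes "x\<^sup>2 \<le> ennreal c" "0 \<le> c"
  shows "x \<le> ennreal (sqrt c)"
proof (cases x)
  case (real r)
  then have "r\<^sup>2 \<le> c" using assms by (simp add: ennreal_power)
  then show ?thesis using real by (simp add: real_le_rsqrt ennreal_leI)
qed (use assms in \<open>simp add: power2_eq_square top_unique\<close>)

lemma nn_integral_sqrt_le:
  assumes "prob_space M" and [measurable]: "V \<in> borel_measurable M" and V: "\<And>\<omega>. 0 \<le> V \<omega>"
    and le: "(\<integral>\<^sup>+\<omega>. ennreal (V \<omega>) \<partial>M) \<le> ennreal c" and "0 \<le> c"
  shows "(\<integral>\<^sup>+\<omega>. ennreal (sqrt (V \<omega>)) \<partial>M) \<le> ennreal (sqrt c)"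
proof (rule ennreal_le_sqrt_if_square_le)
  have "(\<integral>\<^sup>+\<omega>. ennreal (sqrt (V \<omega>)) \<partial>M)\<^sup>2 \<le>
      (\<integral>\<^sup>+\<omega>. (ennreal (sqrt (V \<omega>)))\<^sup>2 \<partial>M) * (\<integral>\<^sup>+\<omega>. 1\<^sup>2 \<partial>M)"
    using Cauchy_Schwarz_nn_integral[of "\<lambda>\<omega>. ennreal (sqrt (V \<omega>))" M "\<lambda>_. 1"] by simp
  also have "\<dots> = (\<integral>\<^sup>+\<omega>. ennreal (V \<omega>) \<partial>M)"
    using V prob_space.emeasure_space_1[OF assms(1)] by (simp add: ennreal_power)
  finally show "(\<integral>\<^sup>+\<omega>. ennreal (sqrt (V \<omega>)) \<partial>M)\<^sup>2 \<le> ennreal c" using le by simp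
qed fact

lemma abs_le_sqrt_sum_squares:
  fixes x :: "'i \<Rightarrow> real"
  assumes "finite R" "u \<in> R"
  shows "\<bar>x u\<bar> \<le> sqrt (\<Sum>v\<in>R. (x v)\<^sup>2)"
proof (rule real_le_rsqrt)
  show "\<bar>x u\<bar>\<^sup>2 \<le> (\<Sum>v\<in>R. (x v)\<^sup>2)"
    using member_le_sum[of u R "\<lambda>v. (x v)\<^sup>2"] assms by simp
qed

text \<open>The function \<open>G\<close> is meant to be the mean of \<open>A\<close>. What matters is that it has values in \<open>[0, B]\<close> and that its squared
distance from \<open>A\<close> has mean at most \<open>B\<close>.\<close>

locale monotone_process = prob_space M for M :: "'w measure" +
  fixes A :: "real \<Rightarrow> 'w \<Rightarrow> real" and G :: "real \<Rightarrow> real" and H :: "real set" and B :: real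
  assumes A_mono: "\<And>s t \<omega>. s \<le> t \<Longrightarrow> A s \<omega> \<le> A t \<omega>"
    and A_measurable [measurable]: "\<And>t. A t \<in> borel_measurable M"
    and G_bounds: "\<And>t. t \<in> H \<Longrightarrow> 0 \<le> G t \<and> G t \<le> B"
    and A_variance: "\<And>t. t \<in> H \<Longrightarrow> (\<integral>\<^sup>+\<omega>. ennreal ((A t \<omega> - G t)\<^sup>2) \<partial>M) \<le> ennreal B"
    and B_nonneg: "0 \<le> B"
begin

text \<open>Within a slab of times whose mean values differ by at most \<open>B/J\<close>, monotonicity confines \<open>A t\<close> between its values
at the first and the last time of the slab. There are at most \<open>J + 1\<close> slabs, hence at most \<open>4 J\<close> such extreme
times, and the deviations at these are summed up in mean square. A finite set \<open>F\<close> of times makes the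
first and the last time exist.\<close>

lemma finite_sup_deviation_le:
  assumes F: "finite F" "F \<subseteq> H" and J: "1 \<le> J"
  shows "(\<integral>\<^sup>+\<omega>. (SUP t\<in>F. ennreal \<bar>A t \<omega> - G t\<bar>) \<partial>M) \<le> ennreal (sqrt (4 * real J * B) + B / real J)"
proof -
  \<comment> \<open>Where \<open>B = 0\<close> the division by \<open>0\<close> puts all times into slab \<open>0\<close>, as it should, since the mean vanishes.\<close>
  define slab where "slab t = nat \<lfloor>G t * real J / B\<rfloor>" for t
  define C where "C k = {u \<in> F. slab u = k}" for k
  define R where "R = (\<lambda>k. Max (C k)) ` (slab ` F) \<union> (\<lambda>k. Min (C k)) ` (slab ` F)"
  define V where "V \<omega> = (\<Sum>u\<in>R. (A u \<omega> - G u)\<^sup>2)" for \<omega>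
  have finC: "finite (C k)" for k using F by (simp add: C_def)
  have finR: "finite R" using F by (simp add: R_def)
  have slab_le: "slab t \<le> J" if "t \<in> F" for t
  proof -
    have "G t * real J / B \<le> real J"
      using G_bounds[of t] that F B_nonneg by (cases "B = 0") (auto simp: field_simps intro!: mult_right_mono)
    then show ?thesis unfolding slab_def by linarith
  qed
  have close: "G u - G t \<le> B / real J" if "u \<in> F" "t \<in> F" "slab u = slab t" for u t
  proof (cases "B = 0")
    case True
    have "u \<in> H" "t \<in> H" using that F by auto
    then show ?thesis using True G_bounds[of u] G_bounds[of t] by auto
  next
    case False
    have "0 \<le> G u * real J / B" "0 \<le> G t * real J / B"
      using G_bounds[of u] G_bounds[of t] that F B_nonneg by auto
    then have "G u * real J / B - G t * real J / B \<le> 1"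
      using that(3) unfolding slab_def by linarith
    then show ?thesis using False B_nonneg J by (simp add: field_simps)
  qed
  have RF: "R \<subseteq> F"
    unfolding R_def using Max_in[OF finC] Min_in[OF finC] by (fastforce simp: C_def)
  have "card (slab ` F) \<le> card {..J}" using slab_le by (intro card_mono) auto
  then have cardR: "card R \<le> 2 * (J + 1)"
    unfolding R_def using card_Un_le[of "(\<lambda>k. Max (C k)) ` (slab ` F)" "(\<lambda>k. Min (C k)) ` (slab ` F)"]
      card_image_le[of "slab ` F" "\<lambda>k. Max (C k)"] card_image_le[of "slab ` F" "\<lambda>k. Min (C k)"] F by simp
  have dev: "\<bar>A t \<omega> - G t\<bar> \<le> sqrt (V \<omega>) + B / real J" if t: "t \<in> F" for t \<omega>
  proof -
    define u where "u = Max (C (slab t))"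
    define l where "l = Min (C (slab t))"
    have tC: "t \<in> C (slab t)" using t by (simp add: C_def)
    have "u \<in> C (slab t)" "l \<in> C (slab t)"
      unfolding u_def l_def using finC tC by (auto intro!: Max_in Min_in)
    then have ul: "u \<in> F" "l \<in> F" "slab u = slab t" "slab l = slab t" by (auto simp: C_def)
    have "l \<le> t" "t \<le> u" unfolding u_def l_def using finC tC by auto
    then have "A t \<omega> \<le> A u \<omega>" "A l \<omega> \<le> A t \<omega>" using A_mono by auto
    moreover have "u \<in> R" "l \<in> R" using t by (auto simp: R_def u_def l_def)
    then have "\<bar>A u \<omega> - G u\<bar> \<le> sqrt (V \<omega>)" "\<bar>A l \<omega> - G l\<bar> \<le> sqrt (V \<omega>)"
      unfolding V_def by (auto intro!: abs_le_sqrt_sum_squares[OF finR, of _ "\<lambda>v. A v \<omega> - G v"])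
    moreover have "G u - G t \<le> B / real J" "G t - G l \<le> B / real J"
      using close[of u t] close[of t l] ul t by auto
    ultimately show ?thesis by linarith
  qed
  have [measurable]: "V \<in> borel_measurable M" unfolding V_def by measurable
  have V0: "0 \<le> V \<omega>" for \<omega> unfolding V_def by (simp add: sum_nonneg)
  have "(\<integral>\<^sup>+\<omega>. ennreal (V \<omega>) \<partial>M) = (\<Sum>u\<in>R. \<integral>\<^sup>+\<omega>. ennreal ((A u \<omega> - G u)\<^sup>2) \<partial>M)"
    unfolding V_def by (subst nn_integral_sum[symmetric]) (auto simp: sum_ennreal)
  also have "\<dots> \<le> (\<Sum>u\<in>R. ennreal B)" using RF F by (intro sum_mono A_variance) auto
  also have "\<dots> = ennreal (real (card R) * B)"
    using B_nonneg by (simp add: ennreal_of_nat_eq_real_of_nat ennreal_mult)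
  also have "\<dots> \<le> ennreal (4 * real J * B)"
    using cardR J B_nonneg by (intro ennreal_leI mult_right_mono) auto
  finally have sq: "(\<integral>\<^sup>+\<omega>. ennreal (sqrt (V \<omega>)) \<partial>M) \<le> ennreal (sqrt (4 * real J * B))"
    using B_nonneg by (intro nn_integral_sqrt_le prob_space_axioms V0) auto
  have "(\<integral>\<^sup>+\<omega>. (SUP t\<in>F. ennreal \<bar>A t \<omega> - G t\<bar>) \<partial>M) \<le>
      (\<integral>\<^sup>+\<omega>. ennreal (sqrt (V \<omega>)) + ennreal (B / real J) \<partial>M)"
    using dev V0 B_nonneg by (intro nn_integral_mono SUP_least) (simp flip: ennreal_plus add: ennreal_leI)
  also have "\<dots> = (\<integral>\<^sup>+\<omega>. ennreal (sqrt (V \<omega>)) \<partial>M) + ennreal (B / real J)"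
    by (subst nn_integral_add) (auto simp: emeasure_space_1)
  also have "\<dots> \<le> ennreal (sqrt (4 * real J * B)) + ennreal (B / real J)"
    using sq by (rule add_right_mono)
  finally show ?thesis using B_nonneg by simp
qed

theorem countable_sup_deviation_le:
  assumes D: "countable D" "D \<subseteq> H" and J: "1 \<le> J"
  shows "(\<integral>\<^sup>+\<omega>. (SUP t\<in>D. ennreal \<bar>A t \<omega> - G t\<bar>) \<partial>M) \<le> ennreal (sqrt (4 * real J * B) + B / real J)"
proof (cases "D = {}")
  case True
  then show ?thesis by (simp add: bot_ennreal)
next
  case False
  let ?d = "from_nat_into D"
  let ?S = "\<lambda>m \<omega>. SUP t\<in>?d ` {..m}. ennreal \<bar>A t \<omega> - G t\<bar>"
  have D_eq: "D = (\<Union>m. ?d ` {..m})"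
  proof -
    have "(\<Union>m. ?d ` {..m}) = ?d ` (\<Union>m. {..m})" by (rule image_UN[symmetric])
    also have "(\<Union>m::nat. {..m}) = UNIV" by auto
    finally show ?thesis using range_from_nat_into[OF False D(1)] by simp
  qed
  have "(SUP t\<in>D. ennreal \<bar>A t \<omega> - G t\<bar>) = (SUP m. ?S m \<omega>)" for \<omega>
    by (subst D_eq) (rule SUP_UNION)
  then have "(\<integral>\<^sup>+\<omega>. (SUP t\<in>D. ennreal \<bar>A t \<omega> - G t\<bar>) \<partial>M) = (\<integral>\<^sup>+\<omega>. (SUP m. ?S m \<omega>) \<partial>M)"
    by simp
  also have "\<dots> = (SUP m. \<integral>\<^sup>+\<omega>. ?S m \<omega> \<partial>M)"
  proof (rule nn_integral_monotone_convergence_SUP)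
    show "incseq ?S" by (intro monoI le_funI SUP_subset_mono) auto
  qed measurable
  also have "\<dots> \<le> ennreal (sqrt (4 * real J * B) + B / real J)"
    using D range_from_nat_into[OF False D(1)] J
    by (intro SUP_least finite_sup_deviation_le) auto
  finally show ?thesis .
qed

end

text \<open>By right-continuity the rational times suffice, except at the endpoint \<open>T\<close>, which has no times of \<open>[0, T]\<close>
to its right.\<close>

lemma cadlag_sup_dist_le:
  assumes x: "x \<in> cadlag_functions T" and y: "y \<in> cadlag_functions T" and T: "0 < T"
  shows "ennreal (sup_dist T x y) \<le> (SUP t\<in>{0..T} \<inter> (\<rat> \<union> {T}). ennreal \<bar>x t - y t\<bar>)"
    (is "_ \<le> ?S")
proof (cases ?S)
  case (real c)
  have D: "\<bar>x t - y t\<bar> \<le> c" if "t \<in> {0..T} \<inter> (\<rat> \<union> {T})" for t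
    using SUP_upper[OF that, of "\<lambda>t. ennreal \<bar>x t - y t\<bar>"] real by simp
  have "\<bar>x t - y t\<bar> \<le> c" if t: "t \<in> {0..T}" for t
  proof (cases "t = T")
    case True
    then show ?thesis using D T by simp
  next
    case False
    then have tT: "t < T" using t by simp
    show ?thesis
    proof (rule ccontr)
      assume "\<not> \<bar>x t - y t\<bar> \<le> c"
      moreover have "((\<lambda>s. \<bar>x s - y s\<bar>) \<longlongrightarrow> \<bar>x t - y t\<bar>) (at_right t)"
        using x y t tT unfolding cadlag_functions_def by (intro tendsto_intros) auto
      ultimately have "\<forall>\<^sub>F s in at_right t. c < \<bar>x s - y s\<bar>"
        by (intro order_tendstoD(1)) auto
      then obtain b where b: "t < b" "\<And>s. t < s \<Longrightarrow> s < b \<Longrightarrow> c < \<bar>x s - y s\<bar>"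
        unfolding eventually_at_right_field by blast
      obtain s where s: "s \<in> \<rat>" "t < s" "s < min b T"
        using Rats_dense_in_real[of t "min b T"] b tT by auto
      then have "\<bar>x s - y s\<bar> \<le> c" using t by (intro D) auto
      then show False using b(2)[of s] s by auto
    qed
  qed
  then have "sup_dist T x y \<le> c"
    unfolding sup_dist_def using T by (intro cSUP_least) auto
  then show ?thesis using real by (simp add: ennreal_leI)
next
  case top
  then show ?thesis by (simp only: top_greatest)
qed

section \<open>Maximal coupling of two densities\<close>

lemma prob_space_uniform_unit: "prob_space (uniform_measure lborel {0..1::real})"
  by (rule prob_space_uniform_measure) auto

text \<open>A point where the density is \<open>a\<close> is kept with probability \<open>min 1 (b/a)\<close>, by comparison with a uniform variable.
The formula is stated multiplied by \<open>a\<close>, in which form it also holds for \<open>a = 0\<close>.\<close>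

lemma nn_integral_uniform_threshold:
  fixes a b :: real and p r :: ennreal
  assumes "0 \<le> a" "0 \<le> b"
  shows "ennreal a * (\<integral>\<^sup>+u. (if u * a \<le> b then p else r) \<partial>uniform_measure lborel {0..1}) =
    ennreal (min a b) * p + ennreal (max 0 (a - b)) * r"
proof (cases "a = 0")
  case False
  then have a: "0 < a" using assms by simp
  let ?U = "uniform_measure lborel {0..1::real}"
  have low: "emeasure ?U {..b/a} = ennreal (min 1 (b / a))"
  proof -
    have "{0..1} \<inter> {..b / a} = {0..min 1 (b / a)}" by auto
    then show ?thesis using assms a by (simp add: divide_ennreal_def)
  qed
  have high: "emeasure ?U {b/a<..} = ennreal (max 0 (1 - b / a))"
  proof (cases "b / a \<le> 1")
    case True
    moreover have "0 \<le> b / a" using assms by simp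
    ultimately have "{0..1} \<inter> {b / a<..} = {b / a<..1}" by auto
    then show ?thesis using True by (simp add: divide_ennreal_def)
  next
    case False
    then have "{0..1} \<inter> {b / a<..} = {}" by auto
    then show ?thesis using False by (simp add: divide_ennreal_def)
  qed
  have "(\<integral>\<^sup>+u. (if u * a \<le> b then p else r) \<partial>?U) =
      (\<integral>\<^sup>+u. p * indicator {..b/a} u + r * indicator {b/a<..} u \<partial>?U)"
    using a by (intro nn_integral_cong) (auto simp: indicator_def field_simps)
  also have "\<dots> = p * emeasure ?U {..b/a} + r * emeasure ?U {b/a<..}"
    by (subst nn_integral_add) (auto simp: nn_integral_cmult)
  finally have "ennreal a * (\<integral>\<^sup>+u. (if u * a \<le> b then p else r) \<partial>?U) =
      (ennreal a * ennreal (min 1 (b / a))) * p + (ennreal a * ennreal (max 0 (1 - b / a))) * r"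
    unfolding low high by (simp add: distrib_left mult_ac)
  also have "ennreal a * ennreal (min 1 (b / a)) = ennreal (min a b)"
    using a assms by (simp add: ennreal_mult[symmetric] min_mult_distrib_left)
  also have "ennreal a * ennreal (max 0 (1 - b / a)) = ennreal (max 0 (a - b))"
  proof -
    have "a * max 0 (1 - b / a) = max 0 (a - b)"
      using a by (simp add: max_mult_distrib_left right_diff_distrib)
    then show ?thesis using assms by (subst ennreal_mult[symmetric]) auto
  qed
  finally show ?thesis .
qed (use assms in simp)

lemma inner_one_Basis: "b \<in> Basis \<Longrightarrow> (1 :: real ^ 'd) \<bullet> b = 1"
  by (auto simp: Basis_vec_def inner_axis)

lemma emeasure_unit_cube: "emeasure lborel (cbox 0 (1 :: real ^ 'd)) = 1"
  by (subst emeasure_lborel_cbox) (auto simp: inner_one_Basis)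

text \<open>Draw \<open>x\<close> from \<open>\<kappa>\<close>, a uniform \<open>u\<close>, and \<open>y\<close> from the normalised excess \<open>(\<kappa>' - \<kappa>)\<^sup>+\<close>. The first point is \<open>x\<close>; the
second one is \<open>x\<close> if \<open>u \<kappa>(x) \<le> \<kappa>'(x)\<close> and \<open>y\<close> otherwise. Kept points have density \<open>min \<kappa> \<kappa>'\<close>, and the replaced
ones supply exactly what is missing to \<open>\<kappa>'\<close>, because \<open>(\<kappa> - \<kappa>')\<^sup>+\<close> and \<open>(\<kappa>' - \<kappa>)\<^sup>+\<close> have the same mass \<open>\<epsilon>\<close>. That
mass is the probability of replacement. It is at most \<open>\<delta>\<close>, as the cube has volume \<open>1\<close>.\<close>

theorem density_coupling:
  fixes \<kappa> \<kappa>' :: "real ^ 'd \<Rightarrow> real"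
  assumes \<kappa>: "unit_cube_density \<kappa>" and \<kappa>': "unit_cube_density \<kappa>'"
    and \<delta>: "AE x in lborel. \<bar>\<kappa>' x - \<kappa> x\<bar> \<le> \<delta>" and "0 \<le> \<delta>"
  obtains Q :: "((real ^ 'd) \<times> real \<times> (real ^ 'd)) measure" and \<xi> \<xi>'
  where "prob_space Q" "\<xi> \<in> borel_measurable Q" "\<xi>' \<in> borel_measurable Q"
    "distr Q borel \<xi> = density lborel (\<lambda>x. ennreal (\<kappa> x))"
    "distr Q borel \<xi>' = density lborel (\<lambda>x. ennreal (\<kappa>' x))"
    "emeasure Q {z \<in> space Q. \<xi> z \<noteq> \<xi>' z} \<le> ennreal \<delta>"
proof -
  have [measurable]: "\<kappa> \<in> borel_measurable borel" "\<kappa>' \<in> borel_measurable borel"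
    and nn: "0 \<le> \<kappa> x" "0 \<le> \<kappa>' x" and off: "x \<notin> cbox 0 1 \<Longrightarrow> \<kappa> x = 0"
    and one: "(\<integral>\<^sup>+x. ennreal (\<kappa> x) \<partial>lborel) = 1" "(\<integral>\<^sup>+x. ennreal (\<kappa>' x) \<partial>lborel) = 1" for x
    using \<kappa> \<kappa>' by (auto simp: unit_cube_density_def)
  define m where "m = (\<integral>\<^sup>+x. ennreal (min (\<kappa> x) (\<kappa>' x)) \<partial>lborel)"
  \<comment> \<open>The mass of the excess of \<open>\<kappa>'\<close>, which equals that of the excess of \<open>\<kappa>\<close>.\<close>
  define \<epsilon> where "\<epsilon> = (\<integral>\<^sup>+x. ennreal (max 0 (\<kappa>' x - \<kappa> x)) \<partial>lborel)"
  have split: "m + (\<integral>\<^sup>+x. ennreal (max 0 (\<kappa> x - \<kappa>' x)) \<partial>lborel) = 1" "m + \<epsilon> = 1"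
  proof -
    have "ennreal (min (\<kappa> x) (\<kappa>' x)) + ennreal (max 0 (\<kappa> x - \<kappa>' x)) = ennreal (\<kappa> x)"
      "ennreal (min (\<kappa> x) (\<kappa>' x)) + ennreal (max 0 (\<kappa>' x - \<kappa> x)) = ennreal (\<kappa>' x)" for x
      using nn by (auto simp flip: ennreal_plus simp: min_def max_def)
    then have "(\<integral>\<^sup>+x. ennreal (min (\<kappa> x) (\<kappa>' x)) + ennreal (max 0 (\<kappa> x - \<kappa>' x)) \<partial>lborel) = 1"
      "(\<integral>\<^sup>+x. ennreal (min (\<kappa> x) (\<kappa>' x)) + ennreal (max 0 (\<kappa>' x - \<kappa> x)) \<partial>lborel) = 1"
      by (simp_all only: one)
    then show "m + (\<integral>\<^sup>+x. ennreal (max 0 (\<kappa> x - \<kappa>' x)) \<partial>lborel) = 1" "m + \<epsilon> = 1"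
      unfolding m_def \<epsilon>_def by (subst nn_integral_add[symmetric]; simp)+
  qed
  have "m \<le> 1" "\<epsilon> \<le> 1" using split(2) by (metis le_iff_add, metis add.commute le_iff_add)
  then have fin: "m \<noteq> \<infinity>" "\<epsilon> \<noteq> \<infinity>" by (auto simp: top_unique)
  have \<epsilon>': "(\<integral>\<^sup>+x. ennreal (max 0 (\<kappa> x - \<kappa>' x)) \<partial>lborel) = \<epsilon>"
    using split fin(1) by (metis ennreal_add_left_cancel infinity_ennreal_def)
  define K where "K = density lborel (\<lambda>x. ennreal (\<kappa> x))"
  define U where "U = uniform_measure lborel {0..1::real}"
  \<comment> \<open>If there is no excess, no point is replaced and any probability measure will do.\<close>
  define R where "R = (if \<epsilon> = 0 then K else density lborel (\<lambda>x. ennreal (max 0 (\<kappa>' x - \<kappa> x)) / \<epsilon>))"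
  have setsK [measurable_cong]: "sets K = sets borel" and setsU [measurable_cong]: "sets U = sets borel"
    and setsR [measurable_cong]: "sets R = sets borel"
    by (simp_all add: K_def U_def R_def)
  have spaces: "space K = UNIV" "space U = UNIV" "space R = UNIV"
    by (simp_all add: K_def U_def R_def)
  have pK: "prob_space K" by (rule prob_spaceI) (simp add: K_def emeasure_density one)
  have pU: "prob_space U" unfolding U_def by (rule prob_space_uniform_unit)
  have pR: "prob_space R"
  proof (cases "\<epsilon> = 0")
    case False
    have "(\<integral>\<^sup>+x. ennreal (max 0 (\<kappa>' x - \<kappa> x)) / \<epsilon> \<partial>lborel) = \<epsilon> / \<epsilon>"
      unfolding \<epsilon>_def by (rule nn_integral_divide) simp
    also have "\<dots> = 1" using False fin by (simp add: ennreal_divide_self less_top)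
    finally show ?thesis using False by (intro prob_spaceI) (simp add: R_def emeasure_density)
  qed (simp add: R_def pK)
  interpret R: prob_space R by (rule pR)
  interpret U: prob_space U by (rule pU)
  have R_eps: "\<epsilon> * emeasure R B = (\<integral>\<^sup>+x. ennreal (max 0 (\<kappa>' x - \<kappa> x)) * indicator B x \<partial>lborel)"
    if [measurable]: "B \<in> sets borel" for B
  proof (cases "\<epsilon> = 0")
    case True
    have "(\<integral>\<^sup>+x. ennreal (max 0 (\<kappa>' x - \<kappa> x)) * indicator B x \<partial>lborel) \<le> \<epsilon>"
      unfolding \<epsilon>_def by (intro nn_integral_mono) (auto simp: indicator_def)
    then show ?thesis using True by simp
  next
    case False
    have "emeasure R B = (\<integral>\<^sup>+x. (ennreal (max 0 (\<kappa>' x - \<kappa> x)) * indicator B x) / \<epsilon> \<partial>lborel)"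
      using False by (simp add: R_def emeasure_density divide_ennreal_def mult_ac)
    also have "\<dots> = (\<integral>\<^sup>+x. ennreal (max 0 (\<kappa>' x - \<kappa> x)) * indicator B x \<partial>lborel) / \<epsilon>"
      by (rule nn_integral_divide) simp
    finally show ?thesis
      using False fin
      by (simp add: mult.commute[of \<epsilon>] ennreal_divide_times ennreal_divide_self less_top)
  qed
  define Q where "Q = K \<Otimes>\<^sub>M (U \<Otimes>\<^sub>M R)"
  define \<xi> :: "(real ^ 'd) \<times> real \<times> (real ^ 'd) \<Rightarrow> real ^ 'd" where "\<xi> = fst"
  define \<xi>' :: "(real ^ 'd) \<times> real \<times> (real ^ 'd) \<Rightarrow> real ^ 'd" where
    "\<xi>' = (\<lambda>(x, u, y). if u * \<kappa> x \<le> \<kappa>' x then x else y)"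
  have pUR: "prob_space (U \<Otimes>\<^sub>M R)" by (intro prob_space_pair pU pR)
  have pQ: "prob_space Q" unfolding Q_def by (intro prob_space_pair pK pUR)
  have \<xi>m: "\<xi> \<in> borel_measurable Q" unfolding \<xi>_def Q_def by measurable
  have \<xi>'m: "\<xi>' \<in> borel_measurable Q" unfolding \<xi>'_def Q_def by measurable
  note [measurable] = \<xi>m \<xi>'m
  interpret URs: prob_space "U \<Otimes>\<^sub>M R" by (rule pUR)
  have int_Q: "(\<integral>\<^sup>+z. f z \<partial>Q) = (\<integral>\<^sup>+x. ennreal (\<kappa> x) * (\<integral>\<^sup>+u. \<integral>\<^sup>+y. f (x, u, y) \<partial>R \<partial>U) \<partial>lborel)"
    if f: "f \<in> borel_measurable Q" for f
  proof -
    have f' [measurable]: "f \<in> borel_measurable (K \<Otimes>\<^sub>M (U \<Otimes>\<^sub>M R))" using f by (simp add: Q_def)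
    have "(\<integral>\<^sup>+z. f z \<partial>Q) = (\<integral>\<^sup>+x. \<integral>\<^sup>+v. f (x, v) \<partial>(U \<Otimes>\<^sub>M R) \<partial>K)"
      unfolding Q_def by (rule URs.nn_integral_fst[symmetric]) measurable
    also have "\<dots> = (\<integral>\<^sup>+x. \<integral>\<^sup>+u. \<integral>\<^sup>+y. f (x, u, y) \<partial>R \<partial>U \<partial>K)"
      by (intro nn_integral_cong R.nn_integral_fst[symmetric]) measurable
    also have "\<dots> = (\<integral>\<^sup>+x. ennreal (\<kappa> x) * (\<integral>\<^sup>+u. \<integral>\<^sup>+y. f (x, u, y) \<partial>R \<partial>U) \<partial>lborel)"
      unfolding K_def
    proof (rule nn_integral_density)
      have "(\<lambda>x. \<integral>\<^sup>+u. \<integral>\<^sup>+y. f (x, u, y) \<partial>R \<partial>U) \<in> borel_measurable K" by measurable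
      then show "(\<lambda>x. \<integral>\<^sup>+u. \<integral>\<^sup>+y. f (x, u, y) \<partial>R \<partial>U) \<in> borel_measurable lborel"
        by (simp add: K_def)
    qed simp
    finally show ?thesis .
  qed
  show ?thesis
  proof (rule that[OF pQ \<xi>m \<xi>'m])
    have "distr Q borel \<xi> = distr (K \<Otimes>\<^sub>M (U \<Otimes>\<^sub>M R)) K fst"
      unfolding Q_def \<xi>_def by (rule distr_cong) (simp_all add: setsK)
    also have "\<dots> = K" by (rule prob_space.distr_pair_fst[OF pUR])
    finally show "distr Q borel \<xi> = density lborel (\<lambda>x. ennreal (\<kappa> x))" by (simp add: K_def)
    show "distr Q borel \<xi>' = density lborel (\<lambda>x. ennreal (\<kappa>' x))"
    proof (rule measure_eqI)
      fix B assume "B \<in> sets (distr Q borel \<xi>')"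
      then have B [measurable]: "B \<in> sets borel" by simp
      have "emeasure (distr Q borel \<xi>') B = (\<integral>\<^sup>+z. indicator B (\<xi>' z) \<partial>Q)"
        by (subst emeasure_distr) (auto simp: nn_integral_indicator[symmetric] indicator_def
            intro!: nn_integral_cong simp del: nn_integral_indicator)
      also have "\<dots> = (\<integral>\<^sup>+x. ennreal (\<kappa> x) * (\<integral>\<^sup>+u. \<integral>\<^sup>+y. indicator B (\<xi>' (x, u, y)) \<partial>R \<partial>U) \<partial>lborel)"
        by (rule int_Q) measurable
      also have "\<dots> = (\<integral>\<^sup>+x. ennreal (\<kappa> x) *
          (\<integral>\<^sup>+u. (if u * \<kappa> x \<le> \<kappa>' x then indicator B x else emeasure R B) \<partial>U) \<partial>lborel)"
      proof (intro nn_integral_cong arg_cong2[where f="(*)"] refl)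
        fix x u
        show "(\<integral>\<^sup>+y. indicator B (\<xi>' (x, u, y)) \<partial>R) =
          (if u * \<kappa> x \<le> \<kappa>' x then indicator B x else emeasure R B)"
          by (simp add: \<xi>'_def R.emeasure_space_1 setsR)
      qed
      also have "\<dots> = (\<integral>\<^sup>+x. ennreal (min (\<kappa> x) (\<kappa>' x)) * indicator B x +
          ennreal (max 0 (\<kappa> x - \<kappa>' x)) * emeasure R B \<partial>lborel)"
        unfolding U_def by (intro nn_integral_cong nn_integral_uniform_threshold nn)
      also have "\<dots> = (\<integral>\<^sup>+x. ennreal (min (\<kappa> x) (\<kappa>' x)) * indicator B x \<partial>lborel) + \<epsilon> * emeasure R B"
        by (subst nn_integral_add) (auto simp: nn_integral_multc \<epsilon>'[simplified])
      also have "\<dots> = (\<integral>\<^sup>+x. ennreal (min (\<kappa> x) (\<kappa>' x)) * indicator B x +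
          ennreal (max 0 (\<kappa>' x - \<kappa> x)) * indicator B x \<partial>lborel)"
        unfolding R_eps[OF B] by (rule nn_integral_add[symmetric]) measurable
      also have "\<dots> = (\<integral>\<^sup>+x. ennreal (\<kappa>' x) * indicator B x \<partial>lborel)"
        using nn by (intro nn_integral_cong)
          (auto simp: indicator_def min_def max_def simp flip: ennreal_plus)
      finally show "emeasure (distr Q borel \<xi>') B = emeasure (density lborel (\<lambda>x. ennreal (\<kappa>' x))) B"
        by (simp add: emeasure_density)
    qed simp
    have "emeasure Q {z \<in> space Q. \<xi> z \<noteq> \<xi>' z} = (\<integral>\<^sup>+z. indicator {z \<in> space Q. \<xi> z \<noteq> \<xi>' z} z \<partial>Q)"
      by (rule nn_integral_indicator[symmetric]) measurable
    also have "\<dots> = (\<integral>\<^sup>+x. ennreal (\<kappa> x) * (\<integral>\<^sup>+u. \<integral>\<^sup>+y.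
        indicator {z \<in> space Q. \<xi> z \<noteq> \<xi>' z} (x, u, y) \<partial>R \<partial>U) \<partial>lborel)"
      by (rule int_Q) measurable
    also have "\<dots> \<le> (\<integral>\<^sup>+x. ennreal (\<kappa> x) * (\<integral>\<^sup>+u. (if u * \<kappa> x \<le> \<kappa>' x then 0 else 1) \<partial>U) \<partial>lborel)"
    proof (intro nn_integral_mono mult_left_mono)
      fix x u
      have "(\<integral>\<^sup>+y. indicator {z \<in> space Q. \<xi> z \<noteq> \<xi>' z} (x, u, y) \<partial>R) \<le>
          (\<integral>\<^sup>+y. (if u * \<kappa> x \<le> \<kappa>' x then 0 else 1) \<partial>R)"
        by (intro nn_integral_mono) (auto simp: \<xi>_def \<xi>'_def indicator_def)
      then show "(\<integral>\<^sup>+y. indicator {z \<in> space Q. \<xi> z \<noteq> \<xi>' z} (x, u, y) \<partial>R) \<le>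
          (if u * \<kappa> x \<le> \<kappa>' x then 0 else 1)"
        by (simp add: R.emeasure_space_1 split: if_splits)
    qed simp
    also have "\<dots> = (\<integral>\<^sup>+x. ennreal (max 0 (\<kappa> x - \<kappa>' x)) \<partial>lborel)"
      unfolding U_def nn_integral_uniform_threshold[OF nn] by simp
    also have "\<dots> \<le> (\<integral>\<^sup>+x. ennreal \<delta> * indicator (cbox 0 (1 :: real ^ 'd)) x \<partial>lborel)"
    proof (rule nn_integral_mono_AE)
      show "AE x in lborel. ennreal (max 0 (\<kappa> x - \<kappa>' x)) \<le> ennreal \<delta> * indicator (cbox 0 (1 :: real ^ 'd)) x"
        using \<delta>
      proof eventually_elim
        case (elim x)
        then show ?case
          using off[of x] nn[of x] \<open>0 \<le> \<delta>\<close> by (cases "x \<in> cbox 0 1") (auto intro!: ennreal_leI)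
      qed
    qed
    also have "\<dots> = ennreal \<delta>"
      by (simp add: nn_integral_cmult_indicator emeasure_unit_cube)
    finally show "emeasure Q {z \<in> space Q. \<xi> z \<noteq> \<xi>' z} \<le> ennreal \<delta>" .
  qed
qed

section \<open>Coupled samples\<close>

text \<open>The ball is enclosed in a cube of side \<open>2 \<rho>\<close>.\<close>

lemma emeasure_ball_le:
  fixes k :: "real ^ 'd \<Rightarrow> real"
  assumes [measurable]: "k \<in> borel_measurable borel" and K: "AE x in lborel. k x \<le> K" and "0 \<le> K"
    and \<rho>: "0 \<le> \<rho>"
  shows "emeasure (density lborel (\<lambda>x. ennreal (k x))) (cball c \<rho>) \<le> ennreal (K * (2 * \<rho>) ^ CARD('d))"
proof -
  let ?b = "cbox (c - \<rho> *\<^sub>R 1) (c + \<rho> *\<^sub>R 1)"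
  have "cball c \<rho> \<subseteq> ?b"
  proof
    fix x assume "x \<in> cball c \<rho>"
    then have "\<bar>(x - c) \<bullet> b\<bar> \<le> \<rho>" if "b \<in> Basis" for b
      using Basis_le_norm[OF that, of "x - c"] by (simp add: dist_norm norm_minus_commute)
    then show "x \<in> ?b"
      by (auto simp: mem_box inner_one_Basis inner_diff_left inner_add_left abs_le_iff algebra_simps)
  qed
  have "emeasure (density lborel (\<lambda>x. ennreal (k x))) (cball c \<rho>) = (\<integral>\<^sup>+x. ennreal (k x) * indicator (cball c \<rho>) x \<partial>lborel)"
    by (rule emeasure_density) auto
  also have "\<dots> \<le> (\<integral>\<^sup>+x. ennreal K * indicator ?b x \<partial>lborel)"
  proof (rule nn_integral_mono_AE)
    show "AE x in lborel. ennreal (k x) * indicator (cball c \<rho>) x \<le> ennreal K * indicator ?b x"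
      using K by eventually_elim (use \<open>cball c \<rho> \<subseteq> ?b\<close> in \<open>auto simp: indicator_def intro: ennreal_leI\<close>)
  qed
  also have "\<dots> = ennreal K * emeasure lborel ?b" by (simp add: nn_integral_cmult_indicator)
  also have "emeasure lborel ?b = ennreal ((2 * \<rho>) ^ CARD('d))"
  proof (subst emeasure_lborel_cbox)
    have side: "(c + \<rho> *\<^sub>R 1 - (c - \<rho> *\<^sub>R 1)) \<bullet> b = 2 * \<rho>" if "b \<in> Basis" for b
    proof -
      have "c + v - (c - v) = 2 *\<^sub>R v" for v :: "real ^ 'd"
        by (simp add: scaleR_2)
      then have "(c + \<rho> *\<^sub>R 1 - (c - \<rho> *\<^sub>R 1)) \<bullet> b = 2 * (\<rho> * (1 \<bullet> b))"
        by (simp only: inner_scaleR_left)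
      then show ?thesis using inner_one_Basis[OF that] by simp
    qed
    show "ennreal (\<Prod>b\<in>Basis. (c + \<rho> *\<^sub>R 1 - (c - \<rho> *\<^sub>R 1)) \<bullet> b) = ennreal ((2 * \<rho>) ^ CARD('d))"
      by (subst prod.cong[OF refl side]) simp_all
  qed (use \<rho> in \<open>auto simp: inner_diff_left inner_add_left inner_one_Basis\<close>)
  finally show ?thesis using \<open>0 \<le> K\<close> \<rho> by (simp add: ennreal_mult)
qed

locale coupled_samples =
  fixes F :: filtration and s :: scheme and T :: real and n :: nat
    and \<kappa> \<kappa>' :: "real ^ 'd \<Rightarrow> real" and Q :: "'e measure" and \<xi> \<xi>' :: "'e \<Rightarrow> real ^ 'd" and \<delta> K :: real
  assumes T: "0 < T" and n: "1 \<le> n"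
    and prob_Q: "prob_space Q"
    and \<xi>_measurable [measurable]: "\<xi> \<in> borel_measurable Q" "\<xi>' \<in> borel_measurable Q"
    and \<kappa>_measurable [measurable]: "\<kappa> \<in> borel_measurable borel" "\<kappa>' \<in> borel_measurable borel"
    and \<xi>_law: "distr Q borel \<xi> = density lborel (\<lambda>x. ennreal (\<kappa> x))"
      "distr Q borel \<xi>' = density lborel (\<lambda>x. ennreal (\<kappa>' x))"
    and differ: "emeasure Q {z \<in> space Q. \<xi> z \<noteq> \<xi>' z} \<le> ennreal \<delta>"
    and \<kappa>_bounded: "AE x in lborel. \<kappa> x \<le> K" "AE x in lborel. \<kappa>' x \<le> K"
    and nonneg: "0 \<le> \<delta>" "0 \<le> K"
begin

definition r :: real where "r = root CARD('d) (real n)"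

text \<open>A ball whose radius is \<open>4 T\<close> after the dilation by \<open>r = n\<^sup>1\<^sup>/\<^sup>d\<close> lies in a cube of volume \<open>(8 T)\<^sup>d / n\<close>.\<close>

definition q :: real where "q = K * (8 * T) ^ CARD('d) / real n"

abbreviation "\<Omega> \<equiv> sampling_space s n Q"

interpretation Q: prob_space Q by (rule prob_Q)
interpretation \<Omega>: prob_space \<Omega> by (rule prob_space_sampling_space[OF prob_Q])

lemma r: "0 < r" "r ^ CARD('d) = real n"
  using n by (simp_all add: r_def)

text \<open>The simplices on which the Euler characteristics of the two samples may disagree, seen in the sample given
by \<open>\<zeta>\<close> (which is \<open>\<xi>\<close> or \<open>\<xi>'\<close>) and separated according to the parity of the number of vertices.\<close>

definition simplex_event :: "('e \<Rightarrow> real ^ 'd) \<Rightarrow> bool \<Rightarrow> real \<Rightarrow> nat set \<Rightarrow> (nat \<Rightarrow> 'e) \<Rightarrow> bool" where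
  "simplex_event \<zeta> p t I Z \<longleftrightarrow> finite I \<and> I \<noteq> {} \<and> even (card I) = p \<and>
     (\<exists>i\<in>I. \<xi> (Z i) \<noteq> \<xi>' (Z i)) \<and> birth F ((\<lambda>i. r *\<^sub>R \<zeta> (Z i)) ` I) \<le> t"

lemma birth_measurable:
  fixes \<zeta> :: "'e \<Rightarrow> real ^ 'd"
  assumes [measurable]: "\<zeta> \<in> borel_measurable Q" and I: "finite I"
  shows "(\<lambda>Z. birth F ((\<lambda>i. r *\<^sub>R \<zeta> (Z i)) ` I)) \<in> borel_measurable (\<Pi>\<^sub>M i\<in>(UNIV::nat set). Q)"
proof -
  have "(\<lambda>Z. (\<lambda>i. r *\<^sub>R \<zeta> (Z i)) ` I) \<in> (\<Pi>\<^sub>M i\<in>(UNIV::nat set). Q) \<rightarrow>\<^sub>M config_space"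
  proof (rule measurable_config_spaceI)
    fix B :: "(real ^ 'd) set" assume [measurable]: "B \<in> sets borel"
    have "{Z \<in> space (\<Pi>\<^sub>M i\<in>(UNIV::nat set). Q). (\<lambda>i. r *\<^sub>R \<zeta> (Z i)) ` I \<inter> B = {}} =
        {Z \<in> space (\<Pi>\<^sub>M i\<in>(UNIV::nat set). Q). \<forall>i\<in>I. r *\<^sub>R \<zeta> (Z i) \<notin> B}" by auto
    also have "\<dots> \<in> sets (\<Pi>\<^sub>M i\<in>(UNIV::nat set). Q)"
      using I by measurable
    finally show "{Z \<in> space (\<Pi>\<^sub>M i\<in>(UNIV::nat set). Q). (\<lambda>i. r *\<^sub>R \<zeta> (Z i)) ` I \<inter> B = {}}
        \<in> sets (\<Pi>\<^sub>M i\<in>(UNIV::nat set). Q)" .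
  qed (use I in simp)
  from measurable_compose[OF this borel_measurable_birth] show ?thesis .
qed

text \<open>A simplex at scale \<open>t \<le> T\<close> has diameter at most \<open>2 T\<close>. In the union of two of
them with a common vertex any two points are therefore at distance at most \<open>4 T\<close>.\<close>

lemma simplex_events_instance:
  assumes \<zeta> [measurable]: "\<zeta> \<in> borel_measurable Q" and [measurable]: "k \<in> borel_measurable borel"
    and law: "distr Q borel \<zeta> = density lborel (\<lambda>x. ennreal (k x))"
    and k: "AE x in lborel. k x \<le> K" and t: "t \<le> T"
  shows "simplex_events Q (simplex_event \<zeta> p t) (\<lambda>z. \<xi> z \<noteq> \<xi>' z)
    (\<lambda>x y. dist (r *\<^sub>R \<zeta> x) (r *\<^sub>R \<zeta> y) \<le> 4 * T) \<delta> q"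
proof (rule simplex_events.intro)
  show "prob_space Q" "0 \<le> \<delta>" "0 \<le> q" using prob_Q nonneg T by (simp_all add: q_def)
  show "Measurable.pred (\<Pi>\<^sub>M i\<in>UNIV. Q) (simplex_event \<zeta> p t I)" if I: "finite I" for I
    unfolding simplex_event_def using birth_measurable[OF \<zeta> I] I by measurable
  show "simplex_event \<zeta> p t I Z = simplex_event \<zeta> p t I Z'" if "\<And>i. i \<in> I \<Longrightarrow> Z i = Z' i" for I Z Z'
  proof -
    have "(\<lambda>i. r *\<^sub>R \<zeta> (Z i)) ` I = (\<lambda>i. r *\<^sub>R \<zeta> (Z' i)) ` I" using that by (intro image_cong) auto
    then show ?thesis using that by (auto simp: simplex_event_def)
  qed
  show "simplex_event \<zeta> p t (\<pi> ` I) Z = simplex_event \<zeta> p t I (\<lambda>i. Z (\<pi> i))" if "inj_on \<pi> I" for \<pi> I Z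
    using that by (auto simp: simplex_event_def card_image image_image finite_image_iff)
  show "\<not> simplex_event \<zeta> p t {} Z" for Z by (simp add: simplex_event_def)
  show "\<exists>i\<in>I. \<xi> (Z i) \<noteq> \<xi>' (Z i) \<and> (\<forall>j\<in>I \<union> J. dist (r *\<^sub>R \<zeta> (Z i)) (r *\<^sub>R \<zeta> (Z j)) \<le> 4 * T)"
    if ev: "simplex_event \<zeta> p t I Z" "simplex_event \<zeta> p t J Z" and "I \<inter> J \<noteq> {}" for I J Z
  proof -
    let ?x = "\<lambda>i. r *\<^sub>R \<zeta> (Z i)"
    obtain i where i: "i \<in> I" "\<xi> (Z i) \<noteq> \<xi>' (Z i)" using ev(1) by (auto simp: simplex_event_def)
    \<comment> \<open>A common vertex, through which the two simplices are linked.\<close>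
    obtain l where l: "l \<in> I" "l \<in> J" using \<open>I \<inter> J \<noteq> {}\<close> by auto
    have "within_scale F t (?x ` I)" "within_scale F t (?x ` J)"
      using ev by (auto simp: simplex_event_def within_scale_iff_birth_le)
    note W = this
    have I: "dist (?x a) (?x b) \<le> 2 * t" if "a \<in> I" "b \<in> I" for a b
      using that within_scale_dist[OF W(1)] by blast
    have J: "dist (?x a) (?x b) \<le> 2 * t" if "a \<in> J" "b \<in> J" for a b
      using that within_scale_dist[OF W(2)] by blast
    have "dist (?x i) (?x j) \<le> 4 * T" if "j \<in> I \<union> J" for j
    proof (cases "j \<in> I")
      case True
      then show ?thesis using I[OF i(1), of j] t T by auto
    next
      case False
      then have "j \<in> J" using that by simp
      then show ?thesis
        using I[OF i(1) l(1)] J[OF l(2), of j] dist_triangle[of "?x i" "?x j" "?x l"] t by linarith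
    qed
    then show ?thesis using i by blast
  qed
  show "Measurable.pred Q (\<lambda>z. \<xi> z \<noteq> \<xi>' z)" by measurable
  show "Measurable.pred (Q \<Otimes>\<^sub>M Q) (\<lambda>p. dist (r *\<^sub>R \<zeta> (fst p)) (r *\<^sub>R \<zeta> (snd p)) \<le> 4 * T)" by measurable
  show "emeasure Q {z \<in> space Q. \<xi> z \<noteq> \<xi>' z} \<le> ennreal \<delta>" by (rule differ)
  show "emeasure Q {y \<in> space Q. dist (r *\<^sub>R \<zeta> x) (r *\<^sub>R \<zeta> y) \<le> 4 * T} \<le> ennreal q" for x
  proof -
    have "dist (r *\<^sub>R \<zeta> x) (r *\<^sub>R \<zeta> y) \<le> 4 * T \<longleftrightarrow> dist (\<zeta> x) (\<zeta> y) \<le> 4 * T / r" for y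
    proof -
      have "dist (r *\<^sub>R \<zeta> x) (r *\<^sub>R \<zeta> y) = r * dist (\<zeta> x) (\<zeta> y)"
        using r(1) by (simp add: dist_norm flip: scaleR_diff_right)
      then show ?thesis using r(1) by (simp add: pos_le_divide_eq mult.commute)
    qed
    then have "{y \<in> space Q. dist (r *\<^sub>R \<zeta> x) (r *\<^sub>R \<zeta> y) \<le> 4 * T} = \<zeta> -` cball (\<zeta> x) (4 * T / r) \<inter> space Q"
      by (simp only: vimage_def mem_cball Int_def mem_Collect_eq conj_commute)
    also have "emeasure Q \<dots> = emeasure (distr Q borel \<zeta>) (cball (\<zeta> x) (4 * T / r))"
      by (rule emeasure_distr[symmetric]) auto
    also have "\<dots> \<le> ennreal (K * (2 * (4 * T / r)) ^ CARD('d))"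
      unfolding law using r T nonneg k by (intro emeasure_ball_le) auto
    also have "K * (2 * (4 * T / r)) ^ CARD('d) = q"
      using r(2) by (simp add: q_def power_divide)
    finally show ?thesis .
  qed
qed

lemma simplex_events_coupled:
  assumes "\<zeta> \<in> {\<xi>, \<xi>'}"
  shows "simplex_events Q (simplex_event \<zeta> p (min t T)) (\<lambda>z. \<xi> z \<noteq> \<xi>' z)
    (\<lambda>x y. dist (r *\<^sub>R \<zeta> x) (r *\<^sub>R \<zeta> y) \<le> 4 * T) \<delta> q"
proof (cases "\<zeta> = \<xi>")
  case True
  then show ?thesis using \<xi>_law \<kappa>_bounded by (auto intro!: simplex_events_instance[where k=\<kappa>])
next
  case False
  then have "\<zeta> = \<xi>'" using assms by simp
  then show ?thesis using \<xi>_law \<kappa>_bounded by (auto intro!: simplex_events_instance[where k=\<kappa>'])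
qed

text \<open>Truncation of \<open>t\<close> at \<open>T\<close> keeps the neighbourhoods within radius \<open>4 T\<close> for all real \<open>t\<close>.\<close>

definition count :: "('e \<Rightarrow> real ^ 'd) \<Rightarrow> bool \<Rightarrow> real \<Rightarrow> nat \<times> (nat \<Rightarrow> 'e) \<Rightarrow> real" where
  "count \<zeta> p t = simplex_events.evcount (simplex_event \<zeta> p (min t T))"

definition mean_count :: "('e \<Rightarrow> real ^ 'd) \<Rightarrow> bool \<Rightarrow> real \<Rightarrow> real" where
  "mean_count \<zeta> p t = (\<integral>\<omega>. count \<zeta> p t \<omega> \<partial>\<Omega>)"

definition B :: real where
  "B = 4 * \<delta> * (real n * exp (real n * (3 * q)))"

lemma count_process:
  assumes "\<zeta> \<in> {\<xi>, \<xi>'}"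
  shows "monotone_process \<Omega> (count \<zeta> p) (mean_count \<zeta> p) {0..T} B" "integrable \<Omega> (count \<zeta> p t)"
proof -
  interpret E: simplex_events Q "simplex_event \<zeta> p (min t T)" "\<lambda>z. \<xi> z \<noteq> \<xi>' z"
    "\<lambda>x y. dist (r *\<^sub>R \<zeta> x) (r *\<^sub>R \<zeta> y) \<le> 4 * T" \<delta> q for t
    by (rule simplex_events_coupled[OF assms])
  show int: "integrable \<Omega> (count \<zeta> p t)" for t
    unfolding count_def by (rule E.evcount_variance_le(1)[OF n])
  have mono: "count \<zeta> p t \<omega> \<le> count \<zeta> p t' \<omega>" if "t \<le> t'" for t t' \<omega>
  proof (cases \<omega>)
    case (Pair N Z)
    have "finite {I \<in> Pow {1..N}. simplex_event \<zeta> p (min t' T) I Z}" by simp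
    then show ?thesis unfolding count_def E.evcount_def Pair using that
      by (auto intro!: card_mono simp: simplex_event_def)
  qed
  show "monotone_process \<Omega> (count \<zeta> p) (mean_count \<zeta> p) {0..T} B"
  proof
    show "count \<zeta> p t \<in> borel_measurable \<Omega>" for t using int by auto
    show "0 \<le> mean_count \<zeta> p t \<and> mean_count \<zeta> p t \<le> B" for t
      using E.evcount_variance_le(2)[OF n, of s t] E.bound_def
      by (simp add: mean_count_def count_def B_def E.evcount_nonneg)
    show "(\<integral>\<^sup>+\<omega>. ennreal ((count \<zeta> p t \<omega> - mean_count \<zeta> p t)\<^sup>2) \<partial>\<Omega>) \<le> ennreal B" for t
      using E.evcount_variance_le(3)[OF n, of s t] E.bound_def
      by (simp add: mean_count_def count_def B_def)
    show "0 \<le> B" using nonneg by (simp add: B_def)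
  qed (rule mono)
qed

text \<open>The samples are sets, whereas simplices are counted as sets of indices. The two agree unless two of the points
coincide, which has probability \<open>0\<close> because the points have a density.\<close>

lemma AE_distinct:
  assumes "\<zeta> \<in> {\<xi>, \<xi>'}"
  shows "AE \<omega> in \<Omega>. inj_on (\<lambda>i. \<zeta> (snd \<omega> i)) {1..fst \<omega>}"
proof -
  obtain k where [measurable]: "k \<in> borel_measurable borel"
    and law: "distr Q borel \<zeta> = density lborel (\<lambda>x. ennreal (k x))"
  proof (cases "\<zeta> = \<xi>")
    case True
    then show ?thesis using that[of \<kappa>] \<xi>_law by simp
  next
    case False
    then show ?thesis using that[of \<kappa>'] \<xi>_law assms by simp
  qed
  have \<zeta> [measurable]: "\<zeta> \<in> borel_measurable Q" using assms by auto
  interpret P: product_prob_space "\<lambda>_::nat. Q" UNIV by standard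
  have null: "emeasure Q {y \<in> space Q. \<zeta> x = \<zeta> y} = 0" for x
  proof -
    have "{y \<in> space Q. \<zeta> x = \<zeta> y} = \<zeta> -` {\<zeta> x} \<inter> space Q" by auto
    also have "emeasure Q \<dots> = emeasure (distr Q borel \<zeta>) {\<zeta> x}"
      by (rule emeasure_distr[symmetric]) auto
    also have "\<dots> = (\<integral>\<^sup>+y. ennreal (k y) * indicator {\<zeta> x} y \<partial>lborel)"
      unfolding law by (rule emeasure_density) auto
    also have "\<dots> = 0"
      using AE_lborel_singleton[of "\<zeta> x"] by (subst nn_integral_0_iff_AE) (auto elim!: eventually_mono)
    finally show ?thesis .
  qed
  have "AE \<omega> in \<Omega>. \<zeta> (snd \<omega> i) \<noteq> \<zeta> (snd \<omega> j)" if ij: "i \<noteq> j" for i j :: nat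
  proof -
    let ?f = "\<lambda>x y. indicator {p \<in> space (Q \<Otimes>\<^sub>M Q). \<zeta> (fst p) = \<zeta> (snd p)} (x, y) :: ennreal"
    have [measurable]: "case_prod ?f \<in> borel_measurable (Q \<Otimes>\<^sub>M Q)" by (simp add: case_prod_beta) 
    have fm: "(\<lambda>\<sigma>. ?f (\<sigma> i) (\<sigma> j)) \<in> borel_measurable (\<Pi>\<^sub>M i\<in>J. Q)" if "i \<in> J" "j \<in> J" for J
    proof -
      have "(\<lambda>\<sigma>. (\<sigma> i, \<sigma> j)) \<in> (\<Pi>\<^sub>M i\<in>J. Q) \<rightarrow>\<^sub>M Q \<Otimes>\<^sub>M Q"
        using that by (intro measurable_Pair measurable_component_singleton) auto
      from measurable_compose[OF this \<open>case_prod ?f \<in> _\<close>] show ?thesis by simp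
    qed
    have "(\<integral>\<^sup>+Z. ?f (Z i) (Z j) \<partial>(\<Pi>\<^sub>M i\<in>UNIV. Q)) =
        (\<integral>\<^sup>+\<sigma>. ?f (\<sigma> i) (\<sigma> j) \<partial>distr (\<Pi>\<^sub>M i\<in>UNIV. Q) (\<Pi>\<^sub>M i\<in>{i, j}. Q) (\<lambda>Z. restrict Z {i, j}))"
      by (subst nn_integral_distr) (auto intro!: fm measurable_restrict_subset)
    also have "distr (\<Pi>\<^sub>M i\<in>UNIV. Q) (\<Pi>\<^sub>M i\<in>{i, j}. Q) (\<lambda>Z. restrict Z {i, j}) = (\<Pi>\<^sub>M i\<in>{i, j}. Q)"
      by (rule P.distr_PiM_restrict_finite) auto
    also have "(\<integral>\<^sup>+\<sigma>. ?f (\<sigma> i) (\<sigma> j) \<partial>(\<Pi>\<^sub>M i\<in>{i, j}. Q)) = (\<integral>\<^sup>+z. ?f (fst z) (snd z) \<partial>(Q \<Otimes>\<^sub>M Q))"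
      by (rule P.product_nn_integral_pair[of "\<lambda>x y. ?f x y", OF _ ij]) measurable
    also have "\<dots> = (\<integral>\<^sup>+x. \<integral>\<^sup>+y. ?f x y \<partial>Q \<partial>Q)"
      by (subst Q.nn_integral_fst[symmetric]) auto
    also have "\<dots> = (\<integral>\<^sup>+x. 0 \<partial>Q)"
    proof (rule nn_integral_cong)
      fix x assume x: "x \<in> space Q"
      have "(\<integral>\<^sup>+y. ?f x y \<partial>Q) = (\<integral>\<^sup>+y. indicator {y \<in> space Q. \<zeta> x = \<zeta> y} y \<partial>Q)"
        using x by (intro nn_integral_cong) (auto simp: indicator_def space_pair_measure)
      then show "(\<integral>\<^sup>+y. ?f x y \<partial>Q) = 0" using null[of x] by simp
    qed
    finally have zero: "(\<integral>\<^sup>+Z. ?f (Z i) (Z j) \<partial>(\<Pi>\<^sub>M i\<in>UNIV. Q)) = 0" by simp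
    have m: "(\<lambda>\<omega>. ?f (snd \<omega> i) (snd \<omega> j)) \<in> borel_measurable \<Omega>"
      by (rule measurable_sampling_space) (use fm in simp)
    have "(\<integral>\<^sup>+\<omega>. ?f (snd \<omega> i) (snd \<omega> j) \<partial>\<Omega>) = 0"
      by (subst nn_integral_sampling_space[OF prob_Q m]) (simp add: zero)
    then have "AE \<omega> in \<Omega>. ?f (snd \<omega> i) (snd \<omega> j) = 0"
      by (subst (asm) nn_integral_0_iff_AE[OF m])
    moreover have "AE \<omega> in \<Omega>. snd \<omega> \<in> UNIV \<rightarrow>\<^sub>E space Q"
      by (rule AE_I2) (auto simp: space_sampling_space)
    ultimately show ?thesis
      by eventually_elim (auto simp: indicator_def space_pair_measure split: if_splits)
  qed
  then have "AE \<omega> in \<Omega>. \<forall>i j. i \<noteq> j \<longrightarrow> \<zeta> (snd \<omega> i) \<noteq> \<zeta> (snd \<omega> j)"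
    by (auto simp: AE_all_countable)
  then show ?thesis by eventually_elim (auto simp: inj_on_def)
qed

lemma count_eq:
  assumes \<zeta>: "\<zeta> \<in> {\<xi>, \<xi>'}" and "t \<le> T"
  shows "count \<zeta> p t (N, Z) = (\<Sum>I\<in>nonempty_subsets {1..N}. of_bool (simplex_event \<zeta> p t I Z))"
proof -
  interpret E: simplex_events Q "simplex_event \<zeta> p (min t T)" "\<lambda>z. \<xi> z \<noteq> \<xi>' z"
    "\<lambda>x y. dist (r *\<^sub>R \<zeta> x) (r *\<^sub>R \<zeta> y) \<le> 4 * T" \<delta> q
    by (rule simplex_events_coupled[OF \<zeta>])
  have "{I \<in> Pow {1..N}. simplex_event \<zeta> p t I Z} =
      {I \<in> nonempty_subsets {1..N}. simplex_event \<zeta> p t I Z}"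
    by (auto simp: nonempty_subsets_def simplex_event_def)
  then show ?thesis
    using assms E.evcount_def by (simp add: count_def min_absorb1 sum_of_bool_eq Int_def)
qed

text \<open>A simplex without disagreeing vertex has the same birth time in both samples, and its contributions cancel.
Simplices with an odd number of vertices count positively.\<close>

lemma chi_difference:
  assumes t: "t \<le> T"
    and inj: "inj_on (\<lambda>i. \<xi> (Z i)) {1..N}" "inj_on (\<lambda>i. \<xi>' (Z i)) {1..N}"
  shows "scaled_euler_char F n t (sample \<xi>' (N, Z)) - scaled_euler_char F n t (sample \<xi> (N, Z)) =
    count \<xi>' False t (N, Z) - count \<xi>' True t (N, Z) -
    (count \<xi> False t (N, Z) - count \<xi> True t (N, Z))"
proof -
  let ?b = "\<lambda>\<zeta> I. of_bool (birth F ((\<lambda>i. r *\<^sub>R \<zeta> (Z i)) ` I) \<le> t) :: real"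
  have chi: "scaled_euler_char F n t (sample \<zeta> (N, Z)) =
      (\<Sum>I\<in>nonempty_subsets {1..N}. (-1) ^ (card I + 1) * ?b \<zeta> I)"
    if "inj_on (\<lambda>i. \<zeta> (Z i)) {1..N}" for \<zeta> :: "'e \<Rightarrow> real ^ 'd"
    using chi_image[OF that, of F r t] n
    by (simp add: sample_def scaled_euler_char_eq_chi r_def)
  have summand: "(-1) ^ (card I + 1) * ?b \<xi>' I - (-1) ^ (card I + 1) * ?b \<xi> I =
      of_bool (simplex_event \<xi>' False t I Z) - of_bool (simplex_event \<xi>' True t I Z) -
      (of_bool (simplex_event \<xi> False t I Z) - of_bool (simplex_event \<xi> True t I Z))"
    if I: "I \<in> nonempty_subsets {1..N}" for I
  proof (cases "\<exists>i\<in>I. \<xi> (Z i) \<noteq> \<xi>' (Z i)")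
    case True
    moreover have "finite I" using I by (auto simp: nonempty_subsets_def dest: finite_subset)
    ultimately show ?thesis using I
      by (cases "even (card I)") (auto simp: simplex_event_def nonempty_subsets_def)
  next
    case False
    then have "(\<lambda>i. r *\<^sub>R \<xi>' (Z i)) ` I = (\<lambda>i. r *\<^sub>R \<xi> (Z i)) ` I" by (intro image_cong) auto
    then show ?thesis using False by (simp add: simplex_event_def)
  qed
  show ?thesis
    unfolding chi[OF inj(1)] chi[OF inj(2)] count_eq[OF insertI1 t] 
      count_eq[OF insertI2[OF singletonI] t] sum_subtractf[symmetric]
    by (intro sum.cong refl summand)
qed

section \<open>The Wasserstein distance of coupled samples\<close>

abbreviation "chi_path \<zeta> \<equiv> chi_bar F T n \<Omega> (sample \<zeta>)"

definition D :: "real set" where "D = {0..T} \<inter> (\<rat> \<union> {T})"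

text \<open>The supremum over the countable set \<open>D\<close> of times is measurable and, by right-continuity, loses nothing.\<close>

definition dev :: "('e \<Rightarrow> real ^ 'd) \<Rightarrow> bool \<Rightarrow> nat \<times> (nat \<Rightarrow> 'e) \<Rightarrow> ennreal" where
  "dev \<zeta> p \<omega> = (SUP t\<in>D. ennreal \<bar>count \<zeta> p t \<omega> - mean_count \<zeta> p t\<bar>)"

lemma countable_D: "countable D" and D_subset: "D \<subseteq> {0..T}"
  unfolding D_def by (auto intro: countable_subset[of _ "\<rat> \<union> {T}"] simp: countable_rat)

lemma count_integrable [simp]: "integrable \<Omega> (count \<xi> p t)" "integrable \<Omega> (count \<xi>' p t)"
  using count_process(2) by auto

lemma count_measurable [measurable]:
  "count \<xi> p t \<in> borel_measurable \<Omega>" "count \<xi>' p t \<in> borel_measurable \<Omega>"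
  by (rule borel_measurable_integrable[OF count_integrable(1)]
      borel_measurable_integrable[OF count_integrable(2)])+

lemma dev_measurable [measurable]:
  "dev \<xi> p \<in> borel_measurable \<Omega>" "dev \<xi>' p \<in> borel_measurable \<Omega>"
proof -
  show "dev \<xi> p \<in> borel_measurable \<Omega>" "dev \<xi>' p \<in> borel_measurable \<Omega>"
    unfolding dev_def using countable_D by measurable
qed

lemma AE_path_distance_le:
  "AE \<omega> in \<Omega>. ennreal (sup_dist T (chi_path \<xi>' \<omega>) (chi_path \<xi> \<omega>)) \<le>
     ennreal (real n powr (-1/2)) * (dev \<xi>' False \<omega> + dev \<xi>' True \<omega> + dev \<xi> False \<omega> + dev \<xi> True \<omega>)"
proof -
  let ?\<chi> = "\<lambda>\<zeta> t \<omega>. scaled_euler_char F n t (sample \<zeta> \<omega>)"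
  let ?c = "\<lambda>t \<omega>. count \<xi>' False t \<omega> - count \<xi>' True t \<omega> - (count \<xi> False t \<omega> - count \<xi> True t \<omega>)"
  have [measurable]: "?c t \<in> borel_measurable \<Omega>" for t
    by measurable
  let ?m = "\<lambda>t. mean_count \<xi>' False t - mean_count \<xi>' True t - (mean_count \<xi> False t - mean_count \<xi> True t)"
  note sm = measurable_sample[OF \<xi>_measurable(1), of s n] measurable_sample[OF \<xi>_measurable(2), of s n]
  note ip = integrable_pow_card_sample[OF prob_Q \<xi>_measurable(1) n, of s]
    integrable_pow_card_sample[OF prob_Q \<xi>_measurable(2) n, of s]
  have AE: "AE \<omega> in \<Omega>. \<forall>t\<le>T. ?\<chi> \<xi>' t \<omega> - ?\<chi> \<xi> t \<omega> = ?c t \<omega>"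
    using AE_distinct[OF insertI1] AE_distinct[OF insertI2[OF singletonI]]
  proof eventually_elim
    case (elim \<omega>)
    then show ?case using chi_difference[of _ "snd \<omega>" "fst \<omega>"] by simp
  qed
  have int\<chi>: "integrable \<Omega> (?\<chi> \<xi> t)" "integrable \<Omega> (?\<chi> \<xi>' t)" for t
    using integrable_scaled_euler_char[OF \<Omega>.prob_space_axioms n sm(1) ip(1)]
      integrable_scaled_euler_char[OF \<Omega>.prob_space_axioms n sm(2) ip(2)] by auto
  have mean: "(\<integral>\<omega>. ?\<chi> \<xi>' t \<omega> \<partial>\<Omega>) - (\<integral>\<omega>. ?\<chi> \<xi> t \<omega> \<partial>\<Omega>) = ?m t" if t: "t \<le> T" for t
  proof -
    have "(\<integral>\<omega>. ?\<chi> \<xi>' t \<omega> \<partial>\<Omega>) - (\<integral>\<omega>. ?\<chi> \<xi> t \<omega> \<partial>\<Omega>) = (\<integral>\<omega>. ?\<chi> \<xi>' t \<omega> - ?\<chi> \<xi> t \<omega> \<partial>\<Omega>)"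
      using int\<chi> by simp
    also have "\<dots> = (\<integral>\<omega>. ?c t \<omega> \<partial>\<Omega>)"
      using AE t int\<chi> by (intro integral_cong_AE) (auto elim!: eventually_mono)
    finally show ?thesis by (simp add: mean_count_def)
  qed
  show ?thesis
    using AE AE_space
  proof eventually_elim
    case (elim \<omega>)
    have "ennreal \<bar>chi_path \<xi>' \<omega> t - chi_path \<xi> \<omega> t\<bar> \<le> ennreal (real n powr (-1/2)) *
        (dev \<xi>' False \<omega> + dev \<xi>' True \<omega> + dev \<xi> False \<omega> + dev \<xi> True \<omega>)" if t: "t \<in> D" for t
    proof -
      let ?d = "\<lambda>\<zeta> p. \<bar>count \<zeta> p t \<omega> - mean_count \<zeta> p t\<bar>"
      have tT: "t \<in> {0..T}" using t D_subset by auto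
      have "chi_path \<xi>' \<omega> t - chi_path \<xi> \<omega> t = real n powr (-1/2) * ((?\<chi> \<xi>' t \<omega> - ?\<chi> \<xi> t \<omega>) -
          ((\<integral>\<omega>. ?\<chi> \<xi>' t \<omega> \<partial>\<Omega>) - (\<integral>\<omega>. ?\<chi> \<xi> t \<omega> \<partial>\<Omega>)))"
        using tT by (simp add: chi_bar_def algebra_simps)
      also have "\<dots> = real n powr (-1/2) * (?c t \<omega> - ?m t)"
        using elim(1) mean[of t] tT by simp
      finally have "\<bar>chi_path \<xi>' \<omega> t - chi_path \<xi> \<omega> t\<bar> = real n powr (-1/2) * \<bar>?c t \<omega> - ?m t\<bar>"
        by (simp add: abs_mult)
      also have "\<dots> \<le> real n powr (-1/2) * (?d \<xi>' False + ?d \<xi>' True + ?d \<xi> False + ?d \<xi> True)"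
        by (intro mult_left_mono) auto
      finally have "ennreal \<bar>chi_path \<xi>' \<omega> t - chi_path \<xi> \<omega> t\<bar> \<le> ennreal (real n powr (-1/2)) *
          (ennreal (?d \<xi>' False) + ennreal (?d \<xi>' True) + ennreal (?d \<xi> False) + ennreal (?d \<xi> True))"
        by (simp add: ennreal_leI flip: ennreal_mult' ennreal_plus)
      also have "\<dots> \<le> ennreal (real n powr (-1/2)) *
        (dev \<xi>' False \<omega> + dev \<xi>' True \<omega> + dev \<xi> False \<omega> + dev \<xi> True \<omega>)"
        unfolding dev_def using t by (intro mult_left_mono add_mono SUP_upper) auto
      finally show ?thesis .
    qed
    then have "(SUP t\<in>D. ennreal \<bar>chi_path \<xi>' \<omega> t - chi_path \<xi> \<omega> t\<bar>) \<le> ennreal (real n powr (-1/2)) *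
        (dev \<xi>' False \<omega> + dev \<xi>' True \<omega> + dev \<xi> False \<omega> + dev \<xi> True \<omega>)"
      by (rule SUP_least)
    moreover have "ennreal (sup_dist T (chi_path \<xi>' \<omega>) (chi_path \<xi> \<omega>)) \<le> (SUP t\<in>D. ennreal \<bar>chi_path \<xi>' \<omega> t - chi_path \<xi> \<omega> t\<bar>)"
      unfolding D_def using elim(2)
      by (intro cadlag_sup_dist_le T chi_bar_cadlag[OF \<Omega>.prob_space_axioms n sm(1) ip(1)]
          chi_bar_cadlag[OF \<Omega>.prob_space_axioms n sm(2) ip(2)])
    ultimately show ?case by (rule order_trans[rotated])
  qed
qed

text \<open>With \<open>B = 4 \<delta> n e\<close> the first term of the bound on the supremum gives \<open>\<surd>J \<surd>\<delta>\<close>, and the second one gives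
\<open>(\<surd>n / J) \<delta>\<close>, which is at most \<open>\<surd>(n/J) \<delta>\<close>.\<close>

lemma rate_arithmetic:
  assumes J: "1 \<le> J"
  shows "real n powr (-1/2) * (4 * (sqrt (4 * real J * B) + B / real J)) \<le>
    16 * exp (3 * (K * (8 * T) ^ CARD('d))) * (sqrt (real J) * sqrt \<delta> + sqrt (real n / real J) * \<delta>)"
proof -
  define e where "e = exp (3 * (K * (8 * T) ^ CARD('d)))"
  have e: "1 \<le> e" unfolding e_def using nonneg T by simp
  have B: "B = 4 * \<delta> * (real n * e)"
  proof -
    have "real n * (3 * q) = 3 * (K * (8 * T) ^ CARD('d))"
      unfolding q_def using n by simp
    then show ?thesis unfolding B_def e_def by simp
  qed
  have np: "real n powr (-1/2) = 1 / sqrt (real n)"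
    using powr_minus_divide[of "real n" "1/2"] n by (simp add: powr_half_sqrt)
  have "4 * real J * B = 16 * (real J * \<delta>) * real n * e" by (simp add: B)
  moreover have "sqrt (16 * (real J * \<delta>) * real n * e) =
      4 * (sqrt (real J) * sqrt \<delta>) * sqrt (real n) * sqrt e"
    by (simp add: real_sqrt_mult)
  ultimately have "sqrt (4 * real J * B) = 4 * (sqrt (real J) * sqrt \<delta>) * sqrt (real n) * sqrt e"
    by (simp only:)
  also have "\<dots> \<le> 4 * (sqrt (real J) * sqrt \<delta>) * sqrt (real n) * e"
    using e nonneg by (intro mult_left_mono) (auto simp: real_sqrt_le_iff real_le_lsqrt power2_eq_square)
  finally have 1: "sqrt (4 * real J * B) / sqrt (real n) \<le> 4 * (sqrt (real J) * sqrt \<delta>) * e"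
    using n by (simp add: field_simps)
  have "B / real J / sqrt (real n) = 4 * e * \<delta> * (sqrt (real n) / real J)"
  proof -
    have "B / real J / sqrt (real n) = 4 * e * \<delta> * (real n / sqrt (real n) / real J)"
      by (simp add: B mult_ac)
    then show ?thesis by (simp add: real_div_sqrt)
  qed
  also have "sqrt (real n) / real J \<le> sqrt (real n / real J)"
  proof -
    have "sqrt (real J) \<le> real J" using J by (intro real_le_lsqrt) (auto simp: power2_eq_square)
    then show ?thesis using J by (simp add: real_sqrt_divide frac_le)
  qed
  finally have 2: "B / real J / sqrt (real n) \<le> 4 * e * \<delta> * sqrt (real n / real J)"
    using e nonneg by (simp add: mult_left_mono)
  have "real n powr (-1/2) * (4 * (sqrt (4 * real J * B) + B / real J)) =
      4 * (sqrt (4 * real J * B) / sqrt (real n) + B / real J / sqrt (real n))"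
    unfolding np by (simp add: add_divide_distrib)
  also have "\<dots> \<le> 4 * (4 * (sqrt (real J) * sqrt \<delta>) * e + 4 * e * \<delta> * sqrt (real n / real J))"
    by (intro mult_left_mono add_mono 1 2) simp
  also have "\<dots> = 16 * e * (sqrt (real J) * sqrt \<delta> + sqrt (real n / real J) * \<delta>)"
    by (simp add: algebra_simps)
  finally show ?thesis unfolding e_def .
qed

lemma nn_integral_path_distance_le:
  assumes J: "1 \<le> J"
  shows "(\<integral>\<^sup>+\<omega>. ennreal (real n powr (-1/2)) *
      (dev \<xi>' False \<omega> + dev \<xi>' True \<omega> + dev \<xi> False \<omega> + dev \<xi> True \<omega>) \<partial>\<Omega>) \<le>
    ennreal (16 * exp (3 * (K * (8 * T) ^ CARD('d))) *
      (sqrt (real J) * sqrt \<delta> + sqrt (real n / real J) * \<delta>))"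
proof -
  let ?b = "sqrt (4 * real J * B) + B / real J"
  have B0: "0 \<le> B" using nonneg by (simp add: B_def)
  then have b0: "0 \<le> ?b" by simp
  have d: "(\<integral>\<^sup>+\<omega>. dev \<zeta> p \<omega> \<partial>\<Omega>) \<le> ennreal ?b" if "\<zeta> \<in> {\<xi>, \<xi>'}" for \<zeta> p
    unfolding dev_def
    by (rule monotone_process.countable_sup_deviation_le[OF count_process(1)[OF that] countable_D D_subset J])
  have "(\<integral>\<^sup>+\<omega>. ennreal (real n powr (-1/2)) *
      (dev \<xi>' False \<omega> + dev \<xi>' True \<omega> + dev \<xi> False \<omega> + dev \<xi> True \<omega>) \<partial>\<Omega>) =
    ennreal (real n powr (-1/2)) * ((\<integral>\<^sup>+\<omega>. dev \<xi>' False \<omega> \<partial>\<Omega>) + (\<integral>\<^sup>+\<omega>. dev \<xi>' True \<omega> \<partial>\<Omega>) +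
      (\<integral>\<^sup>+\<omega>. dev \<xi> False \<omega> \<partial>\<Omega>) + (\<integral>\<^sup>+\<omega>. dev \<xi> True \<omega> \<partial>\<Omega>))"
    by (simp add: nn_integral_cmult nn_integral_add)
  also have "\<dots> \<le> ennreal (real n powr (-1/2)) * (ennreal ?b + ennreal ?b + ennreal ?b + ennreal ?b)"
    by (intro mult_left_mono add_mono d) auto
  also have "ennreal ?b + ennreal ?b + ennreal ?b + ennreal ?b = ennreal (4 * ?b)"
    using b0 by (simp flip: ennreal_plus)
  also have "ennreal (real n powr (-1/2)) * ennreal (4 * ?b) = ennreal (real n powr (-1/2) * (4 * ?b))"
    using b0 by (intro ennreal_mult[symmetric]) auto
  finally show ?thesis using rate_arithmetic[OF J] ennreal_leI order_trans by blast
qed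

text \<open>A Lipschitz function of the path is dominated by its value at the zero path plus the sup-norm of the path,
and the latter is at most of the order of \<open>2\<close> to the number of points.\<close>

lemma integrable_test_function:
  assumes f: "f \<in> borel_measurable (cadlag_space T)"
    and lip: "\<And>x y. x \<in> cadlag_functions T \<Longrightarrow> y \<in> cadlag_functions T \<Longrightarrow> \<bar>f x - f y\<bar> \<le> sup_dist T x y"
    and \<zeta>: "\<zeta> \<in> borel_measurable Q"
  shows "integrable \<Omega> (\<lambda>\<omega>. f (chi_path \<zeta> \<omega>))"
proof -
  note sm = measurable_sample[OF \<zeta>, of s n]
  note ip = integrable_pow_card_sample[OF prob_Q \<zeta> n, of s]
  note path_meas = measurable_chi_bar[OF \<Omega>.prob_space_axioms n sm ip]
  \<comment> \<open>The zero path is cadlag because it is the process of the empty configuration.\<close>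
  define z where "z = (\<lambda>t\<in>{0..T}. 0 :: real)"
  have z: "z \<in> cadlag_functions T"
  proof -
    have "chi_bar F T n \<Omega> (\<lambda>_. {} :: (real ^ 'd) set) = (\<lambda>_. z)"
      by (simp add: fun_eq_iff chi_bar_def z_def \<Omega>.prob_space)
    moreover obtain \<omega> where "\<omega> \<in> space \<Omega>" using \<Omega>.not_empty by auto
    moreover have "(\<lambda>_. {}) \<in> \<Omega> \<rightarrow>\<^sub>M (config_space :: (real ^ 'd) set measure)"
      by (rule measurable_const) (simp add: space_config_space)
    ultimately show ?thesis
      using chi_bar_cadlag[OF \<Omega>.prob_space_axioms n, of "\<lambda>_. {} :: (real ^ 'd) set" \<omega> F T] by simp
  qed
  define c where "c = (\<integral>\<omega>. 2 ^ card (sample \<zeta> \<omega>) \<partial>\<Omega> :: real)"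
  have "integrable \<Omega> (\<lambda>\<omega>. \<bar>f z\<bar> + real n powr (-1/2) * (2 ^ card (sample \<zeta> \<omega>) + c))"
    using ip by auto
  then show ?thesis
  proof (rule Bochner_Integration.integrable_bound)
    show "(\<lambda>\<omega>. f (chi_path \<zeta> \<omega>)) \<in> borel_measurable \<Omega>"
      by (rule measurable_compose[OF path_meas f])
    have "norm (f (chi_path \<zeta> \<omega>)) \<le> norm (\<bar>f z\<bar> + real n powr (-1/2) * (2 ^ card (sample \<zeta> \<omega>) + c))"
      if \<omega>: "\<omega> \<in> space \<Omega>" for \<omega>
    proof -
      have "sup_dist T (chi_path \<zeta> \<omega>) z \<le> real n powr (-1/2) * (2 ^ card (sample \<zeta> \<omega>) + c)"
        unfolding sup_dist_def
      proof (rule cSUP_least)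
        fix t assume t: "t \<in> {0..T}"
        let ?\<chi> = "\<lambda>\<omega>. scaled_euler_char F n t (sample \<zeta> \<omega>)"
        have le: "\<bar>?\<chi> \<omega>\<bar> \<le> 2 ^ card (sample \<zeta> \<omega>)" if "\<omega> \<in> space \<Omega>" for \<omega>
          by (rule abs_scaled_euler_char_config_le[OF \<Omega>.prob_space_axioms n sm ip that])
        have "\<bar>\<integral>\<omega>. ?\<chi> \<omega> \<partial>\<Omega>\<bar> \<le> (\<integral>\<omega>. \<bar>?\<chi> \<omega>\<bar> \<partial>\<Omega>)" by (rule integral_abs_bound)
        also have "\<dots> \<le> c" unfolding c_def
          using integrable_scaled_euler_char[OF \<Omega>.prob_space_axioms n sm ip] le ip
          by (intro integral_mono) auto
        finally have "\<bar>?\<chi> \<omega> - (\<integral>\<omega>. ?\<chi> \<omega> \<partial>\<Omega>)\<bar> \<le> 2 ^ card (sample \<zeta> \<omega>) + c"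
          using le[OF \<omega>] by linarith
        then show "\<bar>chi_path \<zeta> \<omega> t - z t\<bar> \<le> real n powr (-1/2) * (2 ^ card (sample \<zeta> \<omega>) + c)"
          using t by (simp add: chi_bar_def z_def abs_mult mult_left_mono)
      qed (use T in simp)
      then show ?thesis
        using lip[OF chi_bar_cadlag[OF \<Omega>.prob_space_axioms n sm ip \<omega>] z] by (smt (verit) real_norm_def)
    qed
    then show "AE \<omega> in \<Omega>. norm (f (chi_path \<zeta> \<omega>)) \<le>
        norm (\<bar>f z\<bar> + real n powr (-1/2) * (2 ^ card (sample \<zeta> \<omega>) + c))"
      by (rule AE_I2)
  qed
qed

theorem wasserstein_dist_coupled_le:
  assumes J: "1 \<le> J"
  shows "wasserstein_dist T (chi_bar_law F T n \<Omega> (sample \<xi>')) (chi_bar_law F T n \<Omega> (sample \<xi>)) \<le>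
    ennreal (16 * exp (3 * (K * (8 * T) ^ CARD('d))) *
      (sqrt (real J) * sqrt \<delta> + sqrt (real n / real J) * \<delta>))"
  unfolding wasserstein_dist_def
proof (rule SUP_least)
  fix f assume "f \<in> {f \<in> borel_measurable (cadlag_space T).
    \<forall>x\<in>cadlag_functions T. \<forall>y\<in>cadlag_functions T. \<bar>f x - f y\<bar> \<le> sup_dist T x y}"
  then have f: "f \<in> borel_measurable (cadlag_space T)"
    and lip: "\<And>x y. x \<in> cadlag_functions T \<Longrightarrow> y \<in> cadlag_functions T \<Longrightarrow> \<bar>f x - f y\<bar> \<le> sup_dist T x y"
    by auto
  note sm = measurable_sample[OF \<xi>_measurable(1), of s n] measurable_sample[OF \<xi>_measurable(2), of s n]
  note ip = integrable_pow_card_sample[OF prob_Q \<xi>_measurable(1) n, of s]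
    integrable_pow_card_sample[OF prob_Q \<xi>_measurable(2) n, of s]
  note pm = measurable_chi_bar[OF \<Omega>.prob_space_axioms n sm(1) ip(1), of F T]
    measurable_chi_bar[OF \<Omega>.prob_space_axioms n sm(2) ip(2), of F T]
  note int = integrable_test_function[OF f lip \<xi>_measurable(1)] integrable_test_function[OF f lip \<xi>_measurable(2)]
  let ?W = "\<lambda>\<omega>. ennreal (real n powr (-1/2)) *
      (dev \<xi>' False \<omega> + dev \<xi>' True \<omega> + dev \<xi> False \<omega> + dev \<xi> True \<omega>)"
  have "(\<integral>x. f x \<partial>chi_bar_law F T n \<Omega> (sample \<xi>')) - (\<integral>x. f x \<partial>chi_bar_law F T n \<Omega> (sample \<xi>)) =
      (\<integral>\<omega>. f (chi_path \<xi>' \<omega>) - f (chi_path \<xi> \<omega>) \<partial>\<Omega>)"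
    unfolding chi_bar_law_def using int by (simp add: integral_distr[OF pm(1) f] integral_distr[OF pm(2) f])
  then have "ennreal \<bar>(\<integral>x. f x \<partial>chi_bar_law F T n \<Omega> (sample \<xi>')) - (\<integral>x. f x \<partial>chi_bar_law F T n \<Omega> (sample \<xi>))\<bar> =
      ennreal (norm (\<integral>\<omega>. f (chi_path \<xi>' \<omega>) - f (chi_path \<xi> \<omega>) \<partial>\<Omega>))" by simp
  also have "\<dots> \<le> (\<integral>\<^sup>+\<omega>. ennreal (norm (f (chi_path \<xi>' \<omega>) - f (chi_path \<xi> \<omega>))) \<partial>\<Omega>)"
    using int by (intro integral_norm_bound_ennreal) auto
  also have "\<dots> \<le> (\<integral>\<^sup>+\<omega>. ?W \<omega> \<partial>\<Omega>)"
  proof (rule nn_integral_mono_AE)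
    show "AE \<omega> in \<Omega>. ennreal (norm (f (chi_path \<xi>' \<omega>) - f (chi_path \<xi> \<omega>))) \<le> ?W \<omega>"
      using AE_path_distance_le AE_space
    proof eventually_elim
      case (elim \<omega>)
      have "\<bar>f (chi_path \<xi>' \<omega>) - f (chi_path \<xi> \<omega>)\<bar> \<le> sup_dist T (chi_path \<xi>' \<omega>) (chi_path \<xi> \<omega>)"
        by (intro lip chi_bar_cadlag[OF \<Omega>.prob_space_axioms n sm(1) ip(1) elim(2)]
            chi_bar_cadlag[OF \<Omega>.prob_space_axioms n sm(2) ip(2) elim(2)])
      then show ?case using elim(1) by (simp add: ennreal_leI order_trans[OF ennreal_leI])
    qed
  qed
  also have "\<dots> \<le> ennreal (16 * exp (3 * (K * (8 * T) ^ CARD('d))) *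
      (sqrt (real J) * sqrt \<delta> + sqrt (real n / real J) * \<delta>))"
    by (rule nn_integral_path_distance_le[OF J])
  finally show "ennreal \<bar>(\<integral>x. f x \<partial>chi_bar_law F T n \<Omega> (sample \<xi>')) - (\<integral>x. f x \<partial>chi_bar_law F T n \<Omega> (sample \<xi>))\<bar> \<le>
    ennreal (16 * exp (3 * (K * (8 * T) ^ CARD('d))) *
      (sqrt (real J) * sqrt \<delta> + sqrt (real n / real J) * \<delta>))" .
qed

end

section \<open>Laws of the samples\<close>

theorem boot_wasserstein_le:
  fixes \<kappa> \<kappa>' :: "real ^ 'd \<Rightarrow> real"
  assumes \<kappa>: "unit_cube_density \<kappa>" and \<kappa>': "unit_cube_density \<kappa>'"
    and K: "AE x in lborel. \<kappa> x \<le> K" "AE x in lborel. \<kappa>' x \<le> K" "0 \<le> K"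
    and \<delta>: "AE x in lborel. \<bar>\<kappa>' x - \<kappa> x\<bar> \<le> \<delta>" "0 \<le> \<delta>"
    and n: "1 \<le> n" and J: "1 \<le> J" and T: "0 < T"
  shows "wasserstein_dist T (boot_law F s T n \<kappa>') (boot_law F s T n \<kappa>) \<le>
    ennreal (16 * exp (3 * (K * (8 * T) ^ CARD('d))) * (sqrt (real J) * sqrt \<delta> + sqrt (real n / real J) * \<delta>))"
proof -
  obtain Q :: "((real ^ 'd) \<times> real \<times> (real ^ 'd)) measure" and \<xi> \<xi>' where
    Q: "prob_space Q" and meas: "\<xi> \<in> borel_measurable Q" "\<xi>' \<in> borel_measurable Q"
    and law: "distr Q borel \<xi> = density lborel (\<lambda>x. ennreal (\<kappa> x))"
      "distr Q borel \<xi>' = density lborel (\<lambda>x. ennreal (\<kappa>' x))"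
    and differ: "emeasure Q {z \<in> space Q. \<xi> z \<noteq> \<xi>' z} \<le> ennreal \<delta>"
    using density_coupling[OF \<kappa> \<kappa>' \<delta>] .
  have "coupled_samples T n \<kappa> \<kappa>' Q \<xi> \<xi>' \<delta> K"
  proof (rule coupled_samples.intro)
    show "\<kappa> \<in> borel_measurable borel" "\<kappa>' \<in> borel_measurable borel"
      using \<kappa> \<kappa>' by (simp_all add: unit_cube_density_def)
  qed (fact T n Q meas law differ K \<delta>(2))+
  then interpret coupled_samples F s T n \<kappa> \<kappa>' Q \<xi> \<xi>' \<delta> K .
  have boot: "boot_law F s T n k = chi_bar_law F T n (sampling_space s n Q) (sample \<zeta>)"
    if k: "unit_cube_density k" and \<zeta>: "\<zeta> \<in> borel_measurable Q"
      and law: "distr Q borel \<zeta> = density lborel (\<lambda>x. ennreal (k x))" for k \<zeta>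
  proof -
    let ?R = "density lborel (\<lambda>x. ennreal (k x))"
    have R: "prob_space ?R"
      using k by (intro prob_spaceI) (auto simp: unit_cube_density_def emeasure_density)
    have id: "(\<lambda>x. x) \<in> borel_measurable ?R" "distr ?R borel (\<lambda>x. x) = ?R"
      by (auto intro!: distr_id2)
    have "chi_bar_law F T n (sampling_space s n ?R) (sample (\<lambda>x. x)) =
        chi_bar_law F T n (sampling_space s n Q) (sample \<zeta>)"
      using id law by (intro chi_bar_law_cong prob_space_sampling_space R Q n measurable_sample
          sample_law_cong integrable_pow_card_sample \<zeta>) auto
    then show ?thesis by (simp add: boot_law_def boot_space_eq boot_sample_eq)
  qed
  show ?thesis
    unfolding boot[OF \<kappa> meas(1) law(1)] boot[OF \<kappa>' meas(2) law(2)]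
    by (rule wasserstein_dist_coupled_le[OF J])
qed

lemma sampling_void_probability:
  fixes S :: "nat \<Rightarrow> 'w \<Rightarrow> (real ^ 'd) set"
  assumes M: "prob_space M" and \<kappa>: "unit_cube_density \<kappa>" and S: "sampling s M \<kappa> S" and n: "1 \<le> n"
  shows "S n \<in> M \<rightarrow>\<^sub>M config_space"
    and "B \<in> sets borel \<Longrightarrow> measure M {\<omega> \<in> space M. S n \<omega> \<inter> B = {}} =
      sample_size_pgf s n (measure (density lborel (\<lambda>x. ennreal (\<kappa> x))) (- B))"
proof -
  interpret prob_space M by (rule M)
  let ?R = "density lborel (\<lambda>x. ennreal (\<kappa> x))"
  have [measurable]: "\<kappa> \<in> borel_measurable borel" and \<kappa>0: "0 \<le> \<kappa> x" for x
    using \<kappa> by (auto simp: unit_cube_density_def)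
  interpret R: prob_space ?R
    using \<kappa> by (intro prob_spaceI) (auto simp: unit_cube_density_def emeasure_density)
  have "S n \<in> M \<rightarrow>\<^sub>M config_space \<and> (B \<in> sets borel \<longrightarrow>
      measure M {\<omega> \<in> space M. S n \<omega> \<inter> B = {}} = sample_size_pgf s n (measure ?R (- B)))"
  proof (cases s)
    case Poisson
    then have P: "poisson_process M (\<lambda>x. real n * \<kappa> x) (S n)" using S n by simp
    then have meas: "S n \<in> M \<rightarrow>\<^sub>M config_space" by (simp add: poisson_process_def)
    have fin: "finite (S n \<omega>)" if "\<omega> \<in> space M" for \<omega>
      using measurable_space[OF meas that] by (simp add: space_config_space)
    have "measure M {\<omega> \<in> space M. S n \<omega> \<inter> B = {}} = sample_size_pgf s n (measure ?R (- B))"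
      if [measurable]: "B \<in> sets borel"
    proof -
      let ?r = "measure (density lborel (\<lambda>x. ennreal (real n * \<kappa> x))) B"
      have "emeasure (density lborel (\<lambda>x. ennreal (real n * \<kappa> x))) B = ennreal (real n) * emeasure ?R B"
        using \<kappa>0 by (simp add: emeasure_density ennreal_mult mult.assoc nn_integral_cmult)
      then have r: "?r = real n * measure ?R B"
        by (simp add: measure_def enn2real_mult)
      have "{\<omega> \<in> space M. S n \<omega> \<inter> B = {}} = {\<omega> \<in> space M. card (S n \<omega> \<inter> B) = 0}"
        using fin by auto
      moreover have "measure M {\<omega> \<in> space M. card (S n \<omega> \<inter> B) = 0} = ?r ^ 0 / fact 0 * exp (- ?r)"
        using P that unfolding poisson_process_def by (auto simp: Let_def)
      moreover have "measure ?R (- B) = 1 - measure ?R B"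
        using R.prob_compl[of B] by (simp add: Compl_eq_Diff_UNIV)
      ultimately show ?thesis
        unfolding r by (simp add: sample_size_pgf_def Poisson)
    qed
    then show ?thesis using meas by blast
  next
    case Binomial
    then obtain X :: "nat \<Rightarrow> 'w \<Rightarrow> real ^ 'd" where
      ind: "indep_vars (\<lambda>_. borel) X {1..}" and
      dist: "\<And>i. 1 \<le> i \<Longrightarrow> distributed M lborel (X i) (\<lambda>x. ennreal (\<kappa> x))" and
      eq: "\<And>\<omega>. \<omega> \<in> space M \<Longrightarrow> S n \<omega> = (\<lambda>i. X i \<omega>) ` {1..n}"
      using S n by auto
    have X [measurable]: "X i \<in> borel_measurable M" if "1 \<le> i" for i
      using distributed_measurable[OF dist[OF that]] by simp
    have void: "{\<omega> \<in> space M. S n \<omega> \<inter> B = {}} = (\<Inter>i\<in>{1..n}. X i -` (- B) \<inter> space M)" for B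
      using eq n by auto
    have sets: "{\<omega> \<in> space M. S n \<omega> \<inter> B = {}} \<in> sets M" if [measurable]: "B \<in> sets borel" for B
      unfolding void using n by (intro sets.finite_INT measurable_sets[OF X]) auto
    have "S n \<in> M \<rightarrow>\<^sub>M config_space"
      by (rule measurable_config_spaceI) (use eq sets in auto)
    moreover have "measure M {\<omega> \<in> space M. S n \<omega> \<inter> B = {}} = sample_size_pgf s n (measure ?R (- B))"
      if [measurable]: "B \<in> sets borel"
    proof -
      have "prob (\<Inter>i\<in>{1..n}. X i -` (- B) \<inter> space M) = (\<Prod>i\<in>{1..n}. prob (X i -` (- B) \<inter> space M))"
        using n by (intro indep_varsD[OF ind]) auto
      also have "\<dots> = (\<Prod>i\<in>{1..n}. measure ?R (- B))"
      proof (intro prod.cong refl)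
        fix i assume "i \<in> {1..n}"
        then have i: "1 \<le> i" by simp
        have "prob (X i -` (- B) \<inter> space M) = measure (distr M lborel (X i)) (- B)"
          using X[OF i] by (intro measure_distr[symmetric]) auto
        then show "prob (X i -` (- B) \<inter> space M) = measure ?R (- B)"
          by (simp add: distributed_distr_eq_density[OF dist[OF i]])
      qed
      finally show ?thesis unfolding void by (simp add: sample_size_pgf_def Binomial)
    qed
    ultimately show ?thesis by blast
  qed
  then show "S n \<in> M \<rightarrow>\<^sub>M config_space"
    "B \<in> sets borel \<Longrightarrow> measure M {\<omega> \<in> space M. S n \<omega> \<inter> B = {}} = sample_size_pgf s n (measure ?R (- B))"
    by blast+
qed

theorem chi_bar_law_sampling:
  fixes S :: "nat \<Rightarrow> 'w \<Rightarrow> (real ^ 'd) set"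
  assumes M: "prob_space M" and \<kappa>: "unit_cube_density \<kappa>" and S: "sampling s M \<kappa> S" and n: "1 \<le> n"
  shows "chi_bar_law F T n M (S n) = boot_law F s T n \<kappa>"
proof -
  let ?R = "density lborel (\<lambda>x. ennreal (\<kappa> x))"
  have R: "prob_space ?R"
    using \<kappa> by (intro prob_spaceI) (auto simp: unit_cube_density_def emeasure_density)
  have id: "(\<lambda>x. x) \<in> borel_measurable ?R" "distr ?R borel (\<lambda>x. x) = ?R"
    by (auto intro!: distr_id2)
  note Sn = sampling_void_probability[OF M \<kappa> S n]
  have "distr (sampling_space s n ?R) config_space (sample (\<lambda>x. x)) = distr M config_space (S n)"
    using void_probability_sample[OF R id(1) n] id(2) Sn(2)
    by (intro config_law_eq_if_void_probabilities_eq prob_space_sampling_space R M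
        measurable_sample id Sn(1)) simp
  then have "chi_bar_law F T n (sampling_space s n ?R) (sample (\<lambda>x. x)) = chi_bar_law F T n M (S n)"
    by (intro chi_bar_law_cong prob_space_sampling_space R M n measurable_sample id Sn(1)
        integrable_pow_card_sample)
  then show ?thesis by (simp add: boot_law_def boot_space_eq boot_sample_eq)
qed

section \<open>Modes of convergence\<close>

text \<open>This includes \<open>b = 0\<close>, where the inverse is \<open>\<infinity>\<close>: then \<open>w = 0\<close>, and \<open>\<infinity> \<sqdot> 0 = 0\<close>.\<close>

lemma inverse_rate_times_le:
  assumes "0 \<le> b" "0 \<le> C" "w \<le> ennreal (C * b)"
  shows "inverse (ennreal b) * w \<le> ennreal C"
proof (cases "b = 0")
  case True
  then show ?thesis using assms by simp
next
  case False
  have "inverse (ennreal b) * w \<le> inverse (ennreal b) * ennreal (C * b)"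
    by (intro mult_left_mono assms) simp
  also have "\<dots> = ennreal C"
    using False assms by (simp add: inverse_ennreal ennreal_mult[symmetric])
  finally show ?thesis .
qed

lemma boot_rate_infinite: "0 < J \<Longrightarrow> boot_rate n J \<infinity> = \<infinity>"
  by (simp add: boot_rate_def ennreal_sqrt_def ennreal_mult_top)

lemma boot_rate_finite:
  "0 \<le> e \<Longrightarrow> boot_rate n J (ennreal e) = ennreal (sqrt (real J) * sqrt e + sqrt (real n / real J) * e)"
  by (simp add: boot_rate_def ennreal_sqrt_def ennreal_mult)

lemma Linf_norm_bound:
  assumes [measurable]: "f \<in> borel_measurable borel" and "Linf_norm f = ennreal e" "0 \<le> e"
  shows "AE x in lborel. \<bar>f x\<bar> \<le> e"
proof -
  have "AE x in lborel. ennreal \<bar>f x\<bar> \<le> Linf_norm f"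
    unfolding Linf_norm_def by (rule esssup_AE)
  then show ?thesis using assms by (auto elim!: eventually_mono)
qed

text \<open>The norm exceeds \<open>y\<close> iff the set where the function exceeds \<open>y\<close> has positive Lebesgue measure, and
that measure depends measurably on \<open>\<omega>\<close> by Tonelli's theorem.\<close>

lemma borel_measurable_Linf_norm:
  fixes f :: "'w \<Rightarrow> real ^ 'd \<Rightarrow> real"
  assumes [measurable]: "(\<lambda>(\<omega>, x). f \<omega> x) \<in> borel_measurable (M \<Otimes>\<^sub>M borel)"
  shows "(\<lambda>\<omega>. Linf_norm (f \<omega>)) \<in> borel_measurable M"
proof (rule borel_measurableI_greater)
  fix y :: ennreal
  have sec: "f \<omega> \<in> borel_measurable borel" if "\<omega> \<in> space M" for \<omega>
    using measurable_Pair2[OF assms that] by simp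
  define h where "h = (\<lambda>(\<omega>, x). indicator {p \<in> space (M \<Otimes>\<^sub>M (lborel :: (real ^ 'd) measure)).
    y < ennreal \<bar>f (fst p) (snd p)\<bar>} (\<omega>, x) :: ennreal)"
  have fm [measurable]: "(\<lambda>p. f (fst p) (snd p)) \<in> borel_measurable (M \<Otimes>\<^sub>M lborel)"
    using assms by (simp add: case_prod_beta cong: measurable_cong_sets)
  have [measurable]: "h \<in> borel_measurable (M \<Otimes>\<^sub>M lborel)"
    unfolding h_def by (simp add: case_prod_beta)
  have "{\<omega> \<in> space M. y < Linf_norm (f \<omega>)} = {\<omega> \<in> space M. (\<integral>\<^sup>+x. h (\<omega>, x) \<partial>lborel) \<noteq> 0}"
  proof (intro Collect_cong conj_cong refl)
    fix \<omega> assume \<omega>: "\<omega> \<in> space M"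
    note [measurable] = sec[OF \<omega>]
    have "(\<integral>\<^sup>+x. h (\<omega>, x) \<partial>lborel) = 0 \<longleftrightarrow> (AE x in lborel. h (\<omega>, x) = 0)"
    proof (rule nn_integral_0_iff_AE)
      show "(\<lambda>x. h (\<omega>, x)) \<in> borel_measurable lborel"
        using \<omega> by measurable
    qed
    also have "\<dots> \<longleftrightarrow> (AE x in lborel. ennreal \<bar>f \<omega> x\<bar> \<le> y)"
      using \<omega> by (intro AE_cong) (auto simp: h_def indicator_def space_pair_measure not_less)
    also have "\<dots> \<longleftrightarrow> Linf_norm (f \<omega>) \<le> y"
    proof
      show "AE x in lborel. ennreal \<bar>f \<omega> x\<bar> \<le> y \<Longrightarrow> Linf_norm (f \<omega>) \<le> y"
        unfolding Linf_norm_def by (rule esssup_I) measurable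
      assume le: "Linf_norm (f \<omega>) \<le> y"
      have "AE x in lborel. ennreal \<bar>f \<omega> x\<bar> \<le> Linf_norm (f \<omega>)"
        unfolding Linf_norm_def by (rule esssup_AE)
      then show "AE x in lborel. ennreal \<bar>f \<omega> x\<bar> \<le> y"
        using le by (auto elim!: eventually_mono)
    qed
    finally show "y < Linf_norm (f \<omega>) \<longleftrightarrow> (\<integral>\<^sup>+x. h (\<omega>, x) \<partial>lborel) \<noteq> 0" by auto
  qed
  moreover have "(\<lambda>\<omega>. \<integral>\<^sup>+x. h (\<omega>, x) \<partial>lborel) \<in> borel_measurable M"
    by (rule lborel.borel_measurable_nn_integral_fst) measurable
  ultimately show "{\<omega> \<in> space M. y < Linf_norm (f \<omega>)} \<in> sets M"
    by simp
qed

text \<open>A single random variable is tight. This handles the finitely many stages at which a sequence that converges in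
probability is not yet small.\<close>

lemma (in prob_space) ex_tail_probability_le:
  assumes [measurable]: "Y \<in> borel_measurable M" and "0 < \<epsilon>"
  shows "\<exists>c::real. emeasure M {\<omega> \<in> space M. c < Y \<omega>} \<le> ennreal \<epsilon>"
proof -
  let ?X = "\<lambda>m::nat. {\<omega> \<in> space M. real m < Y \<omega>}"
  have "(\<lambda>m. measure M (?X m)) \<longlonglongrightarrow> measure M (\<Inter>m. ?X m)"
    by (rule finite_Lim_measure_decseq) (auto simp: decseq_def)
  also have "(\<Inter>m. ?X m) = {}"
  proof -
    have "\<exists>m. \<not> real m < Y \<omega>" for \<omega>
      using reals_Archimedean2[of "Y \<omega>"] by (meson not_less_iff_gr_or_eq)
    then show ?thesis by auto
  qed
  finally have "(\<lambda>m. measure M (?X m)) \<longlonglongrightarrow> 0" by simp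
  then have "\<forall>\<^sub>F m in sequentially. measure M (?X m) < \<epsilon>"
    by (rule order_tendstoD) fact
  then obtain m where "measure M (?X m) < \<epsilon>" by (auto simp: eventually_sequentially)
  then show ?thesis
    by (intro exI[of _ "real m"]) (simp add: emeasure_eq_measure ennreal_leI)
qed

theorem theorem3p6:
  fixes F :: filtration and s :: scheme and md :: convergence_mode
    and M :: "'w measure" and T :: real
    and \<kappa> :: "real ^ 'd \<Rightarrow> real"
    and S :: "nat \<Rightarrow> 'w \<Rightarrow> (real ^ 'd) set"
    and est :: "nat \<Rightarrow> (real ^ 'd) set \<Rightarrow> real ^ 'd \<Rightarrow> real"
    and kh :: "nat \<Rightarrow> 'w \<Rightarrow> real ^ 'd \<Rightarrow> real"
    and J :: "nat \<Rightarrow> nat"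
    and err :: "nat \<Rightarrow> 'w \<Rightarrow> ennreal"
  defines "kh \<equiv> \<lambda>n \<omega>. est n (S n \<omega>)"
    and "err \<equiv> \<lambda>n \<omega>. Linf_norm (\<lambda>x. kh n \<omega> x - \<kappa> x)"
  assumes "prob_space M" and "0 < T"
    and "unit_cube_density \<kappa>" and "Linf_norm \<kappa> < \<infinity>"
    and "sampling s M \<kappa> S"
    and "\<And>n. n \<ge> 1 \<Longrightarrow> (\<lambda>(c, x). est n c x) \<in> borel_measurable (config_space \<Otimes>\<^sub>M borel)"
    and "\<And>n. n \<ge> 1 \<Longrightarrow> AE \<omega> in M. unit_cube_density (kh n \<omega>)"
    and "tendsto_zero md M err"
    and "\<And>n. n \<ge> 1 \<Longrightarrow> 0 < J n" and "filterlim J at_top sequentially"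
    and "tendsto_zero md M (\<lambda>n \<omega>. ennreal (real (J n)) * err n \<omega>)"
    and "tendsto_zero md M (\<lambda>n \<omega>. ennreal (sqrt (real n / real (J n))) * err n \<omega>)"
  shows "stochastically_bounded md M
     (\<lambda>n \<omega>. inverse (boot_rate n (J n) (err n \<omega>)) *
        wasserstein_dist T (boot_law F s T n (kh n \<omega>)) (chi_bar_law F T n M (S n)))"
proof -
  interpret prob_space M by fact
  note T = \<open>0 < T\<close> and \<kappa> = \<open>unit_cube_density \<kappa>\<close>
  have [measurable]: "\<kappa> \<in> borel_measurable borel" and \<kappa>0: "0 \<le> \<kappa> x" for x
    using \<kappa> by (auto simp: unit_cube_density_def)
  define K where "K = enn2real (Linf_norm \<kappa>)"
  have K0: "0 \<le> K" by (simp add: K_def)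
  have \<kappa>K: "AE x in lborel. \<bar>\<kappa> x\<bar> \<le> K"
    using \<open>Linf_norm \<kappa> < \<infinity>\<close> by (intro Linf_norm_bound) (auto simp: K_def)
  define C where "C e = 16 * exp (3 * ((K + e) * (8 * T) ^ CARD('d)))" for e
  have C_mono: "C e \<le> C e'" if "e \<le> e'" for e e'
    using that T unfolding C_def by (simp add: mult_right_mono)
  define Z where "Z n \<omega> = inverse (boot_rate n (J n) (err n \<omega>)) *
      wasserstein_dist T (boot_law F s T n (kh n \<omega>)) (chi_bar_law F T n M (S n))" for n \<omega>
  have Z_le: "Z n \<omega> \<le> ennreal (C (enn2real (err n \<omega>)))"
    if n: "1 \<le> n" and kh: "unit_cube_density (kh n \<omega>)" for n \<omega>
  proof (cases "err n \<omega>")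
    case top
    then show ?thesis
      using boot_rate_infinite[of "J n" n] assms(11)[OF n] by (simp add: Z_def)
  next
    case (real e)
    have [measurable]: "kh n \<omega> \<in> borel_measurable borel"
      using kh by (simp add: unit_cube_density_def)
    have dist: "AE x in lborel. \<bar>kh n \<omega> x - \<kappa> x\<bar> \<le> e"
      using real by (intro Linf_norm_bound) (auto simp: err_def)
    have bounds: "AE x in lborel. \<kappa> x \<le> K + e" "AE x in lborel. kh n \<omega> x \<le> K + e"
      using \<kappa>K dist by (eventually_elim, use real(1) in linarith)+
    have "wasserstein_dist T (boot_law F s T n (kh n \<omega>)) (boot_law F s T n \<kappa>) \<le>
        ennreal (C e * (sqrt (real (J n)) * sqrt e + sqrt (real n / real (J n)) * e))"
      unfolding C_def using assms(11)[OF n] K0 real(1)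
      by (intro boot_wasserstein_le \<kappa> kh bounds dist n T) auto
    then show ?thesis
      unfolding Z_def chi_bar_law_sampling[OF \<open>prob_space M\<close> \<kappa> \<open>sampling s M \<kappa> S\<close> n] real(2)
        boot_rate_finite[OF real(1)]
      using real(1) by (intro inverse_rate_times_le) (auto simp: C_def)
  qed
  have "stochastically_bounded md M Z"
  proof (cases md)
    case Almost_surely
    have "AE \<omega> in M. \<forall>n. 1 \<le> n \<longrightarrow> unit_cube_density (kh n \<omega>)"
      using assms(9) by (simp add: AE_all_countable)
    moreover have "AE \<omega> in M. (\<lambda>n. err n \<omega>) \<longlonglongrightarrow> 0"
      using assms(10) Almost_surely by simp
    ultimately have "AE \<omega> in M. \<exists>c::real. \<forall>n\<ge>1. Z n \<omega> \<le> ennreal c"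
    proof eventually_elim
      case (elim \<omega>)
      have "\<forall>\<^sub>F n in sequentially. err n \<omega> < 1"
        by (rule order_tendstoD(2)[OF elim(2)]) simp
      then obtain N where N: "\<And>n. N \<le> n \<Longrightarrow> err n \<omega> < 1"
        by (auto simp: eventually_sequentially)
      define e where "e = Max (insert 1 ((\<lambda>n. enn2real (err n \<omega>)) ` {..<N}))"
      have "enn2real (err n \<omega>) \<le> e" for n
      proof (cases "n < N")
        case True
        then show ?thesis unfolding e_def by (intro Max_ge) auto
      next
        case False
        then have "enn2real (err n \<omega>) \<le> enn2real 1"
          using N[of n] by (intro enn2real_mono) auto
        also have "\<dots> \<le> e" unfolding e_def by (intro Max_ge) auto
        finally show ?thesis .
      qed
      then have "Z n \<omega> \<le> ennreal (C e)" if "1 \<le> n" for n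
        using Z_le[OF that, of \<omega>] elim(1) that C_mono ennreal_leI order_trans by meson
      then show ?case by blast
    qed
    then show ?thesis using Almost_surely by simp
  next
    case In_probability
    have err_measurable: "err n \<in> borel_measurable M" if n: "1 \<le> n" for n
      unfolding err_def
    proof (rule borel_measurable_Linf_norm)
      have [measurable]: "S n \<in> M \<rightarrow>\<^sub>M config_space"
        by (rule sampling_void_probability(1)[OF \<open>prob_space M\<close> \<kappa> \<open>sampling s M \<kappa> S\<close> n])
      have "(\<lambda>p. (S n (fst p), snd p)) \<in> M \<Otimes>\<^sub>M borel \<rightarrow>\<^sub>M config_space \<Otimes>\<^sub>M borel"
        by measurable
      from measurable_compose[OF this assms(8)[OF n]]
      have "(\<lambda>p. est n (S n (fst p)) (snd p)) \<in> borel_measurable (M \<Otimes>\<^sub>M borel)" by simp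
      then show "(\<lambda>(\<omega>, x). kh n \<omega> x - \<kappa> x) \<in> borel_measurable (M \<Otimes>\<^sub>M borel)"
        unfolding kh_def case_prod_beta by measurable
    qed
    have tail: "outer_measure_of M {\<omega> \<in> space M. ennreal (C c) < Z n \<omega>} \<le>
        emeasure M {\<omega> \<in> space M. c < enn2real (err n \<omega>)}" if n: "1 \<le> n" for n c
    proof -
      note [measurable] = err_measurable[OF n]
      obtain N where N: "N \<in> null_sets M" "{\<omega> \<in> space M. \<not> unit_cube_density (kh n \<omega>)} \<subseteq> N"
        using assms(9)[OF n] unfolding eventually_ae_filter by auto
      let ?E = "{\<omega> \<in> space M. c < enn2real (err n \<omega>)}"
      have E: "?E \<in> sets M" by measurable
      have "{\<omega> \<in> space M. ennreal (C c) < Z n \<omega>} \<subseteq> ?E \<union> N"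
      proof
        fix \<omega> assume \<omega>: "\<omega> \<in> {\<omega> \<in> space M. ennreal (C c) < Z n \<omega>}"
        show "\<omega> \<in> ?E \<union> N"
        proof (rule ccontr)
          assume "\<omega> \<notin> ?E \<union> N"
          then have "unit_cube_density (kh n \<omega>)" "enn2real (err n \<omega>) \<le> c" using \<omega> N(2) by auto
          then have "Z n \<omega> \<le> ennreal (C c)"
            using Z_le[OF n] C_mono ennreal_leI order_trans by meson
          then show False using \<omega> by auto
        qed
      qed
      then have "outer_measure_of M {\<omega> \<in> space M. ennreal (C c) < Z n \<omega>} \<le> outer_measure_of M (?E \<union> N)"
        by (rule outer_measure_of_mono)
      also have "\<dots> = emeasure M (?E \<union> N)" using E N(1) by (intro outer_measure_of_eq) auto
      also have "\<dots> = emeasure M ?E" using E N(1) by (rule emeasure_Un_null_set)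
      finally show ?thesis .
    qed
    have "\<exists>c::real. \<forall>n\<ge>1. outer_measure_of M {\<omega> \<in> space M. ennreal c < Z n \<omega>} \<le> ennreal \<epsilon>"
      if "0 < \<epsilon>" for \<epsilon> :: real
    proof -
      have "(\<lambda>n. outer_measure_of M {\<omega> \<in> space M. ennreal 1 < err n \<omega>}) \<longlonglongrightarrow> 0"
      proof -
        have "\<forall>\<epsilon>>0. (\<lambda>n. outer_measure_of M {\<omega> \<in> space M. ennreal \<epsilon> < err n \<omega>}) \<longlonglongrightarrow> 0"
          using assms(10) In_probability by simp
        from spec[OF this, of 1] show ?thesis by (simp del: ennreal_1)
      qed
      then have "\<forall>\<^sub>F n in sequentially. outer_measure_of M {\<omega> \<in> space M. ennreal 1 < err n \<omega>} < ennreal \<epsilon>"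
        using \<open>0 < \<epsilon>\<close> by (intro order_tendstoD) auto
      then obtain N where N: "\<And>n. N \<le> n \<Longrightarrow> outer_measure_of M {\<omega> \<in> space M. ennreal 1 < err n \<omega>} < ennreal \<epsilon>"
        by (auto simp: eventually_sequentially)
      have "\<exists>c::real. emeasure M {\<omega> \<in> space M. c < enn2real (err n \<omega>)} \<le> ennreal \<epsilon>" if "1 \<le> n" for n
        using err_measurable[OF that] \<open>0 < \<epsilon>\<close> by (intro ex_tail_probability_le) auto
      then obtain c where c: "\<And>n. 1 \<le> n \<Longrightarrow> emeasure M {\<omega> \<in> space M. c n < enn2real (err n \<omega>)} \<le> ennreal \<epsilon>"
        by metis
      define e where "e = Max (insert 1 (c ` {..<N}))"
      have "outer_measure_of M {\<omega> \<in> space M. ennreal (C e) < Z n \<omega>} \<le> ennreal \<epsilon>" if n: "1 \<le> n" for n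
      proof -
        note [measurable] = err_measurable[OF n]
        have "emeasure M {\<omega> \<in> space M. e < enn2real (err n \<omega>)} \<le> ennreal \<epsilon>"
        proof (cases "n < N")
          case True
          then have "c n \<le> e" unfolding e_def by (intro Max_ge) auto
          then have "emeasure M {\<omega> \<in> space M. e < enn2real (err n \<omega>)} \<le>
              emeasure M {\<omega> \<in> space M. c n < enn2real (err n \<omega>)}"
            by (intro emeasure_mono) auto
          then show ?thesis using c[OF n] by simp
        next
          case False
          have "1 \<le> e" unfolding e_def by (intro Max_ge) auto
          have "1 < err n \<omega>" if "e < enn2real (err n \<omega>)" for \<omega>
          proof (rule ccontr)
            assume "\<not> 1 < err n \<omega>"
            then have "enn2real (err n \<omega>) \<le> enn2real 1" by (intro enn2real_mono) auto
            then show False using that \<open>1 \<le> e\<close> by simp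
          qed
          then have "emeasure M {\<omega> \<in> space M. e < enn2real (err n \<omega>)} \<le>
              emeasure M {\<omega> \<in> space M. ennreal 1 < err n \<omega>}"
            by (intro emeasure_mono) auto
          also have "\<dots> = outer_measure_of M {\<omega> \<in> space M. ennreal 1 < err n \<omega>}"
            by (rule outer_measure_of_eq[symmetric]) measurable
          finally show ?thesis using N[of n] False by simp
        qed
        then show ?thesis using tail[OF n, of e] by simp
      qed
      then show ?thesis by blast
    qed
    then show ?thesis using In_probability by simp
  qed
  then show ?thesis unfolding Z_def .
qed

end
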